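(* Let $(\mathbf X_t)$ be the causal stationary $\mathbb R^d$-valued solution of $\mathbf X_t=\mathbf A_t\mathbf X_{t-1}+\mathbf B_t$, $t\in\mathbb Z$, under the conditions (K1)–(K7) listed in the context, with $\alpha>0$ the index in (K7). Let $p>\alpha/2$ and let $(x_n)$ be a sequence for which there exists $\kappa'>0$ with $n/x_n^{p\wedge(\alpha-\kappa')}\to0$ as $n\to\infty$. Then $(x_n)$ satisfies the following two conditions: for all $\epsilon>0$, $$\lim_{s\to\infty}\limsup_{n\to\infty}\mathbb P\big(\|\mathbf X_{[s,n]}\|_\infty>\epsilon x_n\,\big|\,|\mathbf X_1|>\epsilon x_n\big)=0,$$ and for all $\delta>0$, $$\lim_{\epsilon\downarrow0}\limsup_{n\to\infty}\frac{\mathbb P\big(\sum_{t=1}^n|\mathbf X_t/x_n|^p\mathbf 1(|\mathbf X_t|\le\epsilon x_n)>\delta\big)}{n\,\mathbb P(|\mathbf X_1|>x_n)}=0.$$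
   Context: $|\cdot|$ is a norm on $\mathbb R^d$; $\mathbf X_{[s,n]}=(\mathbf X_t)_{s\le t\le n}$, $\|\mathbf X_{[s,n]}\|_\infty=\max_{s\le t\le n}|\mathbf X_t|$; $|\mathbf A|_{op}=\sup_{|\mathbf x|=1}|\mathbf A\mathbf x|$. $((\mathbf A_t,\mathbf B_t))$ is an iid sequence with generic element $(\mathbf A,\mathbf B)$, $\mathbf A$ a random $d\times d$ matrix with non-negative entries, $\mathbf B$ a random vector in $\mathbb R^d$ with non-negative entries. Conditions: (K1) $\mathbb E[\log^+|\mathbf A|_{op}]+\mathbb E[\log^+|\mathbf B|]<\infty$; (K2) the Lyapunov exponent $\gamma=\lim_n n^{-1}\log|\mathbf A_n\cdots\mathbf A_1|_{op}$ is $<0$ a.s.; (K3) $\mathbf B\ne\mathbf 0$ a.s. and $\mathbf A$ has no zero rows a.s.; (K4) there is $\kappa>0$ with $\mathbb E[|\mathbf A|_{op}^\kappa]<1$; (K5) the set $\{\log|\mathbf a_n\cdots\mathbf a_1|_{op}:n\ge1,\ \mathbf a_n\cdots\mathbf a_1>0,\ \mathbf a_n,\dots,\mathbf a_1\text{ in the support of the law of }\mathbf A\}$ generates a dense group in $\mathbb R$; (K6) there is $\kappa_1>0$ with $\mathbb E[(\min_{i=1,\dots,d}\sum_{j=1}^dA_{ij})^{\kappa_1}]\ge d^{\kappa_1/2}$ and $\mathbb E[|\mathbf A|_{op}^{\kappa_1}\log^+|\mathbf A|_{op}]<\infty$; (K7) $\alpha>0$ is the (then unique) solution of $\lim_n n^{-1}\log\mathbb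 E[|\mathbf A_n\cdots\mathbf A_1|_{op}^\alpha]=0$, $\mathbb E[|\mathbf B|^\alpha]<\infty$, and if $d>1$, $\alpha$ is not an even integer. Under these conditions a unique causal stationary solution exists, $\mathbf X_t=\sum_{i\ge0}\mathbf A_t\cdots\mathbf A_{t-i+1}\mathbf B_{t-i}$, and all its finite-dimensional vectors are multivariate regularly varying with index $\alpha$.
   Formalization: The constant κ' is required to satisfy κ' < α (with x_n > 0 for n ≥ 1); for κ' > α the growth condition forces x_n → 0 and the first limit equals 1 instead of 0, while κ' = α is impossible. *)

theory Defs
  imports
    "HOL-Probability.Probability"
    "HOL-Computational_Algebra.Group_Closure"
begin

text \<open>
  The norm on the state space is an arbitrary one, not the Euclidean norm that the type
  \<open>real^'d\<close> carries, so it is a parameter \<open>N\<close> of everything below.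
\<close>

definition is_norm :: "('a::real_vector \<Rightarrow> real) \<Rightarrow> bool" where
  "is_norm N \<longleftrightarrow>
     (\<forall>x. N x = 0 \<longleftrightarrow> x = 0) \<and>
     (\<forall>c x. N (c *\<^sub>R x) = \<bar>c\<bar> * N x) \<and>
     (\<forall>x y. N (x + y) \<le> N x + N y)"

definition op_norm :: "(real^'d \<Rightarrow> real) \<Rightarrow> real^'d^'d \<Rightarrow> real" where
  "op_norm N a = (SUP x\<in>{x. N x = 1}. N (a *v x))"

text \<open>\<open>left_prod a n = a n ** \<dots> ** a 1\<close>; the entry \<open>a 0\<close> is not used.\<close>

primrec left_prod :: "(nat \<Rightarrow> real^'d^'d) \<Rightarrow> nat \<Rightarrow> real^'d^'d" where
  "left_prod a 0 = mat 1"
| "left_prod a (Suc n) = a (Suc n) ** left_prod a n"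

text \<open>Since \<open>ln 0 = 0\<close> for the real logarithm, \<open>log_plus 0 = 0\<close> as it should be.\<close>

definition log_plus :: "real \<Rightarrow> real" where
  "log_plus x = max 0 (ln x)"

definition ext_log :: "ennreal \<Rightarrow> ereal" where
  "ext_log x = (if x = 0 then - \<infinity> else if x = \<infinity> then \<infinity> else ereal (ln (enn2real x)))"

definition iid_sequence :: "'w measure \<Rightarrow> (int \<Rightarrow> 'w \<Rightarrow> 'b::topological_space) \<Rightarrow> bool" where
  "iid_sequence M Y \<longleftrightarrow>
     prob_space.indep_vars M (\<lambda>_. borel) Y UNIV \<and>
     (\<forall>t. distr M borel (Y t) = distr M borel (Y 0))"

definition measure_support :: "'b::topological_space measure \<Rightarrow> 'b set" where
  "measure_support \<mu> = {a. \<forall>U. open U \<longrightarrow> a \<in> U \<longrightarrow> emeasure \<mu> U > 0}"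

text \<open>
  In the conditions on the generic element, \<open>A\<close> and \<open>B\<close> are single random variables; in those
  involving products, \<open>A\<close> is the whole sequence. Expectations of non-negative quantities are
  \<open>ennreal\<close>-valued integrals, so that no integrability convention enters.
\<close>

definition nonneg_entries ::
  "'w measure \<Rightarrow> ('w \<Rightarrow> real^'d^'d) \<Rightarrow> ('w \<Rightarrow> real^'d) \<Rightarrow> bool" where
  "nonneg_entries M A B \<longleftrightarrow>
     (AE \<omega> in M. (\<forall>i j. 0 \<le> A \<omega> $ i $ j) \<and> (\<forall>i. 0 \<le> B \<omega> $ i))"

definition K1 ::
  "'w measure \<Rightarrow> (real^'d \<Rightarrow> real) \<Rightarrow> ('w \<Rightarrow> real^'d^'d) \<Rightarrow> ('w \<Rightarrow> real^'d) \<Rightarrow> bool" where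
  "K1 M N A B \<longleftrightarrow>
     (\<integral>\<^sup>+\<omega>. ennreal (log_plus (op_norm N (A \<omega>))) \<partial>M) +
     (\<integral>\<^sup>+\<omega>. ennreal (log_plus (N (B \<omega>))) \<partial>M) < \<infinity>"

text \<open>The Lyapunov exponent is extended real because it may be \<open>-\<infinity>\<close>.\<close>

definition K2 ::
  "'w measure \<Rightarrow> (real^'d \<Rightarrow> real) \<Rightarrow> (int \<Rightarrow> 'w \<Rightarrow> real^'d^'d) \<Rightarrow> bool" where
  "K2 M N A \<longleftrightarrow>
     (\<exists>\<gamma>::ereal. \<gamma> < 0 \<and>
        (AE \<omega> in M.
           (\<lambda>n. ext_log (ennreal (op_norm N (left_prod (\<lambda>k. A (int k) \<omega>) n))) / ereal (real n))
             \<longlonglongrightarrow> \<gamma>))"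

definition K3 :: "'w measure \<Rightarrow> ('w \<Rightarrow> real^'d^'d) \<Rightarrow> ('w \<Rightarrow> real^'d) \<Rightarrow> bool" where
  "K3 M A B \<longleftrightarrow> (AE \<omega> in M. B \<omega> \<noteq> 0) \<and> (AE \<omega> in M. \<forall>i. row i (A \<omega>) \<noteq> 0)"

definition K4 :: "'w measure \<Rightarrow> (real^'d \<Rightarrow> real) \<Rightarrow> ('w \<Rightarrow> real^'d^'d) \<Rightarrow> bool" where
  "K4 M N A \<longleftrightarrow> (\<exists>\<kappa>>0. (\<integral>\<^sup>+\<omega>. ennreal (op_norm N (A \<omega>) powr \<kappa>) \<partial>M) < 1)"

definition K5 :: "'w measure \<Rightarrow> (real^'d \<Rightarrow> real) \<Rightarrow> ('w \<Rightarrow> real^'d^'d) \<Rightarrow> bool" where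
  "K5 M N A \<longleftrightarrow>
     closure (group_closure
       {ln (op_norm N (left_prod a n)) | a n.
          1 \<le> n \<and> (\<forall>i j. 0 < left_prod a n $ i $ j) \<and>
          (\<forall>k\<in>{1..n}. a k \<in> measure_support (distr M borel A))}) = (UNIV :: real set)"

definition K6 :: "'w measure \<Rightarrow> (real^'d \<Rightarrow> real) \<Rightarrow> ('w \<Rightarrow> real^'d^'d) \<Rightarrow> bool" where
  "K6 M N A \<longleftrightarrow>
     (\<exists>\<kappa>\<^sub>1>0.
        (\<integral>\<^sup>+\<omega>. ennreal ((MIN i. \<Sum>j\<in>UNIV. A \<omega> $ i $ j) powr \<kappa>\<^sub>1) \<partial>M)
          \<ge> ennreal (real CARD('d) powr (\<kappa>\<^sub>1 / 2)) \<and>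
        (\<integral>\<^sup>+\<omega>. ennreal (op_norm N (A \<omega>) powr \<kappa>\<^sub>1 * log_plus (op_norm N (A \<omega>))) \<partial>M) < \<infinity>)"

definition K7 ::
  "'w measure \<Rightarrow> (real^'d \<Rightarrow> real) \<Rightarrow> (int \<Rightarrow> 'w \<Rightarrow> real^'d^'d) \<Rightarrow> ('w \<Rightarrow> real^'d) \<Rightarrow> real \<Rightarrow> bool"
where
  "K7 M N A B \<alpha> \<longleftrightarrow>
     0 < \<alpha> \<and>
     (\<lambda>n. ext_log (\<integral>\<^sup>+\<omega>. ennreal (op_norm N (left_prod (\<lambda>k. A (int k) \<omega>) n) powr \<alpha>) \<partial>M)
            / ereal (real n)) \<longlonglongrightarrow> 0 \<and>
     (\<integral>\<^sup>+\<omega>. ennreal (N (B \<omega>) powr \<alpha>) \<partial>M) < \<infinity> \<and>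
     (1 < CARD('d) \<longrightarrow> \<not> (\<exists>k::int. \<alpha> = 2 * of_int k))"

definition strictly_stationary ::
  "'w measure \<Rightarrow> (int \<Rightarrow> 'w \<Rightarrow> 'b::topological_space) \<Rightarrow> bool" where
  "strictly_stationary M X \<longleftrightarrow>
     (\<forall>t. X t \<in> borel_measurable M) \<and>
     (\<forall>h. distr M (PiM UNIV (\<lambda>_. borel)) (\<lambda>\<omega> t. X (t + h) \<omega>) =
          distr M (PiM UNIV (\<lambda>_. borel)) (\<lambda>\<omega> t. X t \<omega>))"

text \<open>\<open>X t\<close> is almost surely a measurable function of the inputs \<open>Y s\<close>, \<open>s \<le> t\<close>.\<close>

definition causal ::
  "'w measure \<Rightarrow> (int \<Rightarrow> 'w \<Rightarrow> 'b::topological_space) \<Rightarrow> (int \<Rightarrow> 'w \<Rightarrow> 'c::topological_space) \<Rightarrow> bool"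
where
  "causal M Y X \<longleftrightarrow>
     (\<forall>t. \<exists>f \<in> borel_measurable (PiM (UNIV :: nat set) (\<lambda>_. borel)).
        AE \<omega> in M. X t \<omega> = f (\<lambda>k. Y (t - int k) \<omega>))"

definition causal_stationary_solution ::
  "'w measure \<Rightarrow> (int \<Rightarrow> 'w \<Rightarrow> real^'d^'d) \<Rightarrow> (int \<Rightarrow> 'w \<Rightarrow> real^'d) \<Rightarrow>
   (int \<Rightarrow> 'w \<Rightarrow> real^'d) \<Rightarrow> bool"
where
  "causal_stationary_solution M A B X \<longleftrightarrow>
     strictly_stationary M X \<and>
     causal M (\<lambda>t \<omega>. (A t \<omega>, B t \<omega>)) X \<and>
     (\<forall>t. AE \<omega> in M. X t \<omega> = A t \<omega> *v X (t - 1) \<omega> + B t \<omega>)"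

text \<open>Only meaningful for \<open>s \<le> n\<close>; otherwise it is an unspecified \<open>Max {}\<close>.\<close>

definition block_max :: "('b \<Rightarrow> real) \<Rightarrow> (int \<Rightarrow> 'w \<Rightarrow> 'b) \<Rightarrow> int \<Rightarrow> int \<Rightarrow> 'w \<Rightarrow> real" where
  "block_max N X s n \<omega> = (MAX t\<in>{s..n}. N (X t \<omega>))"

end

theory Submission
  imports Defs
begin

text \<open>
  Both limits follow from a two-sided power bound for the tail of the stationary law,
  \<open>c * x powr - \<alpha> \<le> P(|X| > x) \<le> C * x powr - \<alpha>\<close>, together with the contraction of the moments of
  order below \<open>\<alpha>\<close> of the matrix products.

  The tail bounds are derived from elementary renewal estimates. Norms of products of non-negative
  matrices are submultiplicative, and inserting an entrywise positive product makes them
  supermultiplicative up to a constant. Hence the critical moments \<open>E |A\<^sub>n \<cdots> A\<^sub>1| powr \<alpha>\<close> stay between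
  one and a constant (\<open>mom_critical_ge_1\<close>, \<open>mom_critical_bounded\<close>), and the moments of lower order
  decay geometrically (\<open>mom_decay\<close>). A maximal inequality bounds the probability that the product
  chain ever exceeds \<open>u\<close> by a multiple of \<open>u powr - \<alpha>\<close> (\<open>hit_le\<close>). Conversely, a fixed share of the
  critical moment must cross the level \<open>u\<close>, and the moment \<open>E |A| powr \<alpha> * ln |A|\<close> controls how much of
  it is lost to large overshoots, which gives a lower bound of the same order (\<open>hit_ge\<close>). By
  positivity the stationary state is large, with a fixed probability, whenever the backward product
  chain is, hence the lower tail bound (\<open>nu_tail_ge\<close>). Telescoping along the same chain shows that the tail of the stationary
  law is caused by single inputs \<open>B\<close> amplified by the product, hence the upper one (\<open>nu_tail_le\<close>).

  For the dependence between two times, \<open>X\<^sub>t\<close> is the sum of the propagated state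
  \<open>A\<^sub>t \<cdots> A\<^sub>2 X\<^sub>1\<close> and a remainder that is independent of \<open>X\<^sub>1\<close> and, by positivity, dominated by a
  stationary copy of the chain (\<open>kern_pow_decouple\<close>). A late exceedance is thus either inherited,
  which is geometrically unlikely in \<open>t\<close>, or a new one, and the new ones up to time \<open>n\<close> have total
  probability of order \<open>n * x\<^sub>n powr - \<alpha>\<close>, which tends to zero. For the sum of small values the mean
  vanishes in the limit and the covariances decay geometrically, so its variance is of the order
  \<open>n * \<epsilon> powr (2 * p - \<alpha>) * x\<^sub>n powr - \<alpha>\<close> up to smaller terms. Chebyshev's inequality and
  \<open>2 * p > \<alpha>\<close> conclude.
\<close>

section \<open>Entrywise norms and non-negative matrices\<close>

text \<open>
  Entry sums are linear on the non-negative cone, which gives them good lower bounds there. Any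
  other norm differs from them by constant factors.
\<close>

definition mnorm :: "real^'d^'d \<Rightarrow> real" where
  "mnorm a = (\<Sum>i\<in>UNIV. \<Sum>j\<in>UNIV. \<bar>a $ i $ j\<bar>)"

definition vnorm :: "real^'d \<Rightarrow> real" where
  "vnorm y = (\<Sum>i\<in>UNIV. \<bar>y $ i\<bar>)"

definition mat_nonneg :: "real^'d^'d \<Rightarrow> bool" where
  "mat_nonneg a \<longleftrightarrow> (\<forall>i j. 0 \<le> a $ i $ j)"

definition vec_nonneg :: "real^'d \<Rightarrow> bool" where
  "vec_nonneg y \<longleftrightarrow> (\<forall>i. 0 \<le> y $ i)"

lemma mnorm_nonneg [simp]: "0 \<le> mnorm a"
  unfolding mnorm_def by (intro sum_nonneg) auto

lemma vnorm_nonneg [simp]: "0 \<le> vnorm y"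
  unfolding vnorm_def by (intro sum_nonneg) auto

lemma vnorm_zero_iff [simp]: "vnorm y = 0 \<longleftrightarrow> y = 0"
  unfolding vnorm_def by (simp add: sum_nonneg_eq_0_iff vec_eq_iff)

lemma vnorm_zero [simp]: "vnorm 0 = 0"
  by simp

lemma vnorm_triangle: "vnorm (y + z) \<le> vnorm y + vnorm z"
  unfolding vnorm_def by (subst sum.distrib[symmetric]) (intro sum_mono, auto)

lemma vnorm_scaleR: "vnorm (c *\<^sub>R y) = \<bar>c\<bar> * vnorm y"
  unfolding vnorm_def by (simp add: abs_mult sum_distrib_left)

lemma mnorm_mult_le: "mnorm (a ** b) \<le> mnorm a * mnorm b"
proof -
  have "mnorm (a ** b) \<le> (\<Sum>i\<in>UNIV. \<Sum>j\<in>UNIV. \<Sum>k\<in>UNIV. \<bar>a $ i $ k\<bar> * \<bar>b $ k $ j\<bar>)"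
    unfolding mnorm_def matrix_matrix_mult_def
    by (intro sum_mono) (simp flip: abs_mult)
  also have "\<dots> = (\<Sum>i\<in>UNIV. \<Sum>k\<in>UNIV. \<bar>a $ i $ k\<bar> * (\<Sum>j\<in>UNIV. \<bar>b $ k $ j\<bar>))"
    unfolding sum_distrib_left by (rule sum.cong[OF refl], rule sum.swap)
  also have "\<dots> \<le> (\<Sum>i\<in>UNIV. \<Sum>k\<in>UNIV. \<bar>a $ i $ k\<bar> * mnorm b)"
    unfolding mnorm_def
    by (intro sum_mono mult_left_mono member_le_sum[where f="\<lambda>k. \<Sum>j\<in>UNIV. \<bar>b $ k $ j\<bar>"])
       (auto intro: sum_nonneg)
  also have "\<dots> = mnorm a * mnorm b"
    by (simp add: mnorm_def sum_distrib_right)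
  finally show ?thesis .
qed

lemma vnorm_mult_le: "vnorm (a *v y) \<le> mnorm a * vnorm y"
proof -
  have "vnorm (a *v y) \<le> (\<Sum>i\<in>UNIV. \<Sum>k\<in>UNIV. \<bar>a $ i $ k\<bar> * \<bar>y $ k\<bar>)"
    unfolding vnorm_def matrix_vector_mult_def
    by (intro sum_mono) (simp add: abs_mult[symmetric])
  also have "\<dots> \<le> (\<Sum>i\<in>UNIV. \<Sum>k\<in>UNIV. \<bar>a $ i $ k\<bar> * vnorm y)"
    unfolding vnorm_def
    by (intro sum_mono mult_left_mono member_le_sum[where f="\<lambda>k. \<bar>y $ k\<bar>"]) auto
  also have "\<dots> = mnorm a * vnorm y"
    by (simp add: mnorm_def sum_distrib_right)
  finally show ?thesis .
qed

lemma mat_nonneg_mult: "mat_nonneg a \<Longrightarrow> mat_nonneg b \<Longrightarrow> mat_nonneg (a ** b)"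
  unfolding mat_nonneg_def matrix_matrix_mult_def by (auto intro!: sum_nonneg)

lemma vec_nonneg_mult: "mat_nonneg a \<Longrightarrow> vec_nonneg y \<Longrightarrow> vec_nonneg (a *v y)"
  unfolding mat_nonneg_def vec_nonneg_def matrix_vector_mult_def by (auto intro!: sum_nonneg)

lemma vec_nonneg_add: "vec_nonneg y \<Longrightarrow> vec_nonneg z \<Longrightarrow> vec_nonneg (y + z)"
  unfolding vec_nonneg_def by auto

lemma vec_nonneg_zero [simp]: "vec_nonneg 0"
  unfolding vec_nonneg_def by auto

lemma mat_nonneg_one [simp]: "mat_nonneg (mat 1)"
  unfolding mat_nonneg_def mat_def by auto

lemma vnorm_add_ge: "vec_nonneg y \<Longrightarrow> vec_nonneg z \<Longrightarrow> vnorm y \<le> vnorm (y + z)"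
  unfolding vnorm_def vec_nonneg_def by (intro sum_mono) (smt (verit) vector_add_component)

lemma mnorm_one: "mnorm (mat 1 :: real^'d^'d) = CARD('d)"
proof -
  have "mnorm (mat 1 :: real^'d^'d) = (\<Sum>i\<in>(UNIV::'d set). \<Sum>j\<in>(UNIV::'d set). if i = j then 1 else 0)"
    unfolding mnorm_def mat_def by (intro sum.cong refl) auto
  also have "\<dots> = CARD('d)"
    by simp
  finally show ?thesis .
qed

text \<open>
  A middle factor with all entries at least \<open>s\<close> mixes all coordinates: every coordinate of \<open>D *v y\<close>
  is at least \<open>s * vnorm y\<close>, so no row of \<open>a\<close> can miss the large coordinates.
\<close>

lemma vnorm_sandwich:
  assumes "mat_nonneg a" "vec_nonneg y" "0 \<le> s" "\<And>i j. s \<le> D $ i $ j"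
  shows "s * mnorm a * vnorm y \<le> vnorm (a *v (D *v y))"
proof -
  have D: "s * vnorm y \<le> (D *v y) $ k" for k
    unfolding matrix_vector_mult_def vnorm_def sum_distrib_left vec_lambda_beta
    using assms order_trans[OF assms(3,4)] by (intro sum_mono mult_mono) (auto simp: vec_nonneg_def)
  have "(\<Sum>j\<in>UNIV. \<bar>a $ i $ j\<bar>) * (s * vnorm y) \<le> (a *v (D *v y)) $ i" for i
    unfolding matrix_vector_mult_def[of a] sum_distrib_right vec_lambda_beta
    using assms D by (intro sum_mono mult_mono) (auto simp: mat_nonneg_def)
  then have "(\<Sum>j\<in>UNIV. \<bar>a $ i $ j\<bar>) * (s * vnorm y) \<le> \<bar>(a *v (D *v y)) $ i\<bar>" for i
    by (rule order_trans) simp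
  then have "(\<Sum>i\<in>UNIV. (\<Sum>j\<in>UNIV. \<bar>a $ i $ j\<bar>) * (s * vnorm y)) \<le> vnorm (a *v (D *v y))"
    unfolding vnorm_def[of "a *v (D *v y)"] by (intro sum_mono)
  then show ?thesis
    by (simp add: mnorm_def mult_ac flip: sum_distrib_left sum_distrib_right)
qed

lemma mnorm_eq_vnorm_ones: "mat_nonneg b \<Longrightarrow> mnorm b = vnorm (b *v (\<chi> i. 1))"
  unfolding mnorm_def vnorm_def mat_nonneg_def matrix_vector_mult_def
  by (intro sum.cong refl) (simp add: sum_nonneg)

lemma mnorm_sandwich:
  assumes "mat_nonneg a" "mat_nonneg b" "0 \<le> s" "\<And>i j. s \<le> D $ i $ j"
  shows "s * mnorm a * mnorm b \<le> mnorm (a ** (D ** b))"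
proof -
  have "mat_nonneg D"
    using assms(3,4) order_trans unfolding mat_nonneg_def by blast
  then have "mnorm (a ** (D ** b)) = vnorm (a *v (D *v (b *v (\<chi> i. 1))))"
    using assms by (subst mnorm_eq_vnorm_ones) (auto intro!: mat_nonneg_mult simp: matrix_vector_mul_assoc)
  moreover have "vec_nonneg (b *v (\<chi> i. 1))"
    using assms by (intro vec_nonneg_mult) (auto simp: vec_nonneg_def)
  ultimately show ?thesis
    using vnorm_sandwich[OF assms(1) _ assms(3,4), of "b *v (\<chi> i. 1)"] assms(2)
    by (simp add: mnorm_eq_vnorm_ones[of b])
qed

lemma continuous_on_matrix_mult [continuous_intros]:
  fixes f :: "'a::topological_space \<Rightarrow> real^'d^'d"
  shows "continuous_on S f \<Longrightarrow> continuous_on S g \<Longrightarrow> continuous_on S (\<lambda>x. f x ** g x)"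
  unfolding matrix_matrix_mult_def by (intro continuous_intros)

lemma continuous_on_matrix_vector_mult [continuous_intros]:
  fixes f :: "'a::topological_space \<Rightarrow> real^'d^'d"
  shows "continuous_on S f \<Longrightarrow> continuous_on S g \<Longrightarrow> continuous_on S (\<lambda>x. f x *v g x)"
  unfolding matrix_vector_mult_def by (intro continuous_intros)

lemma continuous_on_mnorm [continuous_intros]:
  "continuous_on S f \<Longrightarrow> continuous_on S (\<lambda>x. mnorm (f x))"
  unfolding mnorm_def by (intro continuous_intros)

lemma continuous_on_vnorm [continuous_intros]:
  "continuous_on S f \<Longrightarrow> continuous_on S (\<lambda>x. vnorm (f x))"
  unfolding vnorm_def by (intro continuous_intros)

lemma measurable_matrix_mult [measurable (raw)]:
  fixes f g :: "'a \<Rightarrow> real^'d^'d"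
  assumes [measurable]: "f \<in> borel_measurable M" "g \<in> borel_measurable M"
  shows "(\<lambda>x. f x ** g x) \<in> borel_measurable M"
  by (rule borel_measurable_continuous_Pair[OF assms]) (intro continuous_intros)

lemma measurable_matrix_vector_mult [measurable (raw)]:
  fixes f :: "'a \<Rightarrow> real^'d^'d"
  assumes [measurable]: "f \<in> borel_measurable M" "g \<in> borel_measurable M"
  shows "(\<lambda>x. f x *v g x) \<in> borel_measurable M"
  by (rule borel_measurable_continuous_Pair[OF assms]) (intro continuous_intros)

lemma measurable_mnorm [measurable]: "mnorm \<in> borel_measurable borel"
  by (intro borel_measurable_continuous_onI continuous_intros)

lemma measurable_vnorm [measurable]: "vnorm \<in> borel_measurable borel"
  by (intro borel_measurable_continuous_onI continuous_intros)

lemma measurable_vec_entry [measurable]: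
  "(\<lambda>y::(real, 'd::finite) vec. y $ i) \<in> borel_measurable borel"
  by (intro borel_measurable_continuous_onI continuous_intros)

lemma measurable_mat_entry [measurable]:
  "(\<lambda>a::real^'d^'d. a $ i $ j) \<in> borel_measurable borel"
  by (intro borel_measurable_continuous_onI continuous_intros)

lemma pred_mat_nonneg [measurable]: "Measurable.pred borel mat_nonneg"
  unfolding mat_nonneg_def by measurable

lemma pred_vec_nonneg [measurable]: "Measurable.pred borel vec_nonneg"
  unfolding vec_nonneg_def by measurable

section \<open>Products of independent random matrices\<close>

locale matrix_law = prob_space m
  for m :: "(real^'d^'d) measure" +
  assumes sets_m [measurable_cong, simp]: "sets m = sets borel"
    and nonneg_m: "AE a in m. mat_nonneg a"
begin

text \<open>
  The law of a product of \<open>n\<close> independent factors. New factors enter on the right, because that is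
  the order in which iterating the affine recursion backwards in time multiplies them.
\<close>

primrec law :: "nat \<Rightarrow> (real^'d^'d) measure" where
  "law 0 = return borel (mat 1)"
| "law (Suc n) = distr (law n \<Otimes>\<^sub>M m) borel (\<lambda>(a, b). a ** b)"

declare law.simps [simp del]

lemma sets_law [measurable_cong, simp]: "sets (law n) = sets borel"
  by (cases n) (auto simp: law.simps)

lemma space_law [simp]: "space (law n) = UNIV"
  using sets_eq_imp_space_eq[OF sets_law[of n]] by simp

lemma space_m [simp]: "space m = UNIV"
  using sets_eq_imp_space_eq[OF sets_m] by simp

lemma prob_space_law: "prob_space (law n)"
proof (induction n)
  case 0
  show ?case by (simp add: prob_space_return law.simps)
next
  case (Suc n)
  interpret L: prob_space "law n" by fact
  interpret pair_prob_space "law n" m ..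
  show ?case
    unfolding law.simps by (rule prob_space_distr) measurable
qed

sublocale law: prob_space "law n" for n
  by (rule prob_space_law)

lemma nn_integral_law_Suc:
  assumes [measurable]: "f \<in> borel_measurable borel"
  shows "(\<integral>\<^sup>+a. f a \<partial>law (Suc n)) = (\<integral>\<^sup>+a. \<integral>\<^sup>+b. f (a ** b) \<partial>m \<partial>law n)"
proof -
  have "(\<integral>\<^sup>+a. f a \<partial>law (Suc n)) = (\<integral>\<^sup>+z. f (fst z ** snd z) \<partial>(law n \<Otimes>\<^sub>M m))"
    unfolding law.simps by (subst nn_integral_distr) (auto simp: split_beta')
  also have "\<dots> = (\<integral>\<^sup>+a. \<integral>\<^sup>+b. f (a ** b) \<partial>m \<partial>law n)"
    by (subst nn_integral_fst[symmetric]) auto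
  finally show ?thesis .
qed

lemma nn_integral_law_0 [simp]:
  "f \<in> borel_measurable borel \<Longrightarrow> (\<integral>\<^sup>+a. f a \<partial>law 0) = f (mat 1)"
  by (simp add: nn_integral_return law.simps)

lemma nn_integral_law_add:
  assumes "f \<in> borel_measurable borel"
  shows "(\<integral>\<^sup>+a. f a \<partial>law (n + k)) = (\<integral>\<^sup>+a. \<integral>\<^sup>+b. f (a ** b) \<partial>law k \<partial>law n)"
  using assms
proof (induction k arbitrary: f)
  case 0
  note [measurable] = 0
  show ?case by simp
next
  case (Suc k)
  note [measurable] = Suc.prems
  have "(\<integral>\<^sup>+a. f a \<partial>law (n + Suc k)) = (\<integral>\<^sup>+a. (\<integral>\<^sup>+c. f (a ** c) \<partial>m) \<partial>law (n + k))"
    unfolding add_Suc_right by (rule nn_integral_law_Suc) fact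
  also have "\<dots> = (\<integral>\<^sup>+a. \<integral>\<^sup>+b. (\<integral>\<^sup>+c. f (a ** b ** c) \<partial>m) \<partial>law k \<partial>law n)"
    by (rule Suc.IH) measurable
  also have "\<dots> = (\<integral>\<^sup>+a. \<integral>\<^sup>+b. f (a ** b) \<partial>law (Suc k) \<partial>law n)"
    by (subst nn_integral_law_Suc) (auto simp: matrix_mul_assoc)
  finally show ?case .
qed

lemma nn_integral_law_1:
  "f \<in> borel_measurable borel \<Longrightarrow> (\<integral>\<^sup>+a. f a \<partial>law (Suc 0)) = (\<integral>\<^sup>+a. f a \<partial>m)"
  by (subst nn_integral_law_Suc) auto

lemma nn_integral_law_Suc':
  assumes [measurable]: "f \<in> borel_measurable borel"
  shows "(\<integral>\<^sup>+a. f a \<partial>law (Suc n)) = (\<integral>\<^sup>+a. \<integral>\<^sup>+b. f (a ** b) \<partial>law n \<partial>m)"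
proof -
  have "(\<integral>\<^sup>+a. f a \<partial>law (Suc 0 + n)) = (\<integral>\<^sup>+a. \<integral>\<^sup>+b. f (a ** b) \<partial>law n \<partial>law (Suc 0))"
    by (rule nn_integral_law_add) fact
  then show ?thesis
    by (simp add: nn_integral_law_1)
qed

lemma AE_law_iff:
  assumes [measurable]: "Measurable.pred borel P"
  shows "(AE a in law n. P a) \<longleftrightarrow> (\<integral>\<^sup>+a. indicator {a. \<not> P a} a \<partial>law n) = 0"
  by (subst AE_iff_nn_integral) (auto simp: Collect_neg_eq[symmetric] indicator_def intro!: arg_cong2[where f=nn_integral] simp del: nn_integral_indicator)

lemma AE_law_nonneg: "AE a in law n. mat_nonneg a"
proof (induction n)
  case 0
  show ?case unfolding law.simps by (subst AE_return) auto
next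
  case (Suc n)
  have "AE a in law n. (\<integral>\<^sup>+b. indicator {a. \<not> mat_nonneg a} (a ** b) \<partial>m) = 0"
    using Suc
  proof eventually_elim
    case (elim a)
    have "(\<integral>\<^sup>+b. indicator {a. \<not> mat_nonneg a} (a ** b) \<partial>m) = (\<integral>\<^sup>+b. 0 \<partial>m)"
      using nonneg_m by (intro nn_integral_cong_AE) (auto elim!: eventually_mono simp: elim mat_nonneg_mult)
    then show ?case by simp
  qed
  then have "(\<integral>\<^sup>+a. \<integral>\<^sup>+b. indicator {a. \<not> mat_nonneg a} (a ** b) \<partial>m \<partial>law n) = (\<integral>\<^sup>+a. 0 \<partial>law n)"
    by (rule nn_integral_cong_AE)
  then show ?case
    by (subst AE_law_iff, measurable) (subst nn_integral_law_Suc, auto)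
qed

subsection \<open>Moments of the norm of a product\<close>

definition mom :: "real \<Rightarrow> nat \<Rightarrow> ennreal" where
  "mom \<kappa> n = (\<integral>\<^sup>+a. ennreal (mnorm a powr \<kappa>) \<partial>law n)"

lemma mom_submult:
  assumes "0 \<le> \<kappa>"
  shows "mom \<kappa> (n + k) \<le> mom \<kappa> n * mom \<kappa> k"
proof -
  have "mom \<kappa> (n + k) = (\<integral>\<^sup>+a. \<integral>\<^sup>+b. ennreal (mnorm (a ** b) powr \<kappa>) \<partial>law k \<partial>law n)"
    unfolding mom_def by (rule nn_integral_law_add) measurable
  also have "\<dots> \<le> (\<integral>\<^sup>+a. \<integral>\<^sup>+b. ennreal (mnorm a powr \<kappa>) * ennreal (mnorm b powr \<kappa>) \<partial>law k \<partial>law n)"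
    by (intro nn_integral_mono)
       (auto simp: ennreal_mult[symmetric] powr_mult[symmetric] intro!: ennreal_leI powr_mono2 assms mnorm_mult_le)
  also have "\<dots> = mom \<kappa> n * mom \<kappa> k"
    unfolding mom_def by (simp add: nn_integral_cmult nn_integral_multc)
  finally show ?thesis .
qed

lemma mom_0 [simp]: "mom \<kappa> 0 = ennreal (real CARD('d) powr \<kappa>)"
  unfolding mom_def by (simp add: mnorm_one)

text \<open>
  If a product of length \<open>l\<close> has all entries above \<open>s\<close> with positive probability, then inserting it
  between two non-negative factors loses only the constant \<open>s\<close>: norms of products are, up to
  constants and with positive probability, supermultiplicative.
\<close>

lemma nn_integral_sandwich:
  assumes "0 \<le> s" "0 \<le> \<kappa>" "mat_nonneg a"
  shows "ennreal (s powr \<kappa>) * emeasure (law l) {D. \<forall>i j. s < D $ i $ j} * (ennreal (mnorm a powr \<kappa>) * mom \<kappa> k)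
    \<le> (\<integral>\<^sup>+b. ennreal (mnorm (a ** b) powr \<kappa>) \<partial>law (l + k))"
proof -
  let ?P = "{D::real^'d^'d. \<forall>i j. s < D $ i $ j}"
  have [measurable]: "?P \<in> sets borel"
    by measurable
  have "ennreal (s powr \<kappa>) * emeasure (law l) ?P * (ennreal (mnorm a powr \<kappa>) * mom \<kappa> k) =
     (\<integral>\<^sup>+D. \<integral>\<^sup>+b. indicator ?P D * (ennreal (s powr \<kappa>) * (ennreal (mnorm a powr \<kappa>) * ennreal (mnorm b powr \<kappa>))) \<partial>law k \<partial>law l)"
    unfolding mom_def by (simp add: nn_integral_cmult nn_integral_multc mult_ac)
  also have "\<dots> \<le> (\<integral>\<^sup>+D. \<integral>\<^sup>+b. ennreal (mnorm (a ** (D ** b)) powr \<kappa>) \<partial>law k \<partial>law l)"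
  proof (rule nn_integral_mono, rule nn_integral_mono_AE)
    fix D
    show "AE b in law k. indicator ?P D * (ennreal (s powr \<kappa>) * (ennreal (mnorm a powr \<kappa>) * ennreal (mnorm b powr \<kappa>)))
       \<le> ennreal (mnorm (a ** (D ** b)) powr \<kappa>)"
      using AE_law_nonneg[of k]
    proof eventually_elim
      case (elim b)
      show ?case
      proof (cases "D \<in> ?P")
        case True
        then have "s * mnorm a * mnorm b \<le> mnorm (a ** (D ** b))"
          using assms elim by (intro mnorm_sandwich) (auto intro: less_imp_le)
        then have "(s * mnorm a * mnorm b) powr \<kappa> \<le> mnorm (a ** (D ** b)) powr \<kappa>"
          using assms by (intro powr_mono2) auto
        then show ?thesis
          using True assms by (simp add: powr_mult ennreal_mult[symmetric] mult_ac)
      qed auto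
    qed
  qed
  also have "\<dots> = (\<integral>\<^sup>+b. ennreal (mnorm (a ** b) powr \<kappa>) \<partial>law (l + k))"
    by (rule nn_integral_law_add[symmetric]) measurable
  finally show ?thesis .
qed

lemma mom_supermult:
  assumes "0 \<le> s" "0 \<le> \<kappa>"
  shows "ennreal (s powr \<kappa>) * emeasure (law l) {D. \<forall>i j. s < D $ i $ j} * (mom \<kappa> n * mom \<kappa> k)
    \<le> mom \<kappa> (n + (l + k))"
proof -
  let ?c = "ennreal (s powr \<kappa>) * emeasure (law l) {D. \<forall>i j. s < D $ i $ j}"
  have "?c * (mom \<kappa> n * mom \<kappa> k) = (\<integral>\<^sup>+a. ?c * (ennreal (mnorm a powr \<kappa>) * mom \<kappa> k) \<partial>law n)"
    unfolding mom_def[of _ n] by (simp add: nn_integral_cmult nn_integral_multc)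
  also have "\<dots> \<le> (\<integral>\<^sup>+a. \<integral>\<^sup>+b. ennreal (mnorm (a ** b) powr \<kappa>) \<partial>law (l + k) \<partial>law n)"
    using AE_law_nonneg[of n] by (intro nn_integral_mono_AE) (auto elim!: eventually_mono intro!: nn_integral_sandwich assms)
  also have "\<dots> = mom \<kappa> (n + (l + k))"
    unfolding mom_def by (rule nn_integral_law_add[symmetric]) measurable
  finally show ?thesis .
qed

end

text \<open>
  Splitting at a threshold \<open>z\<close> plays the part of Hoelder's inequality: with \<open>z\<close> exponential in \<open>n\<close>
  it turns bounds for two moments of a product of length \<open>n\<close> into a bound for those in between.
\<close>

lemma powr_interpolate:
  fixes z Z :: real
  assumes "\<kappa>\<^sub>1 \<le> \<kappa>" "\<kappa> \<le> \<kappa>\<^sub>2" "0 < z" "0 \<le> Z"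
  shows "Z powr \<kappa> \<le> z powr (\<kappa> - \<kappa>\<^sub>1) * Z powr \<kappa>\<^sub>1 + z powr (\<kappa> - \<kappa>\<^sub>2) * Z powr \<kappa>\<^sub>2"
proof (cases "Z = 0")
  case False
  then have Z: "Z > 0" using assms by simp
  show ?thesis
  proof (cases "Z \<le> z")
    case True
    have "Z powr \<kappa> = Z powr (\<kappa> - \<kappa>\<^sub>1) * Z powr \<kappa>\<^sub>1"
      using Z by (simp flip: powr_add)
    also have "\<dots> \<le> z powr (\<kappa> - \<kappa>\<^sub>1) * Z powr \<kappa>\<^sub>1"
      using True Z assms by (intro mult_right_mono powr_mono2) auto
    finally show ?thesis by (simp add: add_increasing2)
  next
    case f: False
    have "Z powr \<kappa> = Z powr (\<kappa> - \<kappa>\<^sub>2) * Z powr \<kappa>\<^sub>2"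
      using Z by (simp flip: powr_add)
    also have "\<dots> \<le> z powr (\<kappa> - \<kappa>\<^sub>2) * Z powr \<kappa>\<^sub>2"
      using f Z assms by (intro mult_right_mono powr_mono2') auto
    finally show ?thesis by (simp add: add_increasing)
  qed
qed simp

context matrix_law
begin

lemma mom_interpolate:
  assumes "\<kappa>\<^sub>1 \<le> \<kappa>" "\<kappa> \<le> \<kappa>\<^sub>2" "0 < z"
  shows "mom \<kappa> n \<le> ennreal (z powr (\<kappa> - \<kappa>\<^sub>1)) * mom \<kappa>\<^sub>1 n + ennreal (z powr (\<kappa> - \<kappa>\<^sub>2)) * mom \<kappa>\<^sub>2 n"
proof -
  have "mom \<kappa> n \<le> (\<integral>\<^sup>+a. ennreal (z powr (\<kappa> - \<kappa>\<^sub>1)) * ennreal (mnorm a powr \<kappa>\<^sub>1) + ennreal (z powr (\<kappa> - \<kappa>\<^sub>2)) * ennreal (mnorm a powr \<kappa>\<^sub>2) \<partial>law n)"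
    unfolding mom_def
    by (intro nn_integral_mono)
       (auto simp: ennreal_mult[symmetric] ennreal_plus[symmetric] simp del: ennreal_plus intro!: ennreal_leI powr_interpolate assms)
  also have "\<dots> = ennreal (z powr (\<kappa> - \<kappa>\<^sub>1)) * mom \<kappa>\<^sub>1 n + ennreal (z powr (\<kappa> - \<kappa>\<^sub>2)) * mom \<kappa>\<^sub>2 n"
    unfolding mom_def by (simp add: nn_integral_add nn_integral_cmult)
  finally show ?thesis .
qed

lemma mom_zero_le: "mom 0 n \<le> 1"
proof -
  have "mom 0 n \<le> (\<integral>\<^sup>+a. 1 \<partial>law n)"
    unfolding mom_def by (intro nn_integral_mono) auto
  then show ?thesis by (simp add: law.emeasure_space_1[simplified])
qed

end

section \<open>Moments of products at the critical exponent\<close>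

text \<open>
  The exponent \<open>\<alpha>\<close> is critical: the moments of order \<open>\<alpha>\<close> of the products neither grow nor decay
  exponentially, while some other moment decays. The last assumption is a logarithmic moment at some
  order whose moments are at least one; it passes to the order \<open>\<alpha>\<close> once such an order is known to
  be at least \<open>\<alpha>\<close>.
\<close>

locale critical_matrix_law = matrix_law m
  for m :: "(real^'d^'d) measure" +
  fixes \<alpha> :: real
  assumes \<alpha>_pos: "0 < \<alpha>"
    and positive_product: "\<exists>l s. 0 < s \<and> 0 < emeasure (law l) {D. \<forall>i j. s < D $ i $ j}"
    and some_decay: "\<exists>\<kappa>>0. \<exists>C>0. \<exists>\<rho>. 0 < \<rho> \<and> \<rho> < 1 \<and> (\<forall>n. mom \<kappa> n \<le> ennreal (C * \<rho> ^ n))"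
    and subexponential: "\<And>\<delta>. 0 < \<delta> \<Longrightarrow>
      \<forall>\<^sub>F n in sequentially. ennreal (exp (- \<delta> * real n)) \<le> mom \<alpha> n \<and> mom \<alpha> n \<le> ennreal (exp (\<delta> * real n))"
    and large_moment: "\<exists>\<kappa>>0. (\<forall>n. 1 \<le> mom \<kappa> n) \<and> (\<integral>\<^sup>+a. ennreal (mnorm a powr \<kappa> * max 0 (ln (mnorm a))) \<partial>m) < \<infinity>"
begin

text \<open>
  Moments are submultiplicative in the length of the product, so a single value below one would
  force exponential decay.
\<close>

lemma mom_critical_ge_1: "1 \<le> mom \<alpha> n"
proof (rule ccontr)
  assume "\<not> 1 \<le> mom \<alpha> n"
  then have lt: "mom \<alpha> n < 1" by simp
  define K where "K = real CARD('d) powr \<alpha>"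
  have card: "1 \<le> real CARD('d)"
    by (metis One_nat_def Suc_leI of_nat_1 of_nat_mono zero_less_card_finite)
  then have K: "1 \<le> K"
    unfolding K_def using \<alpha>_pos by (intro ge_one_powr_ge_zero) auto
  have n: "n > 0"
  proof (rule ccontr)
    assume "\<not> n > 0"
    then have "mom \<alpha> n = ennreal K" by (simp add: K_def)
    with lt K show False by simp
  qed
  define r where "r = max (enn2real (mom \<alpha> n)) (1/2)"
  have fin: "mom \<alpha> n < \<infinity>"
    using lt by (simp add: less_top[symmetric] order_less_imp_not_eq) (metis ennreal_one_less_top order.strict_trans less_top)
  have r: "mom \<alpha> n \<le> ennreal r" "0 < r" "r < 1"
  proof -
    have *: "mom \<alpha> n = ennreal (enn2real (mom \<alpha> n))"
      using fin by (simp add: ennreal_enn2real)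
    show "mom \<alpha> n \<le> ennreal r"
      by (subst *) (auto simp: r_def intro!: ennreal_leI)
    have "enn2real (mom \<alpha> n) < 1"
      using lt by (subst (asm) *) (simp add: ennreal_less_one_iff del: ennreal_enn2real_if)
    then show "r < 1" "0 < r" by (auto simp: r_def)
  qed
  have bound: "mom \<alpha> (n * k) \<le> ennreal (K * r ^ k)" for k
  proof (induction k)
    case (Suc k)
    have "mom \<alpha> (n * Suc k) \<le> mom \<alpha> n * mom \<alpha> (n * k)"
      using mom_submult[of \<alpha> n "n * k"] \<alpha>_pos by simp
    also have "\<dots> \<le> ennreal r * ennreal (K * r ^ k)"
      by (intro mult_mono r Suc) auto
    finally show ?case
      using r K by (simp add: ennreal_mult[symmetric] mult_ac)
  qed (simp add: K_def)
  define \<delta> where "\<delta> = - ln r / (2 * real n)"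
  have \<delta>: "\<delta> > 0" using r n by (simp add: \<delta>_def field_simps)
  obtain n0 where n0: "\<And>N. N \<ge> n0 \<Longrightarrow> ennreal (exp (- \<delta> * real N)) \<le> mom \<alpha> N"
    using subexponential[OF \<delta>] unfolding eventually_sequentially by blast
  have "1 + real k * (- ln r / 2) \<le> K" if "k \<ge> n0" for k
  proof -
    have "n * k \<ge> n0" using that n by (metis One_nat_def Suc_leI le_trans mult_1 mult_le_mono1)
    then have "ennreal (exp (- \<delta> * real (n * k))) \<le> ennreal (K * r ^ k)"
      using n0 bound order_trans by blast
    then have "exp (- \<delta> * real (n * k)) \<le> K * r ^ k"
      using K r by (subst (asm) ennreal_le_iff) auto
    also have "r ^ k = exp (real k * ln r)"
      using r by (simp add: exp_of_nat_mult)
    also have "- \<delta> * real (n * k) = real k * ln r + real k * (- ln r / 2)"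
      using n by (simp add: \<delta>_def field_simps)
    finally have "exp (real k * ln r) * exp (real k * (- ln r / 2)) \<le> exp (real k * ln r) * K"
      unfolding exp_add by (simp only: mult.commute[of K])
    then have "exp (real k * (- ln r / 2)) \<le> K"
      by (simp only: mult_le_cancel_left_pos[OF exp_gt_zero])
    then show ?thesis using exp_ge_add_one_self[of "real k * (- ln r / 2)"] by linarith
  qed
  moreover obtain k where "real k > K / (- ln r / 2)"
    using reals_Archimedean2 by blast
  ultimately have "1 + real (max k n0) * (- ln r / 2) \<le> K" "real (max k n0) > K / (- ln r / 2)"
    by (auto simp: max_def)
  moreover have "- ln r / 2 > 0" using r by simp
  ultimately show False
    by (simp add: field_simps)
qed

text \<open>
  Dually, moments are supermultiplicative up to the sandwich constant \<open>c\<close>, so a single value above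
  \<open>1 / c\<close>, infinity included, would be amplified to exponential growth.
\<close>

lemma mom_critical_bounded: "\<exists>C>0. \<forall>n. mom \<alpha> n \<le> ennreal C"
proof -
  obtain l s where s: "0 < s" and q: "0 < emeasure (law l) {D. \<forall>i j. s < D $ i $ j}"
    using positive_product by blast
  define c where "c = ennreal (s powr \<alpha>) * emeasure (law l) {D. \<forall>i j. s < D $ i $ j}"
  have "emeasure (law l) {D. \<forall>i j. s < D $ i $ j} < \<infinity>"
    by (metis infinity_ennreal_def law.emeasure_finite less_top)
  then have c: "0 < c" "c < \<infinity>"
    using s q by (auto simp: c_def ennreal_zero_less_mult_iff ennreal_mult_less_top)
  have sup: "c * (mom \<alpha> n * mom \<alpha> k) \<le> mom \<alpha> (n + (l + k))" for n k
    unfolding c_def using s \<alpha>_pos by (intro mom_supermult) auto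
  have le1: "c * mom \<alpha> n \<le> 1" for n
  proof (rule ccontr)
    assume "\<not> c * mom \<alpha> n \<le> 1"
    then obtain r' where r': "1 < r'" "r' < c * mom \<alpha> n"
      using dense[of 1 "c * mom \<alpha> n"] by (auto simp: not_le)
    define r where "r = enn2real r'"
    have rr: "r' = ennreal r"
      unfolding r_def using r' by (metis ennreal_enn2real infinity_ennreal_def less_top order_less_le_trans top_greatest)
    have r: "1 < r" "ennreal r \<le> c * mom \<alpha> n"
      using r' by (auto simp: rr)
    have bound: "ennreal (r ^ k) \<le> mom \<alpha> (n + k * (n + l))" for k
    proof (induction k)
      case 0
      show ?case using mom_critical_ge_1[of n] by simp
    next
      case (Suc k)
      have "ennreal (r ^ Suc k) = ennreal r * ennreal (r ^ k)"
        using r by (simp add: ennreal_mult)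
      also have "\<dots> \<le> c * mom \<alpha> n * mom \<alpha> (n + k * (n + l))"
        by (intro mult_mono r Suc) auto
      also have "\<dots> \<le> mom \<alpha> (n + (l + (n + k * (n + l))))"
        using sup by (simp add: mult.assoc)
      also have "n + (l + (n + k * (n + l))) = n + Suc k * (n + l)"
        by simp
      finally show ?case .
    qed
    define \<delta> where "\<delta> = ln r / (2 * real (Suc (n + l)))"
    have \<delta>: "\<delta> > 0" using r by (simp add: \<delta>_def)
    obtain n0 where n0: "\<And>N. N \<ge> n0 \<Longrightarrow> mom \<alpha> N \<le> ennreal (exp (\<delta> * real N))"
      using subexponential[OF \<delta>] unfolding eventually_sequentially by blast
    have nl: "n + l > 0"
    proof (rule ccontr)
      assume "\<not> 0 < n + l"
      then have "bdd_above (range (\<lambda>k. r ^ k))"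
        using bound mom_0[of \<alpha>] unfolding bdd_above_def
        by (auto intro!: exI[of _ "real CARD('d) powr \<alpha>"])
      then show False
        using r by (metis (no_types, lifting) bdd_above.unfold not_less order_refl rangeI real_arch_pow)
    qed
    have "real k * (ln r / 2) \<le> \<delta> * real n" if "k \<ge> n0" for k
    proof -
      have "n + k * (n + l) \<ge> n0"
        using that nl by (metis One_nat_def Suc_leI le_trans mult.right_neutral mult_le_mono2 trans_le_add2)
      then have "ennreal (r ^ k) \<le> ennreal (exp (\<delta> * real (n + k * (n + l))))"
        using n0 bound order_trans by blast
      then have "r ^ k \<le> exp (\<delta> * real (n + k * (n + l)))"
        by (subst (asm) ennreal_le_iff) auto
      moreover have "r ^ k = exp (real k * ln r)"
        using r by (simp add: exp_of_nat_mult)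
      ultimately have "real k * ln r \<le> \<delta> * real n + real k * (\<delta> * real (n + l))"
        by (simp add: algebra_simps)
      moreover have "\<delta> * real (n + l) \<le> ln r / 2"
        using r by (simp add: \<delta>_def field_simps)
      then have "real k * (\<delta> * real (n + l)) \<le> real k * (ln r / 2)"
        by (intro mult_left_mono) auto
      ultimately show ?thesis by simp
    qed
    moreover obtain k where "real k > (\<delta> * real n) / (ln r / 2)"
      using reals_Archimedean2 by blast
    ultimately have "real (max k n0) * (ln r / 2) \<le> \<delta> * real n" "real (max k n0) > (\<delta> * real n) / (ln r / 2)"
      by (auto simp: max_def)
    moreover have "ln r / 2 > 0" using r by simp
    ultimately show False
      by (simp add: field_simps)
  qed
  obtain c' where c': "c = ennreal c'" "c' > 0"
    using c by (cases c) (auto simp: ennreal_less_zero_iff)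
  have "mom \<alpha> n \<le> ennreal (1 / c')" for n
  proof -
    have "c * mom \<alpha> n \<le> c * ennreal (1 / c')"
      using le1[of n] c' by (simp add: ennreal_mult[symmetric])
    then show ?thesis
      using c by (subst (asm) ennreal_mult_le_mult_iff) auto
  qed
  then show ?thesis
    using c' by (intro exI[of _ "1 / c'"]) auto
qed

lemma critical_moment_finite: "(\<integral>\<^sup>+a. ennreal (mnorm a powr \<alpha>) \<partial>m) < \<infinity>"
proof -
  obtain C1 where "\<And>n. mom \<alpha> n \<le> ennreal C1" using mom_critical_bounded by blast
  from this[of "Suc 0"] have "(\<integral>\<^sup>+a. ennreal (mnorm a powr \<alpha>) \<partial>m) \<le> ennreal C1"
    unfolding mom_def by (subst (asm) nn_integral_law_1) auto
  then show ?thesis by (metis ennreal_less_top infinity_ennreal_def order_le_less_trans)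
qed

text \<open>
  Interpolation between geometric decay at one order and boundedness at \<open>\<alpha>\<close>. The decaying order must
  lie below \<open>\<alpha>\<close>, since otherwise interpolation with order zero would bring a moment of order \<open>\<alpha>\<close>
  below one.
\<close>

lemma mom_decay:
  assumes "0 < \<kappa>" "\<kappa> < \<alpha>"
  shows "\<exists>C>0. \<exists>\<rho>. 0 < \<rho> \<and> \<rho> < 1 \<and> (\<forall>n. mom \<kappa> n \<le> ennreal (C * \<rho> ^ n))"
proof -
  obtain \<kappa>0 C0 \<rho> where \<kappa>0: "\<kappa>0 > 0" and C0: "C0 > 0" and \<rho>: "0 < \<rho>" "\<rho> < 1"
    and dec: "\<And>n. mom \<kappa>0 n \<le> ennreal (C0 * \<rho> ^ n)"
    using some_decay by blast
  obtain C1 where C1: "C1 > 0" and bd: "\<And>n. mom \<alpha> n \<le> ennreal C1"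
    using mom_critical_bounded by blast
  have \<rho>n: "\<rho> ^ n = \<rho> powr real n" for n
    using \<rho> by (simp add: powr_realpow)
  have lt: "\<kappa>0 < \<alpha>"
  proof (rule ccontr)
    assume "\<not> \<kappa>0 < \<alpha>"
    then have le: "\<alpha> \<le> \<kappa>0" by simp
    define z :: real where "z = (1/2) powr (1/\<alpha>)"
    have z: "z > 0" "z powr \<alpha> = 1/2"
      using \<alpha>_pos by (auto simp: z_def powr_powr)
    have "1 \<le> 1/2 + z powr (\<alpha> - \<kappa>0) * (C0 * \<rho> ^ n)" for n
    proof -
      have "1 \<le> mom \<alpha> n" by (rule mom_critical_ge_1)
      also have "\<dots> \<le> ennreal (z powr (\<alpha> - 0)) * mom 0 n + ennreal (z powr (\<alpha> - \<kappa>0)) * mom \<kappa>0 n"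
        using \<alpha>_pos le z by (intro mom_interpolate) auto
      also have "\<dots> \<le> ennreal (z powr (\<alpha> - 0)) * 1 + ennreal (z powr (\<alpha> - \<kappa>0)) * ennreal (C0 * \<rho> ^ n)"
        by (intro add_mono mult_left_mono mom_zero_le dec) auto
      also have "\<dots> = ennreal (1/2 + z powr (\<alpha> - \<kappa>0) * (C0 * \<rho> ^ n))"
        using z C0 \<rho> by (simp add: ennreal_mult[symmetric] ennreal_plus[symmetric] del: ennreal_plus)
      finally show ?thesis
        using ennreal_le_1 not_le by (metis ennreal_less_one_iff)
    qed
    moreover have "(\<lambda>n. 1/2 + z powr (\<alpha> - \<kappa>0) * (C0 * \<rho> ^ n)) \<longlonglongrightarrow> 1/2 + z powr (\<alpha> - \<kappa>0) * (C0 * 0)"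
      using \<rho> by (intro tendsto_intros LIMSEQ_realpow_zero) auto
    ultimately have "1 \<le> 1/2 + z powr (\<alpha> - \<kappa>0) * (C0 * 0)"
      by (intro LIMSEQ_le_const) auto
    then show False by simp
  qed
  consider "\<kappa> < \<kappa>0" | "\<kappa> = \<kappa>0" | "\<kappa>0 < \<kappa>" by linarith
  then show ?thesis
  proof cases
    case 1
    define \<rho>' where "\<rho>' = \<rho> powr (\<kappa> / (2 * \<kappa>0))"
    have \<rho>': "0 < \<rho>'" "\<rho>' < 1"
      using \<rho> \<kappa>0 assms by (auto simp: \<rho>'_def powr01_less_one)
    have "mom \<kappa> n \<le> ennreal ((1 + C0) * \<rho>' ^ n)" for n
    proof -
      define z where "z = \<rho> powr (real n / (2 * \<kappa>0))"
      have z: "z > 0" using \<rho> by (simp add: z_def)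
      have z1: "z powr (\<kappa> - 0) = \<rho>' ^ n"
        using \<rho>' by (simp add: z_def \<rho>'_def powr_powr powr_realpow[symmetric] mult_ac)
      have "z powr (\<kappa> - \<kappa>0) * \<rho> ^ n = \<rho> powr ((real n / (2 * \<kappa>0)) * (\<kappa> - \<kappa>0) + real n)"
        unfolding z_def \<rho>n powr_powr powr_add ..
      also have "\<dots> \<le> \<rho> powr (\<kappa> / (2 * \<kappa>0) * real n)"
        using \<rho> \<kappa>0 by (intro powr_mono') (auto simp: field_simps)
      also have "\<dots> = \<rho>' ^ n"
        using \<rho>' \<rho> by (simp add: \<rho>'_def powr_powr powr_realpow[symmetric])
      finally have z2: "z powr (\<kappa> - \<kappa>0) * \<rho> ^ n \<le> \<rho>' ^ n" .
      have "mom \<kappa> n \<le> ennreal (z powr (\<kappa> - 0)) * mom 0 n + ennreal (z powr (\<kappa> - \<kappa>0)) * mom \<kappa>0 n"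
        using assms 1 z by (intro mom_interpolate) auto
      also have "\<dots> \<le> ennreal (z powr (\<kappa> - 0)) * 1 + ennreal (z powr (\<kappa> - \<kappa>0)) * ennreal (C0 * \<rho> ^ n)"
        by (intro add_mono mult_left_mono mom_zero_le dec) auto
      also have "\<dots> = ennreal (\<rho>' ^ n + C0 * (z powr (\<kappa> - \<kappa>0) * \<rho> ^ n))"
        using C0 \<rho> \<rho>' by (simp add: z1[simplified] ennreal_mult[symmetric] ennreal_plus[symmetric] mult_ac del: ennreal_plus)
      also have "\<dots> \<le> ennreal ((1 + C0) * \<rho>' ^ n)"
        using mult_left_mono[OF z2 less_imp_le[OF C0]] by (intro ennreal_leI) (simp add: algebra_simps)
      finally show ?thesis .
    qed
    then show ?thesis using \<rho>' C0 by (intro exI[of _ "1 + C0"] conjI exI[of _ \<rho>']) auto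
  next
    case 2
    then show ?thesis using dec \<rho> C0 by blast
  next
    case 3
    define \<rho>' where "\<rho>' = max (\<rho> powr (1/2)) (\<rho> powr ((\<alpha> - \<kappa>) / (2 * (\<kappa> - \<kappa>0))))"
    have \<rho>': "0 < \<rho>'" "\<rho>' < 1"
      using \<rho> 3 assms by (auto simp: \<rho>'_def powr01_less_one less_max_iff_disj)
    have "mom \<kappa> n \<le> ennreal ((C0 + C1) * \<rho>' ^ n)" for n
    proof -
      define z where "z = \<rho> powr (- real n / (2 * (\<kappa> - \<kappa>0)))"
      have z: "z > 0" using \<rho> by (simp add: z_def)
      have "z powr (\<kappa> - \<kappa>0) * \<rho> ^ n = \<rho> powr (- real n / (2 * (\<kappa> - \<kappa>0)) * (\<kappa> - \<kappa>0) + real n)"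
        unfolding z_def \<rho>n powr_powr powr_add ..
      also have "\<dots> = \<rho> powr ((1/2) * real n)"
        using 3 by (intro arg_cong[where f="\<lambda>e. \<rho> powr e"]) (simp add: field_simps)
      also have "\<dots> = (\<rho> powr (1/2)) ^ n"
        using \<rho> by (subst powr_powr[symmetric]) (simp add: powr_realpow)
      also have "\<dots> \<le> \<rho>' ^ n"
        by (intro power_mono) (auto simp: \<rho>'_def)
      finally have z1: "z powr (\<kappa> - \<kappa>0) * \<rho> ^ n \<le> \<rho>' ^ n" .
      have "z powr (\<kappa> - \<alpha>) = \<rho> powr ((\<alpha> - \<kappa>) / (2 * (\<kappa> - \<kappa>0)) * real n)"
        unfolding z_def powr_powr by (intro arg_cong[where f="\<lambda>e. \<rho> powr e"]) (simp add: minus_divide_left[symmetric] left_diff_distrib right_diff_distrib diff_divide_distrib mult.commute)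
      also have "\<dots> = (\<rho> powr ((\<alpha> - \<kappa>) / (2 * (\<kappa> - \<kappa>0)))) ^ n"
        using \<rho> by (subst powr_powr[symmetric]) (simp add: powr_realpow)
      also have "\<dots> \<le> \<rho>' ^ n"
        by (intro power_mono) (auto simp: \<rho>'_def)
      finally have z2: "z powr (\<kappa> - \<alpha>) \<le> \<rho>' ^ n" .
      have "mom \<kappa> n \<le> ennreal (z powr (\<kappa> - \<kappa>0)) * mom \<kappa>0 n + ennreal (z powr (\<kappa> - \<alpha>)) * mom \<alpha> n"
        using assms 3 z by (intro mom_interpolate) auto
      also have "\<dots> \<le> ennreal (z powr (\<kappa> - \<kappa>0)) * ennreal (C0 * \<rho> ^ n) + ennreal (z powr (\<kappa> - \<alpha>)) * ennreal C1"
        by (intro add_mono mult_left_mono dec bd) auto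
      also have "\<dots> = ennreal (C0 * (z powr (\<kappa> - \<kappa>0) * \<rho> ^ n) + C1 * z powr (\<kappa> - \<alpha>))"
        using C0 C1 \<rho> by (simp add: ennreal_mult[symmetric] ennreal_plus[symmetric] mult_ac del: ennreal_plus)
      also have "\<dots> \<le> ennreal ((C0 + C1) * \<rho>' ^ n)"
        using mult_left_mono[OF z1 less_imp_le[OF C0]] mult_left_mono[OF z2 less_imp_le[OF C1]]
        by (intro ennreal_leI) (simp add: algebra_simps)
      finally show ?thesis .
    qed
    then show ?thesis using \<rho>' C0 C1 by (intro exI[of _ "C0 + C1"] conjI exI[of _ \<rho>']) auto
  qed
qed

text \<open>
  Below \<open>\<alpha>\<close> all moments decay, so an order whose moments are at least one is at least \<open>\<alpha>\<close>.
\<close>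

lemma log_moment: "(\<integral>\<^sup>+a. ennreal (mnorm a powr \<alpha> * max 0 (ln (mnorm a))) \<partial>m) < \<infinity>"
proof -
  obtain \<kappa> where \<kappa>: "\<kappa> > 0" "\<And>n. 1 \<le> mom \<kappa> n"
    and fin: "(\<integral>\<^sup>+a. ennreal (mnorm a powr \<kappa> * max 0 (ln (mnorm a))) \<partial>m) < \<infinity>"
    using large_moment by blast
  have "\<alpha> \<le> \<kappa>"
  proof (rule ccontr)
    assume "\<not> \<alpha> \<le> \<kappa>"
    then obtain C \<rho> where C: "C > 0" "0 < \<rho>" "\<rho> < 1" "\<And>n. mom \<kappa> n \<le> ennreal (C * \<rho> ^ n)"
      using mom_decay[OF \<kappa>(1)] by auto
    have "(\<lambda>n. C * \<rho> ^ n) \<longlonglongrightarrow> C * 0"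
      using C by (intro tendsto_intros LIMSEQ_realpow_zero) auto
    then have "\<forall>\<^sub>F n in sequentially. C * \<rho> ^ n < 1"
      by (rule order_tendstoD(2)) simp
    then obtain n where "C * \<rho> ^ n < 1"
      using eventually_happens'[OF sequentially_bot] by blast
    then have "ennreal (C * \<rho> ^ n) < 1"
      using C by (simp add: ennreal_less_one_iff)
    then show False using \<kappa>(2)[of n] C(4)[of n] by (metis leD order_trans)
  qed
  have "(\<integral>\<^sup>+a. ennreal (mnorm a powr \<alpha> * max 0 (ln (mnorm a))) \<partial>m) \<le> (\<integral>\<^sup>+a. ennreal (mnorm a powr \<kappa> * max 0 (ln (mnorm a))) \<partial>m)"
  proof (intro nn_integral_mono ennreal_leI)
    fix a :: "real^'d^'d"
    show "mnorm a powr \<alpha> * max 0 (ln (mnorm a)) \<le> mnorm a powr \<kappa> * max 0 (ln (mnorm a))"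
    proof (cases "1 \<le> mnorm a")
      case True
      then show ?thesis using \<open>\<alpha> \<le> \<kappa>\<close> by (intro mult_right_mono powr_mono) auto
    next
      case False
      then have "ln (mnorm a) \<le> 0" using mnorm_nonneg[of a] by (cases "mnorm a = 0") (simp_all add: less_le)
      then show ?thesis by simp
    qed
  qed
  then show ?thesis using fin by (rule le_less_trans)
qed

end

section \<open>Renewal estimates for the norm of the random product\<close>

lemma suminf_ennreal_geometric:
  assumes "0 \<le> C" "0 \<le> \<rho>" "\<rho> < 1"
  shows "(\<Sum>k. ennreal (C * \<rho> ^ k)) = ennreal (C / (1 - \<rho>))"
proof -
  have "(\<lambda>k. C * \<rho> ^ k) sums (C * (1 / (1 - \<rho>)))"
    using assms by (intro sums_mult geometric_sums) auto
  then show ?thesis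
    using assms by (subst suminf_ennreal2) (auto simp: sums_iff)
qed

lemma suminf_ennreal_swap:
  fixes f :: "nat \<Rightarrow> nat \<Rightarrow> ennreal"
  shows "(\<Sum>k. \<Sum>j. f k j) = (\<Sum>j. \<Sum>k. f k j)"
proof -
  have "(\<Sum>k. \<Sum>j. f k j) = (\<integral>\<^sup>+k. (\<Sum>j. f k j) \<partial>count_space UNIV)"
    by (rule nn_integral_count_space_nat[symmetric])
  also have "\<dots> = (\<Sum>j. \<integral>\<^sup>+k. f k j \<partial>count_space UNIV)"
    by (rule nn_integral_suminf) auto
  finally show ?thesis by (simp add: nn_integral_count_space_nat)
qed

lemma ex_exp_bracket:
  fixes w :: real
  assumes "1 < w"
  shows "\<exists>j::nat. exp (real j) < w \<and> w \<le> exp (real j + 1)"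
proof -
  have pos: "0 < ln w" using assms by simp
  define j where "j = nat (\<lceil>ln w\<rceil> - 1)"
  have "\<lceil>ln w\<rceil> \<ge> 1" using pos by (simp add: less_ceiling_iff one_le_ceiling)
  then have "real j = of_int \<lceil>ln w\<rceil> - 1" by (simp add: j_def)
  then have "real j < ln w" "ln w \<le> real j + 1"
    using ceiling_correct[of "ln w"] by linarith+
  then have "exp (real j) < exp (ln w)" "exp (ln w) \<le> exp (real j + 1)"
    by simp_all
  then show ?thesis using assms by auto
qed

context matrix_law
begin

text \<open>
  The probability that the chain \<open>a\<close>, \<open>a ** A\<^sub>1\<close>, \<open>a ** A\<^sub>1 ** A\<^sub>2\<close>, ... exceeds the level \<open>y\<close> within
  \<open>n\<close> steps. Its first-step recursion turns stopping-time arguments into inductions on \<open>n\<close>.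
\<close>

primrec hit :: "real \<Rightarrow> nat \<Rightarrow> real^'d^'d \<Rightarrow> ennreal" where
  "hit y 0 a = (if y < mnorm a then 1 else 0)"
| "hit y (Suc n) a = (if y < mnorm a then 1 else \<integral>\<^sup>+b. hit y n (a ** b) \<partial>m)"

lemma measurable_hit [measurable]: "hit y n \<in> borel_measurable borel"
proof (induction n)
  case 0
  have "hit y 0 = (\<lambda>a. if y < mnorm a then 1 else 0)" by auto
  then show ?case by simp
next
  case (Suc n)
  note [measurable] = Suc
  have "hit y (Suc n) = (\<lambda>a. if y < mnorm a then 1 else \<integral>\<^sup>+b. hit y n (a ** b) \<partial>m)" by auto
  also have "\<dots> \<in> borel_measurable borel" by measurable
  finally show ?case .
qed

end

context critical_matrix_law
begin

lemma sum_mom_bounded: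
  assumes "0 < \<kappa>" "\<kappa> < \<alpha>"
  shows "\<exists>C>0. (\<Sum>k. mom \<kappa> k) \<le> ennreal C"
proof -
  obtain C \<rho> where C: "C > 0" "0 < \<rho>" "\<rho> < 1" "\<And>n. mom \<kappa> n \<le> ennreal (C * \<rho> ^ n)"
    using mom_decay[OF assms] by blast
  have "(\<Sum>k. mom \<kappa> k) \<le> (\<Sum>k. ennreal (C * \<rho> ^ k))"
    by (intro suminf_le C) auto
  also have "\<dots> = ennreal (C / (1 - \<rho>))"
    using C by (intro suminf_ennreal_geometric) auto
  finally show ?thesis
    using C by (intro exI[of _ "C / (1 - \<rho>)"]) auto
qed

text \<open>
  Maximal inequality. By the sandwich property \<open>mnorm (a ** P\<^sub>n) powr \<alpha>\<close>, with \<open>P\<^sub>n\<close> a product of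
  length \<open>n\<close>, behaves like a submartingale up to a constant, so Doob's argument applies; it is
  carried out as an induction on the horizon.
\<close>

lemma hit_le: "\<exists>C>0. \<forall>y>0. \<forall>n. hit y n (mat 1) \<le> ennreal (C * y powr - \<alpha>)"
proof -
  obtain l s where s: "0 < s" and q: "0 < emeasure (law l) {D. \<forall>i j. s < D $ i $ j}"
    using positive_product by blast
  define c where "c = s powr \<alpha> * measure (law l) {D. \<forall>i j. s < D $ i $ j}"
  have c: "c > 0"
    using s q by (auto simp: c_def law.emeasure_eq_measure)
  have cc: "ennreal (s powr \<alpha>) * emeasure (law l) {D. \<forall>i j. s < D $ i $ j} = ennreal c"
    by (simp add: c_def law.emeasure_eq_measure ennreal_mult)
  obtain C1 where C1: "C1 > 0" and bd: "\<And>n. mom \<alpha> n \<le> ennreal C1"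
    using mom_critical_bounded by blast
  have ind: "ennreal c * (hit y n a * ennreal (y powr \<alpha>)) \<le> (\<integral>\<^sup>+b. ennreal (mnorm (a ** b) powr \<alpha>) \<partial>law (n + l))"
    if "y > 0" "mat_nonneg a" for y n a
    using that(2)
  proof (induction n arbitrary: a)
    case (0 a)
    show ?case
    proof (cases "y < mnorm a")
      case True
      have "ennreal c * ennreal (y powr \<alpha>) \<le> ennreal c * (ennreal (mnorm a powr \<alpha>) * mom \<alpha> 0)"
        using True \<alpha>_pos \<open>y > 0\<close> mult_mono[OF ennreal_leI[OF powr_mono2[of \<alpha> y "mnorm a"]] mom_critical_ge_1[of 0]]
        by (intro mult_left_mono) auto
      also have "\<dots> \<le> (\<integral>\<^sup>+b. ennreal (mnorm (a ** b) powr \<alpha>) \<partial>law (l + 0))"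
        unfolding cc[symmetric] using s \<alpha>_pos 0 by (intro nn_integral_sandwich) auto
      finally show ?thesis using True by simp
    qed simp
  next
    case (Suc n a)
    show ?case
    proof (cases "y < mnorm a")
      case True
      have "ennreal c * ennreal (y powr \<alpha>) \<le> ennreal c * (ennreal (mnorm a powr \<alpha>) * mom \<alpha> (Suc n))"
        using True \<alpha>_pos \<open>y > 0\<close> mult_mono[OF ennreal_leI[OF powr_mono2[of \<alpha> y "mnorm a"]] mom_critical_ge_1[of "Suc n"]]
        by (intro mult_left_mono) auto
      also have "\<dots> \<le> (\<integral>\<^sup>+b. ennreal (mnorm (a ** b) powr \<alpha>) \<partial>law (l + Suc n))"
        unfolding cc[symmetric] using s \<alpha>_pos Suc.prems by (intro nn_integral_sandwich) auto
      finally show ?thesis using True by (simp add: add.commute)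
    next
      case False
      have "ennreal c * (hit y (Suc n) a * ennreal (y powr \<alpha>)) =
          (\<integral>\<^sup>+b. ennreal c * (hit y n (a ** b) * ennreal (y powr \<alpha>)) \<partial>m)"
        using False by (simp add: nn_integral_cmult nn_integral_multc)
      also have "\<dots> \<le> (\<integral>\<^sup>+b. \<integral>\<^sup>+c. ennreal (mnorm (a ** b ** c) powr \<alpha>) \<partial>law (n + l) \<partial>m)"
        using nonneg_m by (intro nn_integral_mono_AE) (auto elim!: eventually_mono intro!: Suc mat_nonneg_mult)
      also have "\<dots> = (\<integral>\<^sup>+b. ennreal (mnorm (a ** b) powr \<alpha>) \<partial>law (Suc (n + l)))"
        by (subst nn_integral_law_Suc') (auto simp: matrix_mul_assoc)
      finally show ?thesis by simp
    qed
  qed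
  have "hit y n (mat 1) \<le> ennreal (C1 / c * y powr - \<alpha>)" if "y > 0" for y n
  proof -
    have "ennreal (c * y powr \<alpha>) * hit y n (mat 1) \<le> mom \<alpha> (n + l)"
      using ind[OF that mat_nonneg_one, of n] c by (simp add: mom_def ennreal_mult mult_ac)
    also have "\<dots> \<le> ennreal C1" by (rule bd)
    also have "\<dots> = ennreal (c * y powr \<alpha>) * ennreal (C1 / c * y powr - \<alpha>)"
      using c C1 that by (simp add: ennreal_mult[symmetric] powr_minus field_simps)
    finally show ?thesis
      using c that by (subst (asm) ennreal_mult_le_mult_iff) auto
  qed
  then show ?thesis
    using c C1 by (intro exI[of _ "C1 / c"]) auto
qed

text \<open>
  The expected number of visits to a multiplicative window is at most the probability of ever
  exceeding its lower end times the expected number of visits that follow a first one, and the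
  latter is bounded because small moments of the product decay geometrically.
\<close>

lemma visits_le:
  "\<exists>C>0. \<forall>y>0. (\<Sum>k. emeasure (law k) {a. y < mnorm a \<and> mnorm a \<le> exp 1 * y}) \<le> ennreal (C * y powr - \<alpha>)"
proof -
  obtain C0 where C0: "C0 > 0" and sm: "(\<Sum>k. mom (\<alpha>/2) k) \<le> ennreal C0"
    using sum_mom_bounded[of "\<alpha>/2"] \<alpha>_pos by auto
  obtain C1 where C1: "C1 > 0" and hit: "\<And>y n. y > 0 \<Longrightarrow> hit y n (mat 1) \<le> ennreal (C1 * y powr - \<alpha>)"
    using hit_le by blast
  define G where "G = exp (\<alpha>/2) * C0"
  have G: "G > 0" using C0 by (simp add: G_def)
  have G': "(\<Sum>k. emeasure (law k) {b. exp (-1) < mnorm b}) \<le> ennreal G"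
  proof -
    have "emeasure (law k) {b. exp (-1) < mnorm b} \<le> ennreal (exp (\<alpha>/2)) * mom (\<alpha>/2) k" for k
    proof -
      have "emeasure (law k) {b. exp (-1) < mnorm b} = (\<integral>\<^sup>+b. indicator {b. exp (-1) < mnorm b} b \<partial>law k)"
        by simp
      also have "\<dots> \<le> (\<integral>\<^sup>+b. ennreal (exp (\<alpha>/2)) * ennreal (mnorm b powr (\<alpha>/2)) \<partial>law k)"
      proof (intro nn_integral_mono)
        fix b :: "real^'d^'d"
        have "1 \<le> exp (\<alpha>/2) * mnorm b powr (\<alpha>/2)" if "exp (-1) < mnorm b"
        proof -
          have "1 = exp (\<alpha>/2) * exp (-1) powr (\<alpha>/2)"
            by (simp add: powr_def exp_add[symmetric])
          also have "\<dots> \<le> exp (\<alpha>/2) * mnorm b powr (\<alpha>/2)"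
            using that \<alpha>_pos by (intro mult_left_mono powr_mono2) auto
          finally show ?thesis .
        qed
        then show "indicator {b. exp (-1) < mnorm b} b \<le> ennreal (exp (\<alpha>/2)) * ennreal (mnorm b powr (\<alpha>/2))"
          by (auto simp: indicator_def ennreal_mult[symmetric] simp flip: ennreal_1 intro!: ennreal_leI)
      qed
      also have "\<dots> = ennreal (exp (\<alpha>/2)) * mom (\<alpha>/2) k"
        unfolding mom_def by (simp add: nn_integral_cmult)
      finally show ?thesis .
    qed
    then have "(\<Sum>k. emeasure (law k) {b. exp (-1) < mnorm b}) \<le> (\<Sum>k. ennreal (exp (\<alpha>/2)) * mom (\<alpha>/2) k)"
      by (intro suminf_le) auto
    also have "\<dots> \<le> ennreal (exp (\<alpha>/2)) * ennreal C0"
      by (simp add: mult_left_mono sm)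
    finally show ?thesis using C0 by (simp add: G_def ennreal_mult)
  qed
  have "(\<Sum>k. emeasure (law k) {a. y < mnorm a \<and> mnorm a \<le> exp 1 * y}) \<le> ennreal (G * C1 * y powr - \<alpha>)" if y: "y > 0" for y
  proof -
    define W where "W = {a::real^'d^'d. y < mnorm a \<and> mnorm a \<le> exp 1 * y}"
    have [measurable]: "W \<in> sets borel" unfolding W_def by measurable
    define occ where "occ n a = (\<Sum>k\<le>n. \<integral>\<^sup>+b. indicator W (a ** b) \<partial>law k)" for n :: nat and a :: "real^'d^'d"
    have [measurable]: "occ n \<in> borel_measurable borel" for n
      unfolding occ_def by measurable
    have occ_Suc: "occ (Suc n) a = indicator W a + (\<integral>\<^sup>+b. occ n (a ** b) \<partial>m)" for n a
    proof -
      have "occ (Suc n) a = indicator W a + (\<Sum>k\<le>n. \<integral>\<^sup>+b. indicator W (a ** b) \<partial>law (Suc k))"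
        unfolding occ_def by (subst sum.atMost_Suc_shift) simp
      also have "(\<Sum>k\<le>n. \<integral>\<^sup>+b. indicator W (a ** b) \<partial>law (Suc k)) = (\<Sum>k\<le>n. \<integral>\<^sup>+b. \<integral>\<^sup>+c. indicator W (a ** b ** c) \<partial>law k \<partial>m)"
        by (intro sum.cong refl, subst nn_integral_law_Suc') (auto simp: matrix_mul_assoc)
      also have "\<dots> = (\<integral>\<^sup>+b. occ n (a ** b) \<partial>m)"
        unfolding occ_def by (subst nn_integral_sum) auto
      finally show ?thesis .
    qed
    have occ_0: "occ 0 a = indicator W a" for a
      by (simp add: occ_def)
    have in_W: "occ n a \<le> ennreal G" if "a \<in> W" for n a
    proof -
      have "occ n a \<le> (\<Sum>k\<le>n. emeasure (law k) {b. exp (-1) < mnorm b})"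
        unfolding occ_def
      proof (intro sum_mono)
        fix k
        have "(\<integral>\<^sup>+b. indicator W (a ** b) \<partial>law k) \<le> (\<integral>\<^sup>+b. indicator {b. exp (-1) < mnorm b} b \<partial>law k)"
        proof (intro nn_integral_mono)
          fix b
          have "exp (-1) < mnorm b" if "a ** b \<in> W"
          proof -
            have "y < mnorm a * mnorm b" using that mnorm_mult_le[of a b] by (simp add: W_def)
            also have "\<dots> \<le> exp 1 * y * mnorm b"
              using \<open>a \<in> W\<close> by (intro mult_right_mono) (auto simp: W_def)
            finally have "1 < exp 1 * mnorm b" using y by (simp add: field_simps)
            then show ?thesis by (simp add: exp_minus field_simps)
          qed
          then show "indicator W (a ** b) \<le> (indicator {b. exp (-1) < mnorm b} b :: ennreal)"
            by (auto simp: indicator_def)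
        qed
        then show "(\<integral>\<^sup>+b. indicator W (a ** b) \<partial>law k) \<le> emeasure (law k) {b. exp (-1) < mnorm b}"
          by simp
      qed
      also have "\<dots> \<le> (\<Sum>k. emeasure (law k) {b. exp (-1) < mnorm b})"
        by (intro sum_le_suminf) auto
      finally show ?thesis using G' by (rule order_trans)
    qed
    have occ_G: "occ n a \<le> ennreal G" for n a
    proof (induction n arbitrary: a)
      case 0
      show ?case using in_W[of a 0] by (cases "a \<in> W") (auto simp: occ_0)
    next
      case (Suc n)
      show ?case
      proof (cases "a \<in> W")
        case True
        then show ?thesis by (rule in_W)
      next
        case False
        have "(\<integral>\<^sup>+b. occ n (a ** b) \<partial>m) \<le> (\<integral>\<^sup>+b. ennreal G \<partial>m)"
          by (intro nn_integral_mono Suc)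
        then show ?thesis using False by (simp add: occ_Suc emeasure_space_1[simplified])
      qed
    qed
    have occ_hit: "occ n a \<le> ennreal G * hit y n a" for n a
    proof (induction n arbitrary: a)
      case 0
      show ?case using occ_G[of 0 a] by (cases "y < mnorm a") (auto simp: occ_0 W_def)
    next
      case (Suc n)
      show ?case
      proof (cases "y < mnorm a")
        case True
        then show ?thesis using occ_G[of "Suc n" a] by simp
      next
        case False
        have "(\<integral>\<^sup>+b. occ n (a ** b) \<partial>m) \<le> (\<integral>\<^sup>+b. ennreal G * hit y n (a ** b) \<partial>m)"
          by (intro nn_integral_mono Suc)
        also have "\<dots> = ennreal G * hit y (Suc n) a"
          using False by (simp add: nn_integral_cmult)
        finally show ?thesis using False by (simp add: occ_Suc W_def)
      qed
    qed
    have "(\<Sum>k<n. emeasure (law k) W) \<le> ennreal (G * C1 * y powr - \<alpha>)" for n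
    proof -
      have "(\<Sum>k<n. emeasure (law k) W) \<le> (\<Sum>k\<le>n. emeasure (law k) W)"
        by (intro sum_mono2) auto
      also have "\<dots> = occ n (mat 1)"
        by (simp add: occ_def)
      also have "\<dots> \<le> ennreal G * ennreal (C1 * y powr - \<alpha>)"
        by (intro order_trans[OF occ_hit] mult_left_mono hit y) auto
      finally show ?thesis using G C1 by (simp add: ennreal_mult[symmetric] mult_ac)
    qed
    then have "(\<Sum>k. emeasure (law k) W) \<le> ennreal (G * C1 * y powr - \<alpha>)"
      unfolding suminf_eq_SUP by (intro SUP_least)
    then show ?thesis by (simp add: W_def)
  qed
  then show ?thesis
    using G C1 by (intro exI[of _ "G * C1"]) auto
qed

end

lemma one_le_ennreal_affineD:
  assumes "0 \<le> a" "0 \<le> b" "0 \<le> c" "0 \<le> d" "0 \<le> h"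
    and "1 \<le> ennreal a + ennreal b * (ennreal c * ennreal h + ennreal d)"
  shows "1 \<le> a + b * (c * h + d)"
proof -
  have "ennreal 1 \<le> ennreal (a + b * (c * h + d))"
    using assms by (simp add: ennreal_mult ennreal_plus)
  then show ?thesis
    using assms by (subst (asm) ennreal_le_iff) auto
qed

context critical_matrix_law
begin

text \<open>
  The sum over \<open>k\<close> of the laws of the products is the occupation (Green) measure of the chain. Cutting
  the region above \<open>z\<close> into windows of ratio \<open>exp 1\<close> reduces its tail to the bound on visits.
\<close>

lemma green_tail:
  assumes "0 \<le> \<theta>" "\<theta> < \<alpha>"
  shows "\<exists>C>0. \<forall>z>0. (\<Sum>k. \<integral>\<^sup>+a. ennreal (mnorm a powr \<theta>) * indicator {a. z < mnorm a} a \<partial>law k)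
    \<le> ennreal (C * z powr (\<theta> - \<alpha>))"
proof -
  obtain C where C: "C > 0" and vis: "\<And>y. y > 0 \<Longrightarrow>
      (\<Sum>k. emeasure (law k) {a. y < mnorm a \<and> mnorm a \<le> exp 1 * y}) \<le> ennreal (C * y powr - \<alpha>)"
    using visits_le by blast
  define \<rho> where "\<rho> = exp (\<theta> - \<alpha>)"
  have \<rho>: "0 < \<rho>" "\<rho> < 1" using assms by (auto simp: \<rho>_def)
  have "(\<Sum>k. \<integral>\<^sup>+a. ennreal (mnorm a powr \<theta>) * indicator {a. z < mnorm a} a \<partial>law k)
    \<le> ennreal (C * exp \<theta> / (1 - \<rho>) * z powr (\<theta> - \<alpha>))" if z: "z > 0" for z
  proof -
    define W where "W j = {a::real^'d^'d. z * exp (real j) < mnorm a \<and> mnorm a \<le> exp 1 * (z * exp (real j))}" for j :: nat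
    have [measurable]: "W j \<in> sets borel" for j unfolding W_def by measurable
    have pw: "ennreal (mnorm a powr \<theta>) * indicator {a. z < mnorm a} a
        \<le> (\<Sum>j. ennreal ((z * exp (real j + 1)) powr \<theta>) * indicator (W j) a)" for a :: "real^'d^'d"
    proof (cases "z < mnorm a")
      case True
      then obtain j where j: "exp (real j) < mnorm a / z" "mnorm a / z \<le> exp (real j + 1)"
        using ex_exp_bracket[of "mnorm a / z"] z by auto
      then have aW: "a \<in> W j"
        using z by (simp add: W_def field_simps exp_add)
      have "ennreal (mnorm a powr \<theta>) \<le> ennreal ((z * exp (real j + 1)) powr \<theta>) * indicator (W j) a"
        using aW j z assms by (auto intro!: ennreal_leI powr_mono2 simp: field_simps)
      also have "\<dots> = (\<Sum>i\<in>{j}. ennreal ((z * exp (real i + 1)) powr \<theta>) * indicator (W i) a)"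
        by (subst sum.insert, simp, simp, simp)
      also have "\<dots> \<le> (\<Sum>j. ennreal ((z * exp (real j + 1)) powr \<theta>) * indicator (W j) a)"
        by (intro sum_le_suminf) auto
      finally show ?thesis using True by simp
    qed simp
    have "(\<Sum>k. \<integral>\<^sup>+a. ennreal (mnorm a powr \<theta>) * indicator {a. z < mnorm a} a \<partial>law k)
       \<le> (\<Sum>k. \<integral>\<^sup>+a. (\<Sum>j. ennreal ((z * exp (real j + 1)) powr \<theta>) * indicator (W j) a) \<partial>law k)"
      by (intro suminf_le nn_integral_mono pw) auto
    also have "\<dots> = (\<Sum>k. \<Sum>j. ennreal ((z * exp (real j + 1)) powr \<theta>) * emeasure (law k) (W j))"
      by (subst nn_integral_suminf) (auto simp: nn_integral_cmult)
    also have "\<dots> = (\<Sum>j. ennreal ((z * exp (real j + 1)) powr \<theta>) * (\<Sum>k. emeasure (law k) (W j)))"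
      by (subst suminf_ennreal_swap) simp
    also have "\<dots> \<le> (\<Sum>j. ennreal (C * exp \<theta> * z powr (\<theta> - \<alpha>) * \<rho> ^ j))"
    proof (intro suminf_le)
      fix j
      have "ennreal ((z * exp (real j + 1)) powr \<theta>) * (\<Sum>k. emeasure (law k) (W j))
         \<le> ennreal ((z * exp (real j + 1)) powr \<theta>) * ennreal (C * (z * exp (real j)) powr - \<alpha>)"
        unfolding W_def using z by (intro mult_left_mono vis) auto
      also have "\<dots> = ennreal (C * ((z * exp (real j + 1)) powr \<theta> * (z * exp (real j)) powr - \<alpha>))"
        using C by (simp add: ennreal_mult[symmetric] mult_ac)
      also have "(z * exp (real j + 1)) powr \<theta> * (z * exp (real j)) powr - \<alpha> = exp \<theta> * z powr (\<theta> - \<alpha>) * \<rho> ^ j"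
        using z by (simp add: powr_def \<rho>_def ln_mult exp_of_nat_mult[symmetric] exp_add[symmetric] algebra_simps)
      finally show "ennreal ((z * exp (real j + 1)) powr \<theta>) * (\<Sum>k. emeasure (law k) (W j)) \<le> ennreal (C * exp \<theta> * z powr (\<theta> - \<alpha>) * \<rho> ^ j)"
        by (simp add: mult_ac)
    qed auto
    also have "\<dots> = ennreal (C * exp \<theta> * z powr (\<theta> - \<alpha>) / (1 - \<rho>))"
      using C \<rho> by (intro suminf_ennreal_geometric) auto
    finally show ?thesis by (simp add: mult_ac)
  qed
  then show ?thesis
    using C \<rho> by (intro exI[of _ "C * exp \<theta> / (1 - \<rho>)"]) auto
qed

text \<open>
  At the critical order every window contributes the same constant, so only the number of windows,
  a logarithm, remains.
\<close>

lemma green_window: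
  "\<exists>C>0. \<forall>z>0. \<forall>u\<ge>z. (\<Sum>k. \<integral>\<^sup>+a. ennreal (mnorm a powr \<alpha>) * indicator {a. z < mnorm a \<and> mnorm a \<le> u} a \<partial>law k)
    \<le> ennreal (C * (1 + ln (u / z)))"
proof -
  obtain C where C: "C > 0" and vis: "\<And>y. y > 0 \<Longrightarrow>
      (\<Sum>k. emeasure (law k) {a. y < mnorm a \<and> mnorm a \<le> exp 1 * y}) \<le> ennreal (C * y powr - \<alpha>)"
    using visits_le by blast
  have "(\<Sum>k. \<integral>\<^sup>+a. ennreal (mnorm a powr \<alpha>) * indicator {a. z < mnorm a \<and> mnorm a \<le> u} a \<partial>law k)
    \<le> ennreal (C * exp \<alpha> * (1 + ln (u / z)))" if z: "z > 0" "u \<ge> z" for z u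
  proof -
    define W where "W j = {a::real^'d^'d. z * exp (real j) < mnorm a \<and> mnorm a \<le> exp 1 * (z * exp (real j))}" for j :: nat
    have [measurable]: "W j \<in> sets borel" for j unfolding W_def by measurable
    define J where "J = nat \<lceil>ln (u / z)\<rceil>"
    have ln0: "0 \<le> ln (u / z)" using z by simp
    then have J: "ln (u / z) \<le> real J" "real J \<le> 1 + ln (u / z)"
      using ceiling_correct[of "ln (u / z)"] by (auto simp: J_def)
    have pw: "ennreal (mnorm a powr \<alpha>) * indicator {a. z < mnorm a \<and> mnorm a \<le> u} a
        \<le> (\<Sum>j<J. ennreal ((z * exp (real j + 1)) powr \<alpha>) * indicator (W j) a)" for a :: "real^'d^'d"
    proof (cases "z < mnorm a \<and> mnorm a \<le> u")
      case True
      then obtain j where j: "exp (real j) < mnorm a / z" "mnorm a / z \<le> exp (real j + 1)"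
        using ex_exp_bracket[of "mnorm a / z"] z by auto
      then have aW: "a \<in> W j"
        using z by (simp add: W_def field_simps exp_add)
      have "exp (real j) < u / z"
        using j(1) True z by (meson divide_right_mono less_le_trans less_imp_le)
      also have "\<dots> = exp (ln (u / z))"
        using z by simp
      finally have jJ: "j < J" using J by simp
      have "ennreal (mnorm a powr \<alpha>) \<le> ennreal ((z * exp (real j + 1)) powr \<alpha>) * indicator (W j) a"
        using aW j z \<alpha>_pos by (auto intro!: ennreal_leI powr_mono2 simp: field_simps)
      also have "\<dots> = (\<Sum>i\<in>{j}. ennreal ((z * exp (real i + 1)) powr \<alpha>) * indicator (W i) a)"
        by (subst sum.insert, simp, simp, simp)
      also have "\<dots> \<le> (\<Sum>j<J. ennreal ((z * exp (real j + 1)) powr \<alpha>) * indicator (W j) a)"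
        using jJ by (intro sum_mono2) auto
      finally show ?thesis using True by simp
    qed simp
    have "(\<Sum>k. \<integral>\<^sup>+a. ennreal (mnorm a powr \<alpha>) * indicator {a. z < mnorm a \<and> mnorm a \<le> u} a \<partial>law k)
       \<le> (\<Sum>k. \<integral>\<^sup>+a. (\<Sum>j<J. ennreal ((z * exp (real j + 1)) powr \<alpha>) * indicator (W j) a) \<partial>law k)"
      by (intro suminf_le nn_integral_mono pw) auto
    also have "\<dots> = (\<Sum>k. \<Sum>j<J. ennreal ((z * exp (real j + 1)) powr \<alpha>) * emeasure (law k) (W j))"
      by (subst nn_integral_sum) (auto simp: nn_integral_cmult)
    also have "\<dots> = (\<Sum>j<J. ennreal ((z * exp (real j + 1)) powr \<alpha>) * (\<Sum>k. emeasure (law k) (W j)))"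
      by (subst suminf_sum) auto
    also have "\<dots> \<le> (\<Sum>j<J. ennreal (C * exp \<alpha>))"
    proof (intro sum_mono)
      fix j
      have "ennreal ((z * exp (real j + 1)) powr \<alpha>) * (\<Sum>k. emeasure (law k) (W j))
         \<le> ennreal ((z * exp (real j + 1)) powr \<alpha>) * ennreal (C * (z * exp (real j)) powr - \<alpha>)"
        unfolding W_def using z by (intro mult_left_mono vis) auto
      also have "\<dots> = ennreal (C * ((z * exp (real j + 1)) powr \<alpha> * (z * exp (real j)) powr - \<alpha>))"
        using C by (simp add: ennreal_mult[symmetric] mult_ac)
      also have "(z * exp (real j + 1)) powr \<alpha> * (z * exp (real j)) powr - \<alpha> = exp \<alpha>"
        using z by (simp add: powr_def ln_mult exp_add[symmetric] algebra_simps)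
      finally show "ennreal ((z * exp (real j + 1)) powr \<alpha>) * (\<Sum>k. emeasure (law k) (W j)) \<le> ennreal (C * exp \<alpha>)" .
    qed
    also have "\<dots> = ennreal (C * exp \<alpha> * real J)"
      using C by (simp add: ennreal_of_nat_eq_real_of_nat ennreal_mult[symmetric] mult_ac)
    also have "\<dots> \<le> ennreal (C * exp \<alpha> * (1 + ln (u / z)))"
      using J C by (intro ennreal_leI mult_left_mono) auto
    finally show ?thesis .
  qed
  then show ?thesis
    using C by (intro exI[of _ "C * exp \<alpha>"]) auto
qed

text \<open>
  A factor \<open>c\<close> can carry the chain from below \<open>u\<close> to above \<open>K * u\<close> only from the range between
  \<open>K * u / mnorm c\<close> and \<open>u\<close>, which consists of about \<open>1 + ln (mnorm c / K)\<close> windows. The critical moment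
  lost to such jumps is thus a tail of the logarithmic moment, small for large \<open>K\<close> uniformly in \<open>u\<close>.
\<close>

lemma overshoot_small:
  assumes "\<eta> > 0"
  shows "\<exists>K\<ge>1. \<forall>u>0. (\<Sum>k. \<integral>\<^sup>+b. indicator {b. mnorm b \<le> u} b *
      (\<integral>\<^sup>+c. ennreal (mnorm (b ** c) powr \<alpha>) * indicator {a. K * u < mnorm a} (b ** c) \<partial>m) \<partial>law k) \<le> ennreal \<eta>"
proof -
  obtain C where C: "C > 0" and win: "\<And>z u. z > 0 \<Longrightarrow> u \<ge> z \<Longrightarrow>
     (\<Sum>k. \<integral>\<^sup>+a. ennreal (mnorm a powr \<alpha>) * indicator {a. z < mnorm a \<and> mnorm a \<le> u} a \<partial>law k)
      \<le> ennreal (C * (1 + ln (u / z)))"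
    using green_window by blast
  define w where "w c = C * mnorm c powr \<alpha> * (1 + max 0 (ln (mnorm c)))" for c :: "real^'d^'d"
  have w0: "0 \<le> w c" for c using C by (auto simp: w_def)
  have [measurable]: "w \<in> borel_measurable borel" unfolding w_def by measurable
  define L where "L K = (\<integral>\<^sup>+c. ennreal (w c) * indicator {c. real K < mnorm c} c \<partial>m)" for K :: nat
  have wfin: "(\<integral>\<^sup>+c. ennreal (w c) \<partial>m) < \<infinity>"
  proof -
    have "(\<integral>\<^sup>+c. ennreal (w c) \<partial>m) = (\<integral>\<^sup>+c. ennreal C * (ennreal (mnorm c powr \<alpha>) + ennreal (mnorm c powr \<alpha> * max 0 (ln (mnorm c)))) \<partial>m)"
      using C by (intro nn_integral_cong)
        (simp add: w_def ennreal_mult[symmetric] ennreal_plus[symmetric] algebra_simps del: ennreal_plus)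
    also have "\<dots> = ennreal C * ((\<integral>\<^sup>+c. ennreal (mnorm c powr \<alpha>) \<partial>m) + (\<integral>\<^sup>+c. ennreal (mnorm c powr \<alpha> * max 0 (ln (mnorm c))) \<partial>m))"
      by (simp add: nn_integral_cmult nn_integral_add)
    also have "\<dots> < \<infinity>"
      using critical_moment_finite log_moment by (simp add: ennreal_mult_less_top)
    finally show ?thesis .
  qed
  have "L \<longlonglongrightarrow> (\<integral>\<^sup>+c. 0 \<partial>m)"
    unfolding L_def
  proof (rule nn_integral_dominated_convergence[where w="\<lambda>c. ennreal (w c)"])
    show "AE c in m. (\<lambda>K. ennreal (w c) * indicator {c. real K < mnorm c} c) \<longlonglongrightarrow> 0"
    proof (rule AE_I2)
      fix c :: "real^'d^'d"
      obtain K0 where K0: "mnorm c \<le> real K0" using real_arch_simple by blast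
      have "\<forall>\<^sub>F K in sequentially. ennreal (w c) * indicator {c. real K < mnorm c} c = 0"
        unfolding eventually_sequentially using K0
        by (intro exI[of _ K0]) (auto simp: indicator_def)
      then show "(\<lambda>K. ennreal (w c) * indicator {c. real K < mnorm c} c) \<longlonglongrightarrow> 0"
        by (rule tendsto_eventually)
    qed
    show "AE c in m. ennreal (w c) * indicator {c. real K < mnorm c} c \<le> ennreal (w c)" for K
      by (auto simp: indicator_def)
  qed (use wfin in auto)
  then have "\<forall>\<^sub>F K in sequentially. L K < ennreal \<eta>"
    using assms by (intro order_tendstoD(2)[where y=0]) auto
  then obtain K where K: "L K < ennreal \<eta>" "K \<ge> 1"
    using eventually_conj[OF _ eventually_ge_at_top[of 1]] eventually_happens'[OF sequentially_bot] by (metis (mono_tags, lifting) eventually_conj)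
  have "(\<Sum>k. \<integral>\<^sup>+b. indicator {b. mnorm b \<le> u} b *
      (\<integral>\<^sup>+c. ennreal (mnorm (b ** c) powr \<alpha>) * indicator {a. real K * u < mnorm a} (b ** c) \<partial>m) \<partial>law k) \<le> ennreal \<eta>"
    if u: "u > 0" for u
  proof -
    let ?f = "\<lambda>(b :: real^'d^'d) (c :: real^'d^'d). ennreal (mnorm b powr \<alpha>) * indicator {b. real K * u / mnorm c < mnorm b \<and> mnorm b \<le> u} b"
    have [measurable]: "(\<lambda>z. ?f (fst z) (snd z)) \<in> borel_measurable (borel \<Otimes>\<^sub>M borel)"
    proof -
      have "(\<lambda>z. ?f (fst z) (snd z)) = (\<lambda>z::(real^'d^'d) \<times> (real^'d^'d). ennreal (mnorm (fst z) powr \<alpha>) * indicator {z. real K * u / mnorm (snd z) < mnorm (fst z) \<and> mnorm (fst z) \<le> u} z)"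
        by (auto simp: indicator_def)
      also have "\<dots> \<in> borel_measurable (borel \<Otimes>\<^sub>M borel)" by measurable
      finally show ?thesis .
    qed
    have "(\<Sum>k. \<integral>\<^sup>+b. indicator {b. mnorm b \<le> u} b *
      (\<integral>\<^sup>+c. ennreal (mnorm (b ** c) powr \<alpha>) * indicator {a. real K * u < mnorm a} (b ** c) \<partial>m) \<partial>law k)
      = (\<Sum>k. \<integral>\<^sup>+b. \<integral>\<^sup>+c. indicator {b. mnorm b \<le> u} b *
      (ennreal (mnorm (b ** c) powr \<alpha>) * indicator {a. real K * u < mnorm a} (b ** c)) \<partial>m \<partial>law k)"
      by (simp add: nn_integral_cmult)
    also have "\<dots> \<le> (\<Sum>k. \<integral>\<^sup>+b. \<integral>\<^sup>+c. ennreal (mnorm c powr \<alpha>) * ?f b c \<partial>m \<partial>law k)"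
    proof (intro suminf_le nn_integral_mono)
      fix b c :: "real^'d^'d"
      show "indicator {b. mnorm b \<le> u} b * (ennreal (mnorm (b ** c) powr \<alpha>) * indicator {a. real K * u < mnorm a} (b ** c))
        \<le> ennreal (mnorm c powr \<alpha>) * ?f b c"
      proof (cases "mnorm b \<le> u \<and> real K * u < mnorm (b ** c)")
        case True
        have *: "real K * u < mnorm b * mnorm c"
          using True mnorm_mult_le[of b c] by linarith
        have "mnorm c > 0"
        proof (rule ccontr)
          assume "\<not> mnorm c > 0"
          then have "mnorm c = 0" using mnorm_nonneg[of c] by linarith
          with * have "real K * u < 0" by simp
          then show False using u K by (simp add: mult_less_0_iff)
        qed
        then have "real K * u / mnorm c < mnorm b" using * by (simp add: field_simps)
        moreover have "mnorm (b ** c) powr \<alpha> \<le> mnorm c powr \<alpha> * mnorm b powr \<alpha>"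
          using mnorm_mult_le[of b c] \<alpha>_pos by (subst powr_mult[symmetric]) (auto intro!: powr_mono2 simp: mult.commute)
        ultimately show ?thesis using True by (simp add: ennreal_mult[symmetric] ennreal_leI)
      qed auto
    qed auto
    also have "\<dots> = (\<Sum>k. \<integral>\<^sup>+c. \<integral>\<^sup>+b. ennreal (mnorm c powr \<alpha>) * ?f b c \<partial>law k \<partial>m)"
    proof (intro suminf_cong)
      fix k
      interpret pair_sigma_finite "law k" m ..
      show "(\<integral>\<^sup>+b. \<integral>\<^sup>+c. ennreal (mnorm c powr \<alpha>) * ?f b c \<partial>m \<partial>law k) = (\<integral>\<^sup>+c. \<integral>\<^sup>+b. ennreal (mnorm c powr \<alpha>) * ?f b c \<partial>law k \<partial>m)"
        by (rule Fubini'[symmetric]) (simp add: split_beta')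
    qed
    also have "\<dots> = (\<integral>\<^sup>+c. ennreal (mnorm c powr \<alpha>) * (\<Sum>k. \<integral>\<^sup>+b. ?f b c \<partial>law k) \<partial>m)"
      by (simp add: nn_integral_suminf[symmetric] nn_integral_cmult)
    also have "\<dots> \<le> L K"
      unfolding L_def
    proof (intro nn_integral_mono)
      fix c :: "real^'d^'d"
      show "ennreal (mnorm c powr \<alpha>) * (\<Sum>k. \<integral>\<^sup>+b. ?f b c \<partial>law k) \<le> ennreal (w c) * indicator {c. real K < mnorm c} c"
      proof (cases "real K < mnorm c")
        case True
        then have c1: "mnorm c > 1" using K by simp
        have "(\<Sum>k. \<integral>\<^sup>+b. ?f b c \<partial>law k) \<le> ennreal (C * (1 + ln (u / (real K * u / mnorm c))))"
          using True u K c1 by (intro win) (auto simp: field_simps)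
        also have "\<dots> \<le> ennreal (C * (1 + max 0 (ln (mnorm c))))"
          using True u K c1 C by (intro ennreal_leI mult_left_mono) (auto simp: ln_div)
        finally have "ennreal (mnorm c powr \<alpha>) * (\<Sum>k. \<integral>\<^sup>+b. ?f b c \<partial>law k) \<le> ennreal (mnorm c powr \<alpha>) * ennreal (C * (1 + max 0 (ln (mnorm c))))"
          by (intro mult_left_mono) auto
        also have "\<dots> = ennreal (w c)"
          using C by (simp add: ennreal_mult[symmetric] w_def mult_ac)
        finally show ?thesis using True by simp
      next
        case False
        have "?f b c = 0 \<or> mnorm c = 0" for b
        proof (cases "mnorm c = 0")
          case nz: False
          then have cp: "mnorm c > 0" using mnorm_nonneg[of c] by linarith
          have "u * mnorm c \<le> real K * u" using False u by (simp add: mult.commute)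
          then have "u \<le> real K * u / mnorm c" using cp by (simp add: field_simps)
          then show ?thesis by (auto simp: indicator_def)
        qed simp
        then have "mnorm c = 0 \<or> (\<forall>b. ?f b c = 0)" by blast
        then show ?thesis
        proof
          assume "\<forall>b. ?f b c = 0"
          then have "(\<Sum>k. \<integral>\<^sup>+b. ?f b c \<partial>law k) = (\<Sum>k. \<integral>\<^sup>+b. 0 \<partial>law k)"
            by (intro suminf_cong nn_integral_cong) blast
          also have "\<dots> = 0" by simp
          finally show ?thesis by (simp only: mult_zero_right zero_le)
        next
          assume "mnorm c = 0"
          then show ?thesis by (simp only: powr_zero_eq_one powr_0 ennreal_0 mult_zero_left zero_le)
        qed
      qed
    qed
    also have "\<dots> \<le> ennreal \<eta>" using K by simp
    finally show ?thesis .
  qed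
  then show ?thesis using K by (intro exI[of _ "real K"]) auto
qed

text \<open>
  The lower bound matching \<open>hit_le\<close>. The critical moment never drops below one, and late in time
  almost all of it lies above the level \<open>u\<close>, so a fixed share of it is collected at the first passage
  above \<open>u\<close>. The overshoot estimate keeps most of this share below \<open>K * u\<close>, where each unit of
  probability contributes at most \<open>(K * u) powr \<alpha>\<close>.
\<close>

lemma hit_ge:
  "\<exists>c>0. \<forall>u\<ge>real CARD('d). \<exists>n. ennreal (c * u powr - \<alpha>) \<le> hit u n (mat 1)"
proof -
  obtain C0 where C0: "C0 > 0" and bd0: "\<And>n. mom \<alpha> n \<le> ennreal C0"
    using mom_critical_bounded by blast
  define C1 where "C1 = max C0 1"
  have C1: "C1 \<ge> 1" by (simp add: C1_def)
  have bd: "mom \<alpha> n \<le> ennreal C1" for n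
    by (rule order_trans[OF bd0]) (simp add: C1_def ennreal_leI)
  obtain C \<rho> where C: "C > 0" "0 < \<rho>" "\<rho> < 1" and dec: "\<And>n. mom (\<alpha>/2) n \<le> ennreal (C * \<rho> ^ n)"
    using mom_decay[of "\<alpha>/2"] \<alpha>_pos by auto
  obtain K where K: "K \<ge> 1" and over: "\<And>u. u > 0 \<Longrightarrow> (\<Sum>k. \<integral>\<^sup>+b. indicator {b. mnorm b \<le> u} b *
      (\<integral>\<^sup>+c. ennreal (mnorm (b ** c) powr \<alpha>) * indicator {a. K * u < mnorm a} (b ** c) \<partial>m) \<partial>law k) \<le> ennreal (1 / (4 * C1))"
    using overshoot_small[of "1 / (4 * C1)"] C1 by auto
  define c where "c = 1 / (4 * C1 * K powr \<alpha>)"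
  have c: "c > 0" using C1 K by (simp add: c_def)
  have "\<exists>n. ennreal (c * u powr - \<alpha>) \<le> hit u n (mat 1)" if u: "u \<ge> real CARD('d)" for u
  proof -
    have u0: "u > 0" using u by (smt (verit) of_nat_0_less_iff zero_less_card_finite)
    (* the critical moment collected at the first passage above u within n steps *)
    define pas where "pas = rec_nat (\<lambda>a::real^'d^'d. if u < mnorm a then ennreal (mnorm a powr \<alpha>) else 0)
       (\<lambda>n f a. if u < mnorm a then ennreal (mnorm a powr \<alpha>) else \<integral>\<^sup>+b. f (a ** b) \<partial>m)"
    have pas_0: "pas 0 a = (if u < mnorm a then ennreal (mnorm a powr \<alpha>) else 0)" for a
      by (simp add: pas_def)
    have pas_Suc: "pas (Suc n) a = (if u < mnorm a then ennreal (mnorm a powr \<alpha>) else \<integral>\<^sup>+b. pas n (a ** b) \<partial>m)" for n a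
      by (simp add: pas_def)
    have pas_big: "u < mnorm a \<Longrightarrow> pas n a = ennreal (mnorm a powr \<alpha>)" for n a
      by (cases n) (auto simp: pas_0 pas_Suc)
    have [measurable]: "pas n \<in> borel_measurable borel" for n
    proof (induction n)
      case 0
      have "pas 0 = (\<lambda>a. if u < mnorm a then ennreal (mnorm a powr \<alpha>) else 0)" by (rule ext) (rule pas_0)
      then show ?case by simp
    next
      case (Suc n)
      note [measurable] = Suc
      have "pas (Suc n) = (\<lambda>a. if u < mnorm a then ennreal (mnorm a powr \<alpha>) else \<integral>\<^sup>+b. pas n (a ** b) \<partial>m)"
        by (rule ext) (rule pas_Suc)
      also have "\<dots> \<in> borel_measurable borel" by measurable
      finally show ?case .
    qed
    let ?g = "\<lambda>a::real^'d^'d. ennreal (mnorm a powr \<alpha>) * indicator {a. u < mnorm a} a"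
    have mass: "(\<integral>\<^sup>+b. ?g (a ** b) \<partial>law n) \<le> ennreal C1 * pas n a" for n a
    proof (induction n arbitrary: a)
      case 0
      have "1 * ?g a \<le> ennreal C1 * ?g a"
        using C1 by (intro mult_right_mono) auto
      then show ?case by (cases "u < mnorm a") (simp_all add: pas_0)
    next
      case (Suc n)
      show ?case
      proof (cases "u < mnorm a")
        case True
        have "(\<integral>\<^sup>+b. ?g (a ** b) \<partial>law (Suc n)) \<le> (\<integral>\<^sup>+b. ennreal (mnorm a powr \<alpha>) * ennreal (mnorm b powr \<alpha>) \<partial>law (Suc n))"
        proof (intro nn_integral_mono)
          fix b
          have "mnorm (a ** b) powr \<alpha> \<le> mnorm a powr \<alpha> * mnorm b powr \<alpha>"
            using mnorm_mult_le[of a b] \<alpha>_pos by (subst powr_mult[symmetric]) (auto intro!: powr_mono2)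
          then show "?g (a ** b) \<le> ennreal (mnorm a powr \<alpha>) * ennreal (mnorm b powr \<alpha>)"
            by (auto simp: indicator_def ennreal_mult[symmetric] intro!: ennreal_leI)
        qed
        also have "\<dots> = ennreal (mnorm a powr \<alpha>) * mom \<alpha> (Suc n)"
          unfolding mom_def by (simp add: nn_integral_cmult)
        also have "\<dots> \<le> ennreal (mnorm a powr \<alpha>) * ennreal C1"
          by (intro mult_left_mono bd) auto
        finally show ?thesis using True by (simp add: pas_Suc mult.commute)
      next
        case False
        have "(\<integral>\<^sup>+b. ?g (a ** b) \<partial>law (Suc n)) = (\<integral>\<^sup>+b. \<integral>\<^sup>+c. ?g (a ** b ** c) \<partial>law n \<partial>m)"
          by (subst nn_integral_law_Suc') (auto simp: matrix_mul_assoc)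
        also have "\<dots> \<le> (\<integral>\<^sup>+b. ennreal C1 * pas n (a ** b) \<partial>m)"
          by (intro nn_integral_mono Suc)
        finally show ?thesis using False by (simp add: pas_Suc nn_integral_cmult)
      qed
    qed
    let ?o = "\<lambda>a::real^'d^'d. indicator {a. mnorm a \<le> u} a *
      (\<integral>\<^sup>+c. ennreal (mnorm (a ** c) powr \<alpha>) * indicator {a. K * u < mnorm a} (a ** c) \<partial>m)"
    (* the part of it that is due to jumps beyond K * u *)
    define ov where "ov n a = (\<Sum>k<n. \<integral>\<^sup>+b. ?o (a ** b) \<partial>law k)" for n :: nat and a
    have [measurable]: "ov n \<in> borel_measurable borel" for n
      unfolding ov_def by measurable
    have ov_Suc: "ov (Suc n) a = ?o a + (\<integral>\<^sup>+b. ov n (a ** b) \<partial>m)" for n a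
    proof -
      have "ov (Suc n) a = ?o a + (\<Sum>k<n. \<integral>\<^sup>+b. ?o (a ** b) \<partial>law (Suc k))"
        unfolding ov_def by (subst sum.lessThan_Suc_shift) simp
      also have "(\<Sum>k<n. \<integral>\<^sup>+b. ?o (a ** b) \<partial>law (Suc k)) = (\<Sum>k<n. \<integral>\<^sup>+b. \<integral>\<^sup>+c. ?o (a ** b ** c) \<partial>law k \<partial>m)"
        by (intro sum.cong refl, subst nn_integral_law_Suc') (auto simp: matrix_mul_assoc)
      also have "\<dots> = (\<integral>\<^sup>+b. ov n (a ** b) \<partial>m)"
        unfolding ov_def by (subst nn_integral_sum) auto
      finally show ?thesis .
    qed
    have Ku: "u \<le> K * u" using K u0 by simp
    have pas_le: "pas n a \<le> ennreal ((K * u) powr \<alpha>) * hit u n a + ov n a" if "mnorm a \<le> K * u" for n a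
      using that
    proof (induction n arbitrary: a)
      case 0
      then show ?case using \<alpha>_pos by (auto simp: pas_0 ov_def intro!: ennreal_leI powr_mono2)
    next
      case (Suc n)
      show ?case
      proof (cases "u < mnorm a")
        case True
        then have "pas (Suc n) a \<le> ennreal ((K * u) powr \<alpha>) * hit u (Suc n) a"
          using Suc.prems \<alpha>_pos by (auto simp: pas_Suc intro!: ennreal_leI powr_mono2)
        then show ?thesis by (rule order_trans) simp
      next
        case False
        have "(\<integral>\<^sup>+b. pas n (a ** b) \<partial>m) \<le> (\<integral>\<^sup>+b. ennreal ((K * u) powr \<alpha>) * hit u n (a ** b) + ov n (a ** b)
            + ennreal (mnorm (a ** b) powr \<alpha>) * indicator {a. K * u < mnorm a} (a ** b) \<partial>m)"
        proof (intro nn_integral_mono)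
          fix b
          show "pas n (a ** b) \<le> ennreal ((K * u) powr \<alpha>) * hit u n (a ** b) + ov n (a ** b)
            + ennreal (mnorm (a ** b) powr \<alpha>) * indicator {a. K * u < mnorm a} (a ** b)"
          proof (cases "mnorm (a ** b) \<le> K * u")
            case True
            then show ?thesis using Suc.IH[OF True] by (simp add: add_increasing2)
          next
            case f: False
            then show ?thesis using Ku by (subst pas_big) auto
          qed
        qed
        also have "\<dots> = ennreal ((K * u) powr \<alpha>) * hit u (Suc n) a + ov (Suc n) a"
          using False by (simp add: nn_integral_add nn_integral_cmult ov_Suc add_ac)
        finally show ?thesis using False by (simp add: pas_Suc)
      qed
    qed
    have ov1: "ov n (mat 1) \<le> ennreal (1 / (4 * C1))" for n
    proof -
      have "ov n (mat 1) \<le> (\<Sum>k. \<integral>\<^sup>+b. ?o b \<partial>law k)"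
        unfolding ov_def by (simp add: sum_le_suminf)
      also have "\<dots> \<le> ennreal (1 / (4 * C1))" by (rule over[OF u0])
      finally show ?thesis .
    qed
    have "(\<lambda>n. u powr (\<alpha>/2) * (C * \<rho> ^ n)) \<longlonglongrightarrow> u powr (\<alpha>/2) * (C * 0)"
      using C by (intro tendsto_intros LIMSEQ_realpow_zero) auto
    then have "\<forall>\<^sub>F n in sequentially. u powr (\<alpha>/2) * (C * \<rho> ^ n) < 1/2"
      by (rule order_tendstoD(2)) simp
    then obtain n where n: "u powr (\<alpha>/2) * (C * \<rho> ^ n) < 1/2"
      using eventually_happens'[OF sequentially_bot] by blast
    have low: "(\<integral>\<^sup>+a. ennreal (mnorm a powr \<alpha>) * indicator {a. mnorm a \<le> u} a \<partial>law n) \<le> ennreal (1/2)"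
    proof -
      have "(\<integral>\<^sup>+a. ennreal (mnorm a powr \<alpha>) * indicator {a. mnorm a \<le> u} a \<partial>law n)
        \<le> (\<integral>\<^sup>+a. ennreal (u powr (\<alpha>/2)) * ennreal (mnorm a powr (\<alpha>/2)) \<partial>law n)"
      proof (intro nn_integral_mono)
        fix a :: "real^'d^'d"
        have "mnorm a powr \<alpha> \<le> u powr (\<alpha>/2) * mnorm a powr (\<alpha>/2)" if "mnorm a \<le> u"
        proof -
          have "mnorm a powr \<alpha> = mnorm a powr (\<alpha>/2) * mnorm a powr (\<alpha>/2)"
            by (simp flip: powr_add)
          also have "\<dots> \<le> u powr (\<alpha>/2) * mnorm a powr (\<alpha>/2)"
            using that \<alpha>_pos by (intro mult_right_mono powr_mono2) auto
          finally show ?thesis .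
        qed
        then show "ennreal (mnorm a powr \<alpha>) * indicator {a. mnorm a \<le> u} a \<le> ennreal (u powr (\<alpha>/2)) * ennreal (mnorm a powr (\<alpha>/2))"
          by (auto simp: indicator_def ennreal_mult[symmetric] intro!: ennreal_leI)
      qed
      also have "\<dots> = ennreal (u powr (\<alpha>/2)) * mom (\<alpha>/2) n"
        unfolding mom_def by (simp add: nn_integral_cmult)
      also have "\<dots> \<le> ennreal (u powr (\<alpha>/2)) * ennreal (C * \<rho> ^ n)"
        by (intro mult_left_mono dec) auto
      also have "\<dots> = ennreal (u powr (\<alpha>/2) * (C * \<rho> ^ n))"
        using C by (simp add: ennreal_mult[symmetric])
      also have "\<dots> \<le> ennreal (1/2)"
        using n by (intro ennreal_leI) simp
      finally show ?thesis .
    qed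
    have "1 \<le> mom \<alpha> n" by (rule mom_critical_ge_1)
    also have "\<dots> = (\<integral>\<^sup>+a. ennreal (mnorm a powr \<alpha>) * indicator {a. mnorm a \<le> u} a + ?g a \<partial>law n)"
      unfolding mom_def by (intro nn_integral_cong) (auto simp: indicator_def)
    also have "\<dots> = (\<integral>\<^sup>+a. ennreal (mnorm a powr \<alpha>) * indicator {a. mnorm a \<le> u} a \<partial>law n) + (\<integral>\<^sup>+a. ?g a \<partial>law n)"
      by (rule nn_integral_add) measurable
    also have "\<dots> \<le> ennreal (1/2) + ennreal C1 * (ennreal ((K * u) powr \<alpha>) * hit u n (mat 1) + ennreal (1 / (4 * C1)))"
    proof (intro add_mono low)
      have "(\<integral>\<^sup>+a. ?g a \<partial>law n) \<le> ennreal C1 * pas n (mat 1)"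
        using mass[of n "mat 1"] by simp
      also have "\<dots> \<le> ennreal C1 * (ennreal ((K * u) powr \<alpha>) * hit u n (mat 1) + ov n (mat 1))"
        using u Ku by (intro mult_left_mono pas_le) (auto simp: mnorm_one)
      also have "\<dots> \<le> ennreal C1 * (ennreal ((K * u) powr \<alpha>) * hit u n (mat 1) + ennreal (1 / (4 * C1)))"
        by (intro mult_left_mono add_left_mono ov1) auto
      finally show "(\<integral>\<^sup>+a. ?g a \<partial>law n) \<le> ennreal C1 * (ennreal ((K * u) powr \<alpha>) * hit u n (mat 1) + ennreal (1 / (4 * C1)))" .
    qed
    finally have main: "1 \<le> ennreal (1/2) + ennreal C1 * (ennreal ((K * u) powr \<alpha>) * hit u n (mat 1) + ennreal (1 / (4 * C1)))" .
    have "ennreal (c * u powr - \<alpha>) \<le> hit u n (mat 1)"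
    proof (cases "hit u n (mat 1)")
      case (real h)
      have "1 \<le> 1/2 + C1 * ((K * u) powr \<alpha> * h + 1 / (4 * C1))"
        using main C1 real by (intro one_le_ennreal_affineD) auto
      then have "1/4 \<le> C1 * (K powr \<alpha> * u powr \<alpha>) * h"
        using C1 K u0 by (simp add: algebra_simps powr_mult)
      then have "c * u powr - \<alpha> \<le> h"
        using C1 K u0 by (simp add: c_def powr_minus field_simps)
      then show ?thesis using real by (simp add: ennreal_leI)
    qed simp
    then show ?thesis ..
  qed
  then show ?thesis using c by blast
qed

end

section \<open>The stationary law of the affine recursion\<close>

lemma measurable_fst_borel [measurable (raw)]:
  fixes f :: "'a \<Rightarrow> 'b::second_countable_topology \<times> 'c::second_countable_topology"
  shows "f \<in> borel_measurable M \<Longrightarrow> (\<lambda>x. fst (f x)) \<in> borel_measurable M"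
  by (rule measurable_compose[OF _ borel_measurable_continuous_onI]) (auto intro!: continuous_intros)

lemma measurable_snd_borel [measurable (raw)]:
  fixes f :: "'a \<Rightarrow> 'b::second_countable_topology \<times> 'c::second_countable_topology"
  shows "f \<in> borel_measurable M \<Longrightarrow> (\<lambda>x. snd (f x)) \<in> borel_measurable M"
  by (rule measurable_compose[OF _ borel_measurable_continuous_onI]) (auto intro!: continuous_intros)

text \<open>
  The inputs \<open>(A, B)\<close> have the law \<open>\<mu>\<close>, and \<open>\<nu>\<close> is a stationary law of the recursion
  \<open>y \<mapsto> A *v y + B\<close>, that is, invariant under one step with an independent input.
\<close>

locale critical_affine_law = critical_matrix_law "distr \<mu> borel fst" \<alpha>
  for \<mu> :: "((real^'d^'d) \<times> (real^'d)) measure" and \<alpha> :: real +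
  fixes \<nu> :: "(real^'d) measure"
  assumes prob_mu: "prob_space \<mu>" and sets_mu [measurable_cong, simp]: "sets \<mu> = sets borel"
    and prob_nu: "prob_space \<nu>" and sets_nu [measurable_cong, simp]: "sets \<nu> = sets borel"
    and nonneg_mu: "AE z in \<mu>. vec_nonneg (snd z)"
    and nonzero_mu: "AE z in \<mu>. snd z \<noteq> 0"
    and moment_mu: "(\<integral>\<^sup>+z. ennreal (vnorm (snd z) powr \<alpha>) \<partial>\<mu>) < \<infinity>"
    and invariant: "\<And>f. f \<in> borel_measurable borel \<Longrightarrow>
      (\<integral>\<^sup>+y. f y \<partial>\<nu>) = (\<integral>\<^sup>+y. \<integral>\<^sup>+z. f (fst z *v y + snd z) \<partial>\<mu> \<partial>\<nu>)"
begin

sublocale mu: prob_space \<mu> by (rule prob_mu)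
sublocale nu: prob_space \<nu> by (rule prob_nu)

lemma space_mu [simp]: "space \<mu> = UNIV"
  using sets_eq_imp_space_eq[OF sets_mu] by simp

lemma space_nu [simp]: "space \<nu> = UNIV"
  using sets_eq_imp_space_eq[OF sets_nu] by simp

lemma nn_integral_m:
  "f \<in> borel_measurable borel \<Longrightarrow> (\<integral>\<^sup>+a. f a \<partial>distr \<mu> borel fst) = (\<integral>\<^sup>+z. f (fst z) \<partial>\<mu>)"
  by (rule nn_integral_distr) measurable

lemma AE_mu_nonneg: "AE z in \<mu>. mat_nonneg (fst z) \<and> vec_nonneg (snd z)"
proof -
  have "AE z in \<mu>. mat_nonneg (fst z)"
    using nonneg_m by (subst (asm) AE_distr_iff) auto
  with nonneg_mu show ?thesis by eventually_elim auto
qed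

lemma emeasure_nu_if:
  "Measurable.pred borel P \<Longrightarrow> emeasure \<nu> {y. P y} = (\<integral>\<^sup>+y. (if P y then 1 else 0) \<partial>\<nu>)"
proof -
  assume [measurable]: "Measurable.pred borel P"
  have "emeasure \<nu> {y. P y} = (\<integral>\<^sup>+y. indicator {y. P y} y \<partial>\<nu>)" by simp
  also have "\<dots> = (\<integral>\<^sup>+y. (if P y then 1 else 0) \<partial>\<nu>)"
    by (intro nn_integral_cong) (auto simp: indicator_def)
  finally show ?thesis .
qed

lemma swap_mu_nu:
  assumes [measurable]: "(\<lambda>x. f (fst x) (snd x)) \<in> borel_measurable (borel \<Otimes>\<^sub>M borel)"
  shows "(\<integral>\<^sup>+y. \<integral>\<^sup>+z. f z y \<partial>\<mu> \<partial>\<nu>) = (\<integral>\<^sup>+z. \<integral>\<^sup>+y. f z y \<partial>\<nu> \<partial>\<mu>)"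
proof -
  interpret pair_sigma_finite \<mu> \<nu> ..
  show ?thesis by (rule Fubini') (simp add: split_beta')
qed

text \<open>
  Invariance compares a functional \<open>\<Phi>\<close> of \<open>\<nu>\<close> with its average after one more factor, up to an error
  \<open>\<Delta>\<close> made by the additive input. Telescoping moves the main term out along the products.
\<close>

lemma iterate_inequality:
  assumes [measurable]: "\<Phi> \<in> borel_measurable borel" "\<Delta> \<in> borel_measurable borel"
    and le: "\<And>a. mat_nonneg a \<Longrightarrow> \<Phi> a \<le> (\<integral>\<^sup>+z. \<Phi> (a ** fst z) \<partial>\<mu>) + \<Delta> a"
  shows "\<Phi> (mat 1) \<le> (\<integral>\<^sup>+a. \<Phi> a \<partial>law n) + (\<Sum>k<n. \<integral>\<^sup>+a. \<Delta> a \<partial>law k)"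
proof (induction n)
  case (Suc n)
  have "(\<integral>\<^sup>+a. \<Phi> a \<partial>law n) \<le> (\<integral>\<^sup>+a. (\<integral>\<^sup>+z. \<Phi> (a ** fst z) \<partial>\<mu>) + \<Delta> a \<partial>law n)"
    using AE_law_nonneg[of n] by (intro nn_integral_mono_AE) (auto elim!: eventually_mono intro!: le)
  also have "\<dots> = (\<integral>\<^sup>+a. \<Phi> a \<partial>law (Suc n)) + (\<integral>\<^sup>+a. \<Delta> a \<partial>law n)"
    by (simp add: nn_integral_add nn_integral_law_Suc nn_integral_m)
  finally have "(\<integral>\<^sup>+a. \<Phi> a \<partial>law n) + (\<Sum>k<n. \<integral>\<^sup>+a. \<Delta> a \<partial>law k) \<le>
      (\<integral>\<^sup>+a. \<Phi> a \<partial>law (Suc n)) + (\<integral>\<^sup>+a. \<Delta> a \<partial>law n) + (\<Sum>k<n. \<integral>\<^sup>+a. \<Delta> a \<partial>law k)"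
    by (rule add_right_mono)
  from order_trans[OF Suc this] show ?case by (simp add: add_ac)
qed simp

lemma product_vanishes:
  assumes "\<delta> > 0" "\<eta> > 0"
  shows "\<forall>\<^sub>F n in sequentially. (\<integral>\<^sup>+a. emeasure \<nu> {y. \<delta> < vnorm (a *v y)} \<partial>law n) \<le> ennreal \<eta>"
proof -
  have "(\<lambda>K. measure \<nu> {y. real K < vnorm y}) \<longlonglongrightarrow> measure \<nu> (\<Inter>K. {y. real K < vnorm y})"
    by (rule nu.finite_Lim_measure_decseq) (auto simp: decseq_def)
  also have "(\<Inter>K. {y::real^'d. real K < vnorm y}) = {}"
  proof (rule equals0I)
    fix x :: "real^'d" assume x: "x \<in> (\<Inter>K. {y. real K < vnorm y})"
    obtain k where "vnorm x \<le> real k" using real_arch_simple by blast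
    with x show False by (auto dest: spec[of _ k])
  qed
  finally have "\<forall>\<^sub>F K in sequentially. measure \<nu> {y. real K < vnorm y} < \<eta> / 2"
    using assms by (intro order_tendstoD(2)[where y=0]) auto
  then obtain K0 where "\<And>K. K \<ge> K0 \<Longrightarrow> measure \<nu> {y. real K < vnorm y} < \<eta> / 2"
    unfolding eventually_sequentially by blast
  then obtain K where K: "measure \<nu> {y. real K < vnorm y} < \<eta> / 2" "K > 0"
    by (metis le_add1 zero_less_Suc add_Suc_right)
  define \<kappa> where "\<kappa> = \<alpha> / 2"
  have \<kappa>: "0 < \<kappa>" "\<kappa> < \<alpha>" using \<alpha>_pos by (auto simp: \<kappa>_def)
  obtain C \<rho> where C: "C > 0" "0 < \<rho>" "\<rho> < 1" and dec: "\<And>n. mom \<kappa> n \<le> ennreal (C * \<rho> ^ n)"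
    using mom_decay[OF \<kappa>] by blast
  define r where "r = (real K / \<delta>) powr \<kappa>"
  have "(\<lambda>n. r * (C * \<rho> ^ n)) \<longlonglongrightarrow> r * (C * 0)"
    using C by (intro tendsto_intros LIMSEQ_realpow_zero) auto
  then have "\<forall>\<^sub>F n in sequentially. r * (C * \<rho> ^ n) < \<eta> / 2"
    using assms by (intro order_tendstoD(2)[where y="r * (C * 0)"]) auto
  then show ?thesis
  proof eventually_elim
    case (elim n)
    have "(\<integral>\<^sup>+a. emeasure \<nu> {y. \<delta> < vnorm (a *v y)} \<partial>law n)
       \<le> (\<integral>\<^sup>+a. ennreal (\<eta> / 2) + ennreal r * ennreal (mnorm a powr \<kappa>) \<partial>law n)"
    proof (intro nn_integral_mono)
      fix a :: "real^'d^'d"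
      show "emeasure \<nu> {y. \<delta> < vnorm (a *v y)} \<le> ennreal (\<eta> / 2) + ennreal r * ennreal (mnorm a powr \<kappa>)"
      proof (cases "mnorm a * real K \<le> \<delta>")
        case True
        have "{y. \<delta> < vnorm (a *v y)} \<subseteq> {y. real K < vnorm y}"
        proof (intro Collect_mono impI, rule ccontr)
          fix y assume y: "\<delta> < vnorm (a *v y)" "\<not> real K < vnorm y"
          have "vnorm (a *v y) \<le> mnorm a * vnorm y" by (rule vnorm_mult_le)
          also have "\<dots> \<le> mnorm a * real K" using y by (intro mult_left_mono) auto
          finally show False using y True by simp
        qed
        then have "emeasure \<nu> {y. \<delta> < vnorm (a *v y)} \<le> emeasure \<nu> {y. real K < vnorm y}"
          by (intro emeasure_mono) auto
        also have "\<dots> \<le> ennreal (\<eta> / 2)"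
          using K by (simp add: nu.emeasure_eq_measure ennreal_leI)
        finally show ?thesis by (rule order_trans) simp
      next
        case False
        then have "\<delta> < mnorm a * real K" by simp
        then have "1 < real K / \<delta> * mnorm a" using assms by (simp add: field_simps)
        then have "1 \<le> r * mnorm a powr \<kappa>"
          unfolding r_def using \<kappa> assms by (subst powr_mult[symmetric]) (auto intro!: ge_one_powr_ge_zero)
        then have "1 \<le> ennreal r * ennreal (mnorm a powr \<kappa>)"
          by (simp add: r_def ennreal_mult[symmetric] flip: ennreal_1 del: ennreal_1)
        then show ?thesis
          using nu.emeasure_le_1[of "{y. \<delta> < vnorm (a *v y)}"] by (metis add_increasing order_trans zero_le)
      qed
    qed
    also have "\<dots> = ennreal (\<eta> / 2) + ennreal r * mom \<kappa> n"
      by (simp add: nn_integral_add nn_integral_cmult mom_def law.emeasure_space_1[simplified])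
    also have "\<dots> \<le> ennreal (\<eta> / 2) + ennreal r * ennreal (C * \<rho> ^ n)"
      by (intro add_left_mono mult_left_mono dec) auto
    also have "\<dots> = ennreal (\<eta> / 2 + r * (C * \<rho> ^ n))"
      using C assms by (simp add: r_def ennreal_mult[symmetric] ennreal_plus)
    also have "\<dots> \<le> ennreal \<eta>"
      using elim by (intro ennreal_leI) simp
    finally show ?case .
  qed
qed

text \<open>
  A stationary law is carried by the non-negative cone: the negative part of \<open>A y + B\<close> is dominated
  by the negative part of \<open>A y\<close>, and \<open>A\<^sub>1 \<cdots> A\<^sub>n y\<close> tends to zero in probability.
\<close>

lemma AE_nu_nonneg: "AE y in \<nu>. vec_nonneg y"
proof -
  have zero: "emeasure \<nu> {y. \<exists>i. y $ i < - \<delta>} = 0" if \<delta>: "\<delta> > 0" for \<delta>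
  proof -
    define \<Phi> where "\<Phi> a = emeasure \<nu> {y. \<exists>i. (a *v y) $ i < - \<delta>}" for a :: "real^'d^'d"
    have \<Phi>: "\<Phi> = (\<lambda>a. \<integral>\<^sup>+y. (if \<exists>i. (a *v y) $ i < - \<delta> then 1 else 0) \<partial>\<nu>)"
      unfolding \<Phi>_def by (intro ext emeasure_nu_if) measurable
    have [measurable]: "\<Phi> \<in> borel_measurable borel"
      unfolding \<Phi> by measurable
    have le: "\<Phi> a \<le> (\<integral>\<^sup>+z. \<Phi> (a ** fst z) \<partial>\<mu>) + 0" if "mat_nonneg a" for a
    proof -
      let ?f = "\<lambda>y. if \<exists>i. (a *v y) $ i < - \<delta> then 1 else 0 :: ennreal"
      have "\<Phi> a = (\<integral>\<^sup>+y. \<integral>\<^sup>+z. ?f (fst z *v y + snd z) \<partial>\<mu> \<partial>\<nu>)"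
        unfolding \<Phi> by (rule invariant) measurable
      also have "\<dots> \<le> (\<integral>\<^sup>+y. \<integral>\<^sup>+z. ?f (fst z *v y) \<partial>\<mu> \<partial>\<nu>)"
      proof (rule nn_integral_mono, rule nn_integral_mono_AE)
        fix y
        show "AE z in \<mu>. ?f (fst z *v y + snd z) \<le> ?f (fst z *v y)"
          using AE_mu_nonneg
        proof eventually_elim
          case (elim z)
          then have "vec_nonneg (a *v snd z)" using that by (auto intro: vec_nonneg_mult)
          then have "(a *v (fst z *v y)) $ i \<le> (a *v (fst z *v y + snd z)) $ i" for i
            by (simp add: matrix_vector_right_distrib vec_nonneg_def)
          then show ?case by (auto intro: le_less_trans)
        qed
      qed
      also have "\<dots> = (\<integral>\<^sup>+z. \<integral>\<^sup>+y. ?f (fst z *v y) \<partial>\<nu> \<partial>\<mu>)"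
        by (rule swap_mu_nu) measurable
      also have "\<dots> = (\<integral>\<^sup>+z. \<Phi> (a ** fst z) \<partial>\<mu>)"
        unfolding \<Phi> by (simp add: matrix_vector_mul_assoc)
      finally show ?thesis by simp
    qed
    have small: "\<Phi> (mat 1) \<le> ennreal \<eta>" if \<eta>: "\<eta> > 0" for \<eta>
    proof -
      obtain n where n: "(\<integral>\<^sup>+a. emeasure \<nu> {y. \<delta> < vnorm (a *v y)} \<partial>law n) \<le> ennreal \<eta>"
        using eventually_happens'[OF sequentially_bot product_vanishes[OF \<delta> \<eta>]] by blast
      have "\<Phi> (mat 1) \<le> (\<integral>\<^sup>+a. \<Phi> a \<partial>law n) + (\<Sum>k<n. \<integral>\<^sup>+a. 0 \<partial>law k)"
        by (intro iterate_inequality le) auto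
      also have "\<dots> \<le> (\<integral>\<^sup>+a. emeasure \<nu> {y. \<delta> < vnorm (a *v y)} \<partial>law n)"
        unfolding \<Phi>_def
      proof (simp, intro nn_integral_mono emeasure_mono subsetI)
        fix a y assume "y \<in> {y. \<exists>i. (a *v y) $ i < - \<delta>}"
        then obtain i where "(a *v y) $ i < - \<delta>" by auto
        then have "\<delta> < \<bar>(a *v y) $ i\<bar>" by linarith
        also have "\<dots> \<le> vnorm (a *v y)"
          unfolding vnorm_def by (intro member_le_sum) auto
        finally show "y \<in> {y. \<delta> < vnorm (a *v y)}" by simp
      qed auto
      finally show ?thesis using n by simp
    qed
    have "\<Phi> (mat 1) \<le> 0"
    proof (rule ennreal_le_epsilon)
      fix e :: real assume "e > 0"
      then show "\<Phi> (mat 1) \<le> 0 + ennreal e" using small by simp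
    qed
    then show ?thesis by (simp add: \<Phi>_def)
  qed
  have "AE y in \<nu>. \<forall>k::nat. \<not> (\<exists>i. y $ i < - (1 / real (Suc k)))"
    using zero by (subst AE_all_countable) (auto intro!: AE_I'[where N="{y. \<exists>i. y $ i < - (1 / real (Suc _))}"])
  then show ?thesis
  proof eventually_elim
    case (elim y)
    show ?case
      unfolding vec_nonneg_def
    proof (intro allI, rule ccontr)
      fix i assume "\<not> 0 \<le> y $ i"
      then obtain k :: nat where "1 / real (Suc k) < - (y $ i)"
        using reals_Archimedean[of "- (y $ i)"] by (auto simp: inverse_eq_divide)
      then show False using elim by (meson less_minus_iff minus_less_iff)
    qed
  qed
qed

text \<open>
  An input \<open>B\<close> that is non-zero and non-negative cannot be cancelled by \<open>A *v y\<close>, so \<open>\<nu>\<close> has no atom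
  at the origin.
\<close>

lemma nu_positive: "\<exists>b>0. 0 < emeasure \<nu> {y. b < vnorm y}"
proof -
  have "emeasure \<nu> {y. y = 0} = (\<integral>\<^sup>+y. \<integral>\<^sup>+z. (if fst z *v y + snd z = 0 then 1 else 0) \<partial>\<mu> \<partial>\<nu>)"
    by (subst emeasure_nu_if, measurable, subst invariant) auto
  also have "\<dots> = (\<integral>\<^sup>+y. \<integral>\<^sup>+z. 0 \<partial>\<mu> \<partial>\<nu>)"
  proof (rule nn_integral_cong_AE)
    show "AE y in \<nu>. (\<integral>\<^sup>+z. (if fst z *v y + snd z = 0 then 1 else 0) \<partial>\<mu>) = (\<integral>\<^sup>+z. 0 \<partial>\<mu>)"
      using AE_nu_nonneg
    proof eventually_elim
      case (elim y)
      show ?case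
      proof (rule nn_integral_cong_AE)
        show "AE z in \<mu>. (if fst z *v y + snd z = 0 then 1 else 0) = (0::ennreal)"
          using AE_mu_nonneg nonzero_mu
        proof eventually_elim
          case (elim z)
          then have "vnorm (snd z) \<le> vnorm (snd z + fst z *v y)"
            using \<open>vec_nonneg y\<close> by (intro vnorm_add_ge) (auto intro: vec_nonneg_mult)
          moreover have "vnorm (snd z) > 0"
            using elim vnorm_nonneg[of "snd z"] by (simp add: order_less_le)
          ultimately have "vnorm (fst z *v y + snd z) > 0" by (simp add: add.commute)
          then show ?case by auto
        qed
      qed
    qed
  qed
  finally have zero: "emeasure \<nu> {y. y = 0} = 0" by simp
  show ?thesis
  proof (rule ccontr)
    assume *: "\<not> ?thesis"
    then have z: "emeasure \<nu> {y. 1 / real (Suc k) < vnorm y} = 0" for k :: nat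
      by (metis not_gr_zero of_nat_0_less_iff zero_less_Suc zero_less_divide_1_iff)
    have "emeasure \<nu> (\<Union>k. {y. 1 / real (Suc k) < vnorm y}) = 0"
      by (rule emeasure_UN_eq_0) (use z in auto)
    moreover have "(\<Union>k. {y::real^'d. 1 / real (Suc k) < vnorm y}) = {y. y \<noteq> 0}"
    proof (intro equalityI subsetI)
      fix y :: "real^'d" assume "y \<in> {y. y \<noteq> 0}"
      then have "vnorm y > 0" using vnorm_nonneg[of y] by (simp add: order_less_le)
      then obtain k where "1 / real (Suc k) < vnorm y"
        using reals_Archimedean[of "vnorm y"] by (auto simp: inverse_eq_divide)
      then show "y \<in> (\<Union>k. {y. 1 / real (Suc k) < vnorm y})" by auto
    next
      fix y :: "real^'d" assume "y \<in> (\<Union>k. {y. 1 / real (Suc k) < vnorm y})"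
      then obtain k where k: "1 / real (Suc k) < vnorm y" by auto
      have "0 < 1 / real (Suc k)" by simp
      then have "0 < vnorm y" using k by linarith
      then show "y \<in> {y. y \<noteq> 0}" by auto
    qed
    ultimately have "emeasure \<nu> {y. y \<noteq> 0} = 0" by simp
    moreover have "emeasure \<nu> ({y. y = 0} \<union> {y. y \<noteq> 0}) \<le> emeasure \<nu> {y. y = 0} + emeasure \<nu> {y. y \<noteq> 0}"
      by (rule emeasure_subadditive) auto
    moreover have "{y::real^'d. y = 0} \<union> {y. y \<noteq> 0} = UNIV" by auto
    ultimately show False using zero nu.emeasure_space_1 by simp
  qed
qed

text \<open>
  Lower tail bound. By invariance \<open>f a = \<nu> {y. t < vnorm (a *v y)}\<close> does not increase on average
  along the product chain, and it is bounded below once \<open>mnorm a\<close> is of order \<open>t\<close>. Hence \<open>f\<close>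
  dominates the probability that the chain ever reaches that level.
\<close>

lemma nu_tail_ge: "\<exists>c>0. \<forall>x\<ge>1. ennreal (c * x powr - \<alpha>) \<le> emeasure \<nu> {y. x < vnorm y}"
proof -
  obtain b where b: "b > 0" and \<nu>b: "0 < emeasure \<nu> {y. b < vnorm y}"
    using nu_positive by blast
  obtain l s where s: "0 < s" and q: "0 < emeasure (law l) {D. \<forall>i j. s < D $ i $ j}"
    using positive_product by blast
  obtain c0 where c0: "c0 > 0" and hit: "\<And>u. u \<ge> real CARD('d) \<Longrightarrow> \<exists>n. ennreal (c0 * u powr - \<alpha>) \<le> hit u n (mat 1)"
    using hit_ge by blast
  define q' where "q' = measure (law l) {D. \<forall>i j. s < D $ i $ j} * measure \<nu> {y. b < vnorm y}"
  have q': "q' > 0"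
    using q \<nu>b by (auto simp: q'_def law.emeasure_eq_measure nu.emeasure_eq_measure)
  define x0 where "x0 = s * real CARD('d) * b"
  have x0: "x0 > 0" using s b by (simp add: x0_def)
  have large: "ennreal (q' * c0 * (s * b) powr \<alpha> * x powr - \<alpha>) \<le> emeasure \<nu> {y. x < vnorm y}" if x: "x \<ge> x0" for x
  proof -
    have xp: "x > 0" using x x0 by simp
    define u where "u = x / (s * b)"
    have u: "u \<ge> real CARD('d)" "x = s * u * b"
      using x s b by (auto simp: u_def x0_def field_simps)
    have u0: "u > 0" using xp s b by (simp add: u_def)
    define f where "f a = emeasure \<nu> {y. x < vnorm (a *v y)}" for a :: "real^'d^'d"
    have f: "f = (\<lambda>a. \<integral>\<^sup>+y. (if x < vnorm (a *v y) then 1 else 0) \<partial>\<nu>)"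
      unfolding f_def by (intro ext emeasure_nu_if) measurable
    have [measurable]: "f \<in> borel_measurable borel"
      unfolding f by measurable
    have dec: "(\<integral>\<^sup>+z. f (a ** fst z) \<partial>\<mu>) \<le> f a" if a: "mat_nonneg a" for a
    proof -
      let ?f = "\<lambda>y. if x < vnorm (a *v y) then 1 else 0 :: ennreal"
      have "(\<integral>\<^sup>+z. f (a ** fst z) \<partial>\<mu>) = (\<integral>\<^sup>+z. \<integral>\<^sup>+y. ?f (fst z *v y) \<partial>\<nu> \<partial>\<mu>)"
        unfolding f by (simp add: matrix_vector_mul_assoc)
      also have "\<dots> = (\<integral>\<^sup>+y. \<integral>\<^sup>+z. ?f (fst z *v y) \<partial>\<mu> \<partial>\<nu>)"
        by (rule swap_mu_nu[symmetric]) measurable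
      also have "\<dots> \<le> (\<integral>\<^sup>+y. \<integral>\<^sup>+z. ?f (fst z *v y + snd z) \<partial>\<mu> \<partial>\<nu>)"
      proof (rule nn_integral_mono_AE)
        show "AE y in \<nu>. (\<integral>\<^sup>+z. ?f (fst z *v y) \<partial>\<mu>) \<le> (\<integral>\<^sup>+z. ?f (fst z *v y + snd z) \<partial>\<mu>)"
          using AE_nu_nonneg
        proof eventually_elim
          case (elim y)
          show ?case
          proof (rule nn_integral_mono_AE)
            show "AE z in \<mu>. ?f (fst z *v y) \<le> ?f (fst z *v y + snd z)"
              using AE_mu_nonneg
            proof eventually_elim
              case (elim z)
              then have "vnorm (a *v (fst z *v y)) \<le> vnorm (a *v (fst z *v y) + a *v snd z)"
                using a \<open>vec_nonneg y\<close> by (intro vnorm_add_ge vec_nonneg_mult) auto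
              then show ?case by (simp add: matrix_vector_right_distrib)
            qed
          qed
        qed
      qed
      also have "\<dots> = f a"
        unfolding f by (rule invariant[symmetric]) measurable
      finally show ?thesis .
    qed
    have dec_n: "(\<integral>\<^sup>+c. f (a ** c) \<partial>law n) \<le> f a" if a: "mat_nonneg a" for a n
    proof (induction n)
      case (Suc n)
      have "(\<integral>\<^sup>+c. f (a ** c) \<partial>law (Suc n)) = (\<integral>\<^sup>+c. \<integral>\<^sup>+z. f (a ** c ** fst z) \<partial>\<mu> \<partial>law n)"
        by (simp add: nn_integral_law_Suc nn_integral_m matrix_mul_assoc)
      also have "\<dots> \<le> (\<integral>\<^sup>+c. f (a ** c) \<partial>law n)"
        using AE_law_nonneg[of n] a
        by (intro nn_integral_mono_AE) (auto elim!: eventually_mono intro!: dec mat_nonneg_mult)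
      finally show ?case using Suc by (rule order_trans)
    qed simp
    have big: "ennreal q' \<le> f a" if a: "mat_nonneg a" "u < mnorm a" for a
    proof -
      have "ennreal q' = (\<integral>\<^sup>+D. emeasure \<nu> {y. b < vnorm y} * indicator {D. \<forall>i j. s < D $ i $ j} D \<partial>law l)"
        by (simp add: nn_integral_cmult q'_def law.emeasure_eq_measure nu.emeasure_eq_measure ennreal_mult mult.commute)
      also have "\<dots> \<le> (\<integral>\<^sup>+D. f (a ** D) \<partial>law l)"
      proof (intro nn_integral_mono)
        fix D
        show "emeasure \<nu> {y. b < vnorm y} * indicator {D. \<forall>i j. s < D $ i $ j} D \<le> f (a ** D)"
        proof (cases "\<forall>i j. s < D $ i $ j")
          case True
          have "emeasure \<nu> {y. b < vnorm y} \<le> emeasure \<nu> {y. x < vnorm ((a ** D) *v y)}"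
          proof (rule emeasure_mono_AE)
            show "AE y in \<nu>. y \<in> {y. b < vnorm y} \<longrightarrow> y \<in> {y. x < vnorm ((a ** D) *v y)}"
              using AE_nu_nonneg
            proof eventually_elim
              case (elim y)
              show ?case
              proof
                assume "y \<in> {y. b < vnorm y}"
                then have "b < vnorm y" by simp
                then have "u * b < mnorm a * vnorm y"
                  using a b u0 by (intro mult_strict_mono) auto
                then have "s * (u * b) < s * (mnorm a * vnorm y)"
                  using s by simp
                also have "\<dots> = s * mnorm a * vnorm y" by simp
                also have "\<dots> \<le> vnorm (a *v (D *v y))"
                  using True s elim a by (intro vnorm_sandwich) (auto intro: less_imp_le)
                finally show "y \<in> {y. x < vnorm ((a ** D) *v y)}"
                  by (simp add: u(2) matrix_vector_mul_assoc mult.assoc)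
              qed
            qed
          qed auto
          then show ?thesis using True by (simp add: f_def)
        qed simp
      qed
      also have "\<dots> \<le> f a" by (rule dec_n) fact
      finally show ?thesis .
    qed
    have "ennreal q' * hit u n a \<le> f a" if "mat_nonneg a" for n a
      using that
    proof (induction n arbitrary: a)
      case 0
      then show ?case using big by auto
    next
      case (Suc n)
      show ?case
      proof (cases "u < mnorm a")
        case True
        then show ?thesis using big Suc.prems by simp
      next
        case False
        have "ennreal q' * hit u (Suc n) a = (\<integral>\<^sup>+c. ennreal q' * hit u n (a ** c) \<partial>distr \<mu> borel fst)"
          using False by (simp add: nn_integral_cmult)
        also have "\<dots> \<le> (\<integral>\<^sup>+c. f (a ** c) \<partial>distr \<mu> borel fst)"
          using nonneg_m Suc.prems by (intro nn_integral_mono_AE) (auto elim!: eventually_mono intro!: Suc.IH mat_nonneg_mult)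
        also have "\<dots> = (\<integral>\<^sup>+z. f (a ** fst z) \<partial>\<mu>)"
          by (rule nn_integral_m) measurable
        also have "\<dots> \<le> f a" by (rule dec) fact
        finally show ?thesis .
      qed
    qed
    note hit_f = this
    obtain n where n: "ennreal (c0 * u powr - \<alpha>) \<le> hit u n (mat 1)"
      using hit[OF u(1)] by blast
    have "q' * c0 * (s * b) powr \<alpha> * x powr - \<alpha> = q' * (c0 * u powr - \<alpha>)"
      using xp s b by (simp add: u_def powr_divide powr_minus field_simps)
    then have "ennreal (q' * c0 * (s * b) powr \<alpha> * x powr - \<alpha>) = ennreal q' * ennreal (c0 * u powr - \<alpha>)"
      using q' c0 by (simp only: ennreal_mult[symmetric] less_imp_le powr_ge_zero mult_nonneg_nonneg)
    also have "\<dots> \<le> ennreal q' * hit u n (mat 1)"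
      by (intro mult_left_mono n) auto
    also have "\<dots> \<le> f (mat 1)" by (rule hit_f) simp
    finally show ?thesis by (simp add: f_def)
  qed
  define c1 where "c1 = q' * c0 * (s * b) powr \<alpha>"
  have c1: "c1 > 0" using q' c0 s b by (simp add: c1_def)
  define c where "c = min c1 (c1 * (max x0 1) powr - \<alpha>)"
  have c: "c > 0" using c1 by (simp add: c_def)
  have "ennreal (c * x powr - \<alpha>) \<le> emeasure \<nu> {y. x < vnorm y}" if x: "x \<ge> 1" for x
  proof (cases "x \<ge> x0")
    case True
    have "ennreal (c * x powr - \<alpha>) \<le> ennreal (c1 * x powr - \<alpha>)"
      by (intro ennreal_leI mult_right_mono) (auto simp: c_def)
    also have "\<dots> \<le> emeasure \<nu> {y. x < vnorm y}"
      unfolding c1_def by (rule large[OF True])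
    finally show ?thesis .
  next
    case False
    have "x powr - \<alpha> \<le> 1"
      using x \<alpha>_pos by (simp add: powr_minus field_simps ge_one_powr_ge_zero)
    then have "c * x powr - \<alpha> \<le> c * 1" using c by (intro mult_left_mono) auto
    also have "c * 1 \<le> c1 * (max x0 1) powr - \<alpha>" by (simp add: c_def)
    finally have "ennreal (c * x powr - \<alpha>) \<le> ennreal (c1 * (max x0 1) powr - \<alpha>)" by (rule ennreal_leI)
    also have "\<dots> \<le> emeasure \<nu> {y. max x0 1 < vnorm y}"
      unfolding c1_def by (rule large) simp
    also have "\<dots> \<le> emeasure \<nu> {y. x < vnorm y}"
      using False by (intro emeasure_mono) auto
    finally show ?thesis .
  qed
  then show ?thesis using c by blast
qed

end

section \<open>Truncated moments under a power tail bound\<close>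

lemma powr_add_le:
  fixes p q r :: real
  assumes "0 \<le> p" "0 \<le> q" "0 \<le> r"
  shows "(p + q) powr r \<le> 2 powr r * (p powr r + q powr r)"
proof -
  have "(p + q) powr r \<le> (2 * max p q) powr r"
    using assms by (intro powr_mono2) auto
  also have "\<dots> = 2 powr r * max p q powr r"
    by (rule powr_mult)
  also have "\<dots> \<le> 2 powr r * (p powr r + q powr r)"
    by (intro mult_left_mono) (auto simp: max_def)
  finally show ?thesis .
qed

lemma ex_exp_bracket_below:
  fixes w :: real
  assumes "1 \<le> w"
  shows "\<exists>j::nat. exp (real j) \<le> w \<and> w < exp (real j + 1)"
proof -
  have pos: "0 \<le> ln w" using assms by simp
  define j where "j = nat \<lfloor>ln w\<rfloor>"
  have "real j = of_int \<lfloor>ln w\<rfloor>" using pos by (simp add: j_def)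
  then have "real j \<le> ln w" "ln w < real j + 1"
    by linarith+
  then have "exp (real j) \<le> exp (ln w)" "exp (ln w) < exp (real j + 1)"
    by simp_all
  then show ?thesis using assms by auto
qed

text \<open>
  Karamata-type bounds: on each window of ratio \<open>exp 1\<close> the integrand is nearly constant, and the
  tail bound makes the sum over the windows geometric, dominated by the window at the level \<open>u\<close>.
\<close>

lemma truncated_moment_above:
  fixes f :: "'a \<Rightarrow> real"
  assumes [measurable]: "f \<in> borel_measurable N" and \<kappa>: "0 \<le> \<kappa>" "\<kappa> < \<beta>" and C: "0 \<le> C"
    and tail: "\<And>x. x > 0 \<Longrightarrow> emeasure N {w \<in> space N. x < f w} \<le> ennreal (C * x powr - \<beta>)"
    and u: "u > 0"
  shows "(\<integral>\<^sup>+w. (if u < f w then ennreal (f w powr \<kappa>) else 0) \<partial>N)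
    \<le> ennreal (C * exp \<kappa> / (1 - exp (\<kappa> - \<beta>)) * u powr (\<kappa> - \<beta>))"
proof -
  define \<rho> where "\<rho> = exp (\<kappa> - \<beta>)"
  have \<rho>: "0 < \<rho>" "\<rho> < 1" using \<kappa> by (auto simp: \<rho>_def)
  define W where "W j = {w \<in> space N. u * exp (real j) < f w}" for j :: nat
  have [measurable]: "W j \<in> sets N" for j unfolding W_def by measurable
  have pw: "(if u < f w then ennreal (f w powr \<kappa>) else 0)
      \<le> (\<Sum>j. ennreal ((u * exp (real j + 1)) powr \<kappa>) * indicator (W j) w)" if w: "w \<in> space N" for w
  proof (cases "u < f w")
    case True
    then obtain j where j: "exp (real j) < f w / u" "f w / u \<le> exp (real j + 1)"
      using ex_exp_bracket[of "f w / u"] u by auto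
    then have aW: "w \<in> W j"
      using u w by (simp add: W_def field_simps exp_add)
    have "ennreal (f w powr \<kappa>) \<le> ennreal ((u * exp (real j + 1)) powr \<kappa>) * indicator (W j) w"
      using aW j True u \<kappa> by (auto intro!: ennreal_leI powr_mono2 simp: field_simps)
    also have "\<dots> = (\<Sum>i\<in>{j}. ennreal ((u * exp (real i + 1)) powr \<kappa>) * indicator (W i) w)"
      by (subst sum.insert, simp, simp, simp)
    also have "\<dots> \<le> (\<Sum>j. ennreal ((u * exp (real j + 1)) powr \<kappa>) * indicator (W j) w)"
      by (intro sum_le_suminf) auto
    finally show ?thesis using True by simp
  qed simp
  have "(\<integral>\<^sup>+w. (if u < f w then ennreal (f w powr \<kappa>) else 0) \<partial>N)
     \<le> (\<integral>\<^sup>+w. (\<Sum>j. ennreal ((u * exp (real j + 1)) powr \<kappa>) * indicator (W j) w) \<partial>N)"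
    by (intro nn_integral_mono pw)
  also have "\<dots> = (\<Sum>j. ennreal ((u * exp (real j + 1)) powr \<kappa>) * emeasure N (W j))"
    by (subst nn_integral_suminf) (auto simp: nn_integral_cmult)
  also have "\<dots> \<le> (\<Sum>j. ennreal (C * exp \<kappa> * u powr (\<kappa> - \<beta>) * \<rho> ^ j))"
  proof (intro suminf_le)
    fix j
    have "ennreal ((u * exp (real j + 1)) powr \<kappa>) * emeasure N (W j)
       \<le> ennreal ((u * exp (real j + 1)) powr \<kappa>) * ennreal (C * (u * exp (real j)) powr - \<beta>)"
      unfolding W_def using u by (intro mult_left_mono tail) auto
    also have "\<dots> = ennreal (C * ((u * exp (real j + 1)) powr \<kappa> * (u * exp (real j)) powr - \<beta>))"
      using C by (simp add: ennreal_mult[symmetric] mult_ac)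
    also have "(u * exp (real j + 1)) powr \<kappa> * (u * exp (real j)) powr - \<beta> = exp \<kappa> * u powr (\<kappa> - \<beta>) * \<rho> ^ j"
      using u by (simp add: powr_def \<rho>_def ln_mult exp_of_nat_mult[symmetric] exp_add[symmetric] algebra_simps)
    finally show "ennreal ((u * exp (real j + 1)) powr \<kappa>) * emeasure N (W j) \<le> ennreal (C * exp \<kappa> * u powr (\<kappa> - \<beta>) * \<rho> ^ j)"
      by (simp add: mult_ac)
  qed auto
  also have "\<dots> = ennreal (C * exp \<kappa> * u powr (\<kappa> - \<beta>) / (1 - \<rho>))"
    using C \<rho> by (intro suminf_ennreal_geometric) auto
  finally show ?thesis by (simp add: mult_ac \<rho>_def)
qed

lemma truncated_moment_below:
  fixes f :: "'a \<Rightarrow> real"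
  assumes [measurable]: "f \<in> borel_measurable N" and \<beta>: "0 < \<beta>" "\<beta> < q" and C: "0 \<le> C"
    and nonneg: "\<And>w. 0 \<le> f w"
    and tail: "\<And>x. x > 0 \<Longrightarrow> emeasure N {w \<in> space N. x < f w} \<le> ennreal (C * x powr - \<beta>)"
    and u: "u > 0"
  shows "(\<integral>\<^sup>+w. (if f w \<le> u then ennreal (f w powr q) else 0) \<partial>N)
    \<le> ennreal (C * exp \<beta> / (1 - exp (\<beta> - q)) * u powr (q - \<beta>))"
proof -
  define \<rho> where "\<rho> = exp (\<beta> - q)"
  have \<rho>: "0 < \<rho>" "\<rho> < 1" using \<beta> by (auto simp: \<rho>_def)
  define W where "W j = {w \<in> space N. u * exp (- (real j + 1)) < f w}" for j :: nat
  have [measurable]: "W j \<in> sets N" for j unfolding W_def by measurable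
  have pw: "(if f w \<le> u then ennreal (f w powr q) else 0)
      \<le> (\<Sum>j. ennreal ((u * exp (- real j)) powr q) * indicator (W j) w)" if w: "w \<in> space N" for w
  proof (cases "f w \<le> u \<and> f w \<noteq> 0")
    case True
    then have pos: "0 < f w" using nonneg[of w] by simp
    then obtain j where j: "exp (real j) \<le> u / f w" "u / f w < exp (real j + 1)"
      using ex_exp_bracket_below[of "u / f w"] u True by auto
    then have aW: "w \<in> W j"
      using u w pos by (simp add: W_def field_simps exp_minus exp_diff exp_add)
    have "f w \<le> u * exp (- real j)" using j pos by (simp add: field_simps exp_minus)
    then have "ennreal (f w powr q) \<le> ennreal ((u * exp (- real j)) powr q) * indicator (W j) w"
      using aW True u \<beta> pos by (auto intro!: ennreal_leI powr_mono2)
    also have "\<dots> = (\<Sum>i\<in>{j}. ennreal ((u * exp (- real i)) powr q) * indicator (W i) w)"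
      by (subst sum.insert, simp, simp, simp)
    also have "\<dots> \<le> (\<Sum>j. ennreal ((u * exp (- real j)) powr q) * indicator (W j) w)"
      by (intro sum_le_suminf) auto
    finally show ?thesis using True by simp
  qed auto
  have "(\<integral>\<^sup>+w. (if f w \<le> u then ennreal (f w powr q) else 0) \<partial>N)
     \<le> (\<integral>\<^sup>+w. (\<Sum>j. ennreal ((u * exp (- real j)) powr q) * indicator (W j) w) \<partial>N)"
    by (intro nn_integral_mono pw)
  also have "\<dots> = (\<Sum>j. ennreal ((u * exp (- real j)) powr q) * emeasure N (W j))"
    by (subst nn_integral_suminf) (auto simp: nn_integral_cmult)
  also have "\<dots> \<le> (\<Sum>j. ennreal (C * exp \<beta> * u powr (q - \<beta>) * \<rho> ^ j))"
  proof (intro suminf_le)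
    fix j
    have "ennreal ((u * exp (- real j)) powr q) * emeasure N (W j)
       \<le> ennreal ((u * exp (- real j)) powr q) * ennreal (C * (u * exp (- (real j + 1))) powr - \<beta>)"
      unfolding W_def using u by (intro mult_left_mono tail) auto
    also have "\<dots> = ennreal (C * ((u * exp (- real j)) powr q * (u * exp (- (real j + 1))) powr - \<beta>))"
      using C by (simp add: ennreal_mult[symmetric] mult_ac)
    also have "(u * exp (- real j)) powr q * (u * exp (- (real j + 1))) powr - \<beta> = exp \<beta> * u powr (q - \<beta>) * \<rho> ^ j"
      using u by (simp add: powr_def \<rho>_def ln_mult exp_of_nat_mult[symmetric] exp_add[symmetric] algebra_simps)
    finally show "ennreal ((u * exp (- real j)) powr q) * emeasure N (W j) \<le> ennreal (C * exp \<beta> * u powr (q - \<beta>) * \<rho> ^ j)"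
      by (simp add: mult_ac)
  qed auto
  also have "\<dots> = ennreal (C * exp \<beta> * u powr (q - \<beta>) / (1 - \<rho>))"
    using C \<rho> by (intro suminf_ennreal_geometric) auto
  finally show ?thesis by (simp add: mult_ac \<rho>_def)
qed

section \<open>Upper tail bound for the stationary law\<close>

context critical_affine_law
begin

lemma green_tail_subcritical:
  assumes "0 < \<theta>" "\<theta> < \<alpha>" "\<theta> \<le> \<beta>" "\<beta> \<le> \<alpha>"
  shows "\<exists>C>0. \<forall>z>0. (\<Sum>k. \<integral>\<^sup>+a. ennreal (mnorm a powr \<theta>) * indicator {a. z < mnorm a} a \<partial>law k)
    \<le> ennreal (C * z powr (\<theta> - \<beta>))"
proof (cases "\<beta> = \<alpha>")
  case True
  then show ?thesis using green_tail[of \<theta>] assms by simp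
next
  case False
  obtain C where C: "C > 0" and sm: "(\<Sum>k. mom \<beta> k) \<le> ennreal C"
    using sum_mom_bounded[of \<beta>] assms False by auto
  have "(\<Sum>k. \<integral>\<^sup>+a. ennreal (mnorm a powr \<theta>) * indicator {a. z < mnorm a} a \<partial>law k)
    \<le> ennreal (C * z powr (\<theta> - \<beta>))" if z: "z > 0" for z
  proof -
    have "(\<Sum>k. \<integral>\<^sup>+a. ennreal (mnorm a powr \<theta>) * indicator {a. z < mnorm a} a \<partial>law k)
       \<le> (\<Sum>k. \<integral>\<^sup>+a. ennreal (z powr (\<theta> - \<beta>)) * ennreal (mnorm a powr \<beta>) \<partial>law k)"
    proof (intro suminf_le nn_integral_mono)
      fix a :: "real^'d^'d"
      have "mnorm a powr \<theta> \<le> z powr (\<theta> - \<beta>) * mnorm a powr \<beta>" if "z < mnorm a"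
      proof -
        have "mnorm a powr \<theta> = mnorm a powr (\<theta> - \<beta>) * mnorm a powr \<beta>"
          using that z by (simp flip: powr_add)
        also have "\<dots> \<le> z powr (\<theta> - \<beta>) * mnorm a powr \<beta>"
          using that z assms by (intro mult_right_mono powr_mono2') auto
        finally show ?thesis .
      qed
      then show "ennreal (mnorm a powr \<theta>) * indicator {a. z < mnorm a} a \<le> ennreal (z powr (\<theta> - \<beta>)) * ennreal (mnorm a powr \<beta>)"
        by (auto simp: indicator_def ennreal_mult[symmetric] intro!: ennreal_leI)
    qed auto
    also have "\<dots> = ennreal (z powr (\<theta> - \<beta>)) * (\<Sum>k. mom \<beta> k)"
      unfolding mom_def by (simp add: nn_integral_cmult)
    also have "\<dots> \<le> ennreal (z powr (\<theta> - \<beta>)) * ennreal C"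
      by (intro mult_left_mono sm) auto
    finally show ?thesis using C by (simp add: ennreal_mult mult.commute)
  qed
  then show ?thesis using C by blast
qed

lemma swap_law:
  assumes [measurable]: "(\<lambda>x. F (fst x) (fst (snd x)) (snd (snd x))) \<in> borel_measurable (borel \<Otimes>\<^sub>M (borel \<Otimes>\<^sub>M borel))"
  shows "(\<integral>\<^sup>+a. \<integral>\<^sup>+y. \<integral>\<^sup>+z. F a y z \<partial>\<mu> \<partial>\<nu> \<partial>law k) = (\<integral>\<^sup>+y. \<integral>\<^sup>+z. \<integral>\<^sup>+a. F a y z \<partial>law k \<partial>\<mu> \<partial>\<nu>)"
proof -
  interpret n: pair_sigma_finite "law k" \<nu> ..
  interpret u: pair_sigma_finite "law k" \<mu> ..
  have F: "(\<lambda>x. F (f x) (g x) (h x)) \<in> borel_measurable N"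
    if [measurable]: "f \<in> borel_measurable N" "g \<in> borel_measurable N" "h \<in> borel_measurable N" for f g h and N :: "'c measure"
    by (rule measurable_compose[where f="\<lambda>x. (f x, g x, h x)", OF _ assms, simplified]) measurable
  note [measurable] = F
  have "(\<integral>\<^sup>+a. \<integral>\<^sup>+y. \<integral>\<^sup>+z. F a y z \<partial>\<mu> \<partial>\<nu> \<partial>law k) = (\<integral>\<^sup>+y. \<integral>\<^sup>+a. \<integral>\<^sup>+z. F a y z \<partial>\<mu> \<partial>law k \<partial>\<nu>)"
    by (rule n.Fubini'[symmetric]) (simp add: split_beta')
  also have "\<dots> = (\<integral>\<^sup>+y. \<integral>\<^sup>+z. \<integral>\<^sup>+a. F a y z \<partial>law k \<partial>\<mu> \<partial>\<nu>)"
    by (intro nn_integral_cong u.Fubini'[symmetric]) (simp add: split_beta')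
  finally show ?thesis .
qed

text \<open>
  The weight that a single additive input receives in the telescoping sum, separated into the power
  \<open>x powr - \<beta>\<close> and a factor that is integrable in the input and in the stationary state.
\<close>

lemma tail_weight_le:
  fixes x b v A r :: real
  assumes x: "x > 0" and nn: "0 \<le> b" "0 \<le> A" "0 \<le> r" and v: "v = A * r + b" "v > 0" and \<theta>: "0 < \<theta>" "\<theta> \<le> \<beta>"
  shows "(2 * b / x) powr \<theta> * (x / (2 * v)) powr (\<theta> - \<beta>)
    \<le> 2 powr \<beta> * 2 powr (\<beta> - \<theta>) * x powr - \<beta> * ((b powr \<beta> + A powr \<beta>) * r powr (\<beta> - \<theta>) + b powr \<beta>)"
proof -
  have "(2 * b / x) powr \<theta> * (x / (2 * v)) powr (\<theta> - \<beta>) = 2 powr \<beta> * x powr - \<beta> * (b powr \<theta> * v powr (\<beta> - \<theta>))"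
  proof -
    have "(x / (2 * v)) powr (\<theta> - \<beta>) = (2 * v / x) powr (\<beta> - \<theta>)"
      using x v by (simp add: powr_def ln_div ln_mult algebra_simps)
    also have "\<dots> = (2 / x) powr (\<beta> - \<theta>) * v powr (\<beta> - \<theta>)"
      by (simp flip: powr_mult)
    finally have 1: "(x / (2 * v)) powr (\<theta> - \<beta>) = (2 / x) powr (\<beta> - \<theta>) * v powr (\<beta> - \<theta>)" .
    have 2: "(2 * b / x) powr \<theta> = (2 / x) powr \<theta> * b powr \<theta>"
      by (simp flip: powr_mult)
    have 3: "(2 / x) powr \<theta> * (2 / x) powr (\<beta> - \<theta>) = (2 / x) powr \<beta>"
      by (simp flip: powr_add)
    have 4: "(2 / x) powr \<beta> = 2 powr \<beta> * x powr - \<beta>"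
      using x by (simp add: powr_divide powr_minus field_simps)
    show ?thesis unfolding 1 2 using 3 4 by (simp add: mult_ac)
  qed
  also have "\<dots> \<le> 2 powr \<beta> * x powr - \<beta> * (2 powr (\<beta> - \<theta>) * ((b powr \<beta> + A powr \<beta>) * r powr (\<beta> - \<theta>) + b powr \<beta>))"
  proof (intro mult_left_mono)
    have "b powr \<theta> * v powr (\<beta> - \<theta>) \<le> b powr \<theta> * (2 powr (\<beta> - \<theta>) * ((A * r) powr (\<beta> - \<theta>) + b powr (\<beta> - \<theta>)))"
      unfolding v(1) using nn \<theta> by (intro mult_left_mono powr_add_le) auto
    also have "\<dots> = 2 powr (\<beta> - \<theta>) * (b powr \<theta> * A powr (\<beta> - \<theta>) * r powr (\<beta> - \<theta>) + b powr \<theta> * b powr (\<beta> - \<theta>))"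
      by (simp add: powr_mult algebra_simps)
    also have "b powr \<theta> * b powr (\<beta> - \<theta>) = b powr \<beta>"
      by (simp flip: powr_add)
    also have "2 powr (\<beta> - \<theta>) * (b powr \<theta> * A powr (\<beta> - \<theta>) * r powr (\<beta> - \<theta>) + b powr \<beta>)
        \<le> 2 powr (\<beta> - \<theta>) * ((b powr \<beta> + A powr \<beta>) * r powr (\<beta> - \<theta>) + b powr \<beta>)"
    proof (intro mult_left_mono add_right_mono mult_right_mono)
      have "b powr \<theta> * A powr (\<beta> - \<theta>) \<le> max b A powr \<theta> * max b A powr (\<beta> - \<theta>)"
        using nn \<theta> by (intro mult_mono powr_mono2) auto
      also have "\<dots> = max b A powr \<beta>" by (simp flip: powr_add)
      also have "\<dots> \<le> b powr \<beta> + A powr \<beta>" by (auto simp: max_def)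
      finally show "b powr \<theta> * A powr (\<beta> - \<theta>) \<le> b powr \<beta> + A powr \<beta>" .
    qed auto
    finally show "b powr \<theta> * v powr (\<beta> - \<theta>) \<le> 2 powr (\<beta> - \<theta>) * ((b powr \<beta> + A powr \<beta>) * r powr (\<beta> - \<theta>) + b powr \<beta>)" .
  qed auto
  finally show ?thesis by (simp add: mult_ac)
qed

lemma moment_m_le:
  assumes "0 \<le> \<beta>" "\<beta> \<le> \<alpha>"
  shows "(\<integral>\<^sup>+z. ennreal (vnorm (snd z) powr \<beta>) + ennreal (mnorm (fst z) powr \<beta>) \<partial>\<mu>) < \<infinity>"
proof -
  have powr_le: "t powr \<beta> \<le> 1 + t powr \<alpha>" if "0 \<le> t" for t :: real
    using powr_interpolate[of 0 \<beta> \<alpha> 1 t] assms that by (cases "t = 0") auto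
  have A: "(\<integral>\<^sup>+z. ennreal (mnorm (fst z) powr \<alpha>) \<partial>\<mu>) < \<infinity>"
    using critical_moment_finite by (subst (asm) nn_integral_m) auto
  have "(\<integral>\<^sup>+z. ennreal (vnorm (snd z) powr \<beta>) + ennreal (mnorm (fst z) powr \<beta>) \<partial>\<mu>)
    \<le> (\<integral>\<^sup>+z. (1 + ennreal (vnorm (snd z) powr \<alpha>)) + (1 + ennreal (mnorm (fst z) powr \<alpha>)) \<partial>\<mu>)"
    using powr_le by (intro nn_integral_mono add_mono) (auto simp flip: ennreal_1 ennreal_plus simp del: ennreal_1 intro!: ennreal_leI)
  also have "\<dots> < \<infinity>"
    using A moment_mu by (simp add: nn_integral_add mu.emeasure_space_1[simplified])
  finally show ?thesis .
qed

text \<open>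
  Writing \<open>\<nu>\<close> as the law of \<open>A y + B\<close> and telescoping along the product chain bounds the tail of \<open>\<nu>\<close>
  by the effect of the additive terms \<open>B\<close>. A term matters only where the chain has already reached
  the level \<open>x\<close>, and there it is controlled by the renewal estimate. The price is a moment of
  \<open>\<nu>\<close> whose order is smaller by \<open>\<theta>\<close>, which is what makes the bound usable as a bootstrap.
\<close>

lemma nu_tail_step:
  assumes \<theta>: "0 < \<theta>" "\<theta> \<le> 1" "\<theta> < \<alpha>" "\<theta> \<le> \<beta>" "\<beta> \<le> \<alpha>"
    and mom_fin: "(\<integral>\<^sup>+y. ennreal (vnorm y powr (\<beta> - \<theta>)) \<partial>\<nu>) < \<infinity>"
  shows "\<exists>C>0. \<forall>x>0. emeasure \<nu> {y. x < vnorm y} \<le> ennreal (C * x powr - \<beta>)"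
proof -
  obtain C0 where C0: "C0 > 0" and green: "\<And>z. z > 0 \<Longrightarrow>
      (\<Sum>k. \<integral>\<^sup>+a. ennreal (mnorm a powr \<theta>) * indicator {a. z < mnorm a} a \<partial>law k) \<le> ennreal (C0 * z powr (\<theta> - \<beta>))"
    using green_tail_subcritical[of \<theta> \<beta>] \<theta> by blast
  define D where "D = C0 * 2 powr \<beta> * 2 powr (\<beta> - \<theta>)"
  have D: "D > 0" using C0 by (simp add: D_def)
  define H where "H y z = (vnorm (snd z) powr \<beta> + mnorm (fst z) powr \<beta>) * vnorm y powr (\<beta> - \<theta>) + vnorm (snd z) powr \<beta>"
    for y :: "real^'d" and z :: "(real^'d^'d) \<times> (real^'d)"
  have H0: "0 \<le> H y z" for y z by (simp add: H_def)
  have "(\<integral>\<^sup>+y. \<integral>\<^sup>+z. ennreal (H y z) \<partial>\<mu> \<partial>\<nu>) \<le> (\<integral>\<^sup>+y. \<integral>\<^sup>+z. (ennreal (vnorm (snd z) powr \<beta>) + ennreal (mnorm (fst z) powr \<beta>)) * (ennreal (vnorm y powr (\<beta> - \<theta>)) + 1) \<partial>\<mu> \<partial>\<nu>)"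
    unfolding H_def
    by (intro nn_integral_mono)
      (simp add: ennreal_plus[symmetric] ennreal_mult[symmetric] ennreal_leI algebra_simps flip: ennreal_1 del: ennreal_1 ennreal_plus)
  also have "\<dots> = (\<integral>\<^sup>+z. ennreal (vnorm (snd z) powr \<beta>) + ennreal (mnorm (fst z) powr \<beta>) \<partial>\<mu>) * ((\<integral>\<^sup>+y. ennreal (vnorm y powr (\<beta> - \<theta>)) \<partial>\<nu>) + 1)"
    by (simp add: nn_integral_multc nn_integral_cmult nn_integral_add[of _ \<nu>] nu.emeasure_space_1[simplified])
  also have "\<dots> < \<infinity>"
    using moment_m_le[of \<beta>] \<theta> mom_fin by (simp add: ennreal_mult_less_top)
  finally obtain h where h: "0 \<le> h" "(\<integral>\<^sup>+y. \<integral>\<^sup>+z. ennreal (H y z) \<partial>\<mu> \<partial>\<nu>) = ennreal h"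
    by (cases "\<integral>\<^sup>+y. \<integral>\<^sup>+z. ennreal (H y z) \<partial>\<mu> \<partial>\<nu>") auto
  have "emeasure \<nu> {y. x < vnorm y} \<le> ennreal ((D * h + 1) * x powr - \<beta>)" if x: "x > 0" for x
  proof -
    define \<phi> where "\<phi> r = min 1 (max 0 (2 * r / x - 1))" for r :: real
    have \<phi>_bounds: "0 \<le> \<phi> r" "\<phi> r \<le> 1" for r by (auto simp: \<phi>_def)
    have \<phi>_1: "\<phi> r = 1" if "x < r" for r using that x by (simp add: \<phi>_def field_simps)
    have \<phi>_0: "\<phi> r = 0" if "r \<le> x / 2" for r using that x by (simp add: \<phi>_def field_simps)
    have [measurable]: "\<phi> \<in> borel_measurable borel" unfolding \<phi>_def by measurable
    have holder: "\<phi> r2 \<le> \<phi> r1 + (2 * t / x) powr \<theta>" if "r2 \<le> r1 + t" "0 \<le> t" for r1 r2 t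
    proof (cases "2 * t / x \<le> 1")
      case True
      have "\<phi> r2 \<le> \<phi> r1 + 2 * t / x"
      proof -
        have "2 * r2 / x \<le> 2 * (r1 + t) / x" using that x by (intro divide_right_mono) auto
        also have "\<dots> = 2 * r1 / x + 2 * t / x" by (simp add: distrib_left add_divide_distrib)
        finally have "2 * r2 / x \<le> 2 * r1 / x + 2 * t / x" .
        moreover have "0 \<le> 2 * t / x" using that x by simp
        ultimately show ?thesis unfolding \<phi>_def by linarith
      qed
      moreover have "2 * t / x \<le> (2 * t / x) powr \<theta>"
      proof (cases "t = 0")
        case False
        then have "(2 * t / x) powr 1 \<le> (2 * t / x) powr \<theta>"
          using True that x \<theta> by (intro powr_mono') auto
        then show ?thesis using that x by simp
      qed simp
      ultimately show ?thesis by linarith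
    next
      case False
      then have "1 \<le> (2 * t / x) powr \<theta>" using \<theta> by (intro ge_one_powr_ge_zero) auto
      then show ?thesis using \<phi>_bounds[of r1] \<phi>_bounds[of r2] by linarith
    qed
    define v where "v y z = mnorm (fst z) * vnorm y + vnorm (snd z)" for y :: "real^'d" and z :: "(real^'d^'d) \<times> (real^'d)"
    have v0: "0 \<le> v y z" for y z by (simp add: v_def)
    define F where "F a y z = (if x / 2 < mnorm a * v y z then ennreal ((2 * (mnorm a * vnorm (snd z)) / x) powr \<theta>) else 0)"
      for a :: "real^'d^'d" and y z
    have F_meas: "(\<lambda>x. F (f x) (g x) (h x)) \<in> borel_measurable N"
      if [measurable]: "f \<in> borel_measurable N" "g \<in> borel_measurable N" "h \<in> borel_measurable N" for f g h and N :: "'c measure"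
      unfolding F_def v_def by measurable
    note [measurable] = F_meas
    define \<Phi> where "\<Phi> a = (\<integral>\<^sup>+y. ennreal (\<phi> (vnorm (a *v y))) \<partial>\<nu>)" for a :: "real^'d^'d"
    have [measurable]: "\<Phi> \<in> borel_measurable borel" unfolding \<Phi>_def by measurable
    define \<Delta> where "\<Delta> a = (\<integral>\<^sup>+y. \<integral>\<^sup>+z. F a y z \<partial>\<mu> \<partial>\<nu>)" for a :: "real^'d^'d"
    have [measurable]: "\<Delta> \<in> borel_measurable borel" unfolding \<Delta>_def by measurable
    have step: "\<Phi> a \<le> (\<integral>\<^sup>+z. \<Phi> (a ** fst z) \<partial>\<mu>) + \<Delta> a" for a
    proof -
      have "\<Phi> a = (\<integral>\<^sup>+y. \<integral>\<^sup>+z. ennreal (\<phi> (vnorm (a *v (fst z *v y + snd z)))) \<partial>\<mu> \<partial>\<nu>)"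
        unfolding \<Phi>_def by (rule invariant) measurable
      also have "\<dots> \<le> (\<integral>\<^sup>+y. \<integral>\<^sup>+z. ennreal (\<phi> (vnorm (a *v (fst z *v y)))) + F a y z \<partial>\<mu> \<partial>\<nu>)"
      proof (intro nn_integral_mono)
        fix y :: "real^'d" and z :: "(real^'d^'d) \<times> (real^'d)"
        let ?r2 = "vnorm (a *v (fst z *v y + snd z))" and ?r1 = "vnorm (a *v (fst z *v y))"
        have "?r2 \<le> ?r1 + vnorm (a *v snd z)"
          by (simp add: matrix_vector_right_distrib vnorm_triangle)
        also have "vnorm (a *v snd z) \<le> mnorm a * vnorm (snd z)" by (rule vnorm_mult_le)
        finally have r: "?r2 \<le> ?r1 + mnorm a * vnorm (snd z)" by simp
        have "?r2 \<le> mnorm a * vnorm (fst z *v y + snd z)" by (rule vnorm_mult_le)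
        also have "\<dots> \<le> mnorm a * v y z"
          unfolding v_def
          by (intro mult_left_mono order_trans[OF vnorm_triangle] add_right_mono vnorm_mult_le) auto
        finally have r2: "?r2 \<le> mnorm a * v y z" .
        show "ennreal (\<phi> ?r2) \<le> ennreal (\<phi> ?r1) + F a y z"
        proof (cases "x / 2 < mnorm a * v y z")
          case True
          then show ?thesis
            using holder[OF r] \<phi>_bounds by (simp add: F_def ennreal_plus[symmetric] ennreal_leI del: ennreal_plus)
        next
          case False
          then have "\<phi> ?r2 = 0" using r2 by (intro \<phi>_0) simp
          then show ?thesis by simp
        qed
      qed
      also have "\<dots> = (\<integral>\<^sup>+y. \<integral>\<^sup>+z. ennreal (\<phi> (vnorm (a *v (fst z *v y)))) \<partial>\<mu> \<partial>\<nu>) + \<Delta> a"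
        unfolding \<Delta>_def by (simp add: nn_integral_add)
      also have "(\<integral>\<^sup>+y. \<integral>\<^sup>+z. ennreal (\<phi> (vnorm (a *v (fst z *v y)))) \<partial>\<mu> \<partial>\<nu>) = (\<integral>\<^sup>+z. \<Phi> (a ** fst z) \<partial>\<mu>)"
        unfolding \<Phi>_def by (subst swap_mu_nu) (auto simp: matrix_vector_mul_assoc)
      finally show ?thesis .
    qed
    have inner: "(\<Sum>k. \<integral>\<^sup>+a. F a y z \<partial>law k) \<le> ennreal (D * x powr - \<beta> * H y z)" for y z
    proof (cases "v y z = 0")
      case True
      then show ?thesis using x by (simp add: F_def not_less)
    next
      case False
      then have vp: "v y z > 0" using v0[of y z] by simp
      have "(\<Sum>k. \<integral>\<^sup>+a. F a y z \<partial>law k) = (\<Sum>k. \<integral>\<^sup>+a. ennreal ((2 * vnorm (snd z) / x) powr \<theta>) *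
          (ennreal (mnorm a powr \<theta>) * indicator {a. x / (2 * v y z) < mnorm a} a) \<partial>law k)"
      proof (intro suminf_cong nn_integral_cong)
        fix a :: "real^'d^'d"
        have "x / 2 < mnorm a * v y z \<longleftrightarrow> x / (2 * v y z) < mnorm a"
          using vp by (simp add: field_simps)
        moreover have "(2 * (mnorm a * vnorm (snd z)) / x) powr \<theta> = (2 * vnorm (snd z) / x) powr \<theta> * mnorm a powr \<theta>"
          by (simp add: mult_ac flip: powr_mult)
        ultimately show "F a y z = ennreal ((2 * vnorm (snd z) / x) powr \<theta>) *
          (ennreal (mnorm a powr \<theta>) * indicator {a. x / (2 * v y z) < mnorm a} a)"
          by (auto simp: F_def ennreal_mult)
      qed
      also have "\<dots> = ennreal ((2 * vnorm (snd z) / x) powr \<theta>) *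
          (\<Sum>k. \<integral>\<^sup>+a. ennreal (mnorm a powr \<theta>) * indicator {a. x / (2 * v y z) < mnorm a} a \<partial>law k)"
        by (simp add: nn_integral_cmult)
      also have "\<dots> \<le> ennreal ((2 * vnorm (snd z) / x) powr \<theta>) * ennreal (C0 * (x / (2 * v y z)) powr (\<theta> - \<beta>))"
        using x vp by (intro mult_left_mono green) auto
      also have "\<dots> = ennreal (C0 * ((2 * vnorm (snd z) / x) powr \<theta> * (x / (2 * v y z)) powr (\<theta> - \<beta>)))"
        using C0 by (simp add: ennreal_mult[symmetric] mult_ac)
      also have "\<dots> \<le> ennreal (C0 * (2 powr \<beta> * 2 powr (\<beta> - \<theta>) * x powr - \<beta> * H y z))"
        unfolding H_def using C0 x \<theta> vp by (intro ennreal_leI mult_left_mono tail_weight_le) (auto simp: v_def)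
      finally show ?thesis by (simp add: D_def mult_ac)
    qed
    have sum_le: "(\<Sum>k<n. \<integral>\<^sup>+a. \<Delta> a \<partial>law k) \<le> ennreal (D * h * x powr - \<beta>)" for n
    proof -
      have "(\<Sum>k<n. \<integral>\<^sup>+a. \<Delta> a \<partial>law k) \<le> (\<Sum>k. \<integral>\<^sup>+a. \<Delta> a \<partial>law k)"
        by (rule sum_le_suminf) auto
      also have "\<dots> = (\<Sum>k. \<integral>\<^sup>+y. \<integral>\<^sup>+z. \<integral>\<^sup>+a. F a y z \<partial>law k \<partial>\<mu> \<partial>\<nu>)"
        unfolding \<Delta>_def by (intro suminf_cong swap_law) measurable
      also have "\<dots> = (\<integral>\<^sup>+y. \<integral>\<^sup>+z. (\<Sum>k. \<integral>\<^sup>+a. F a y z \<partial>law k) \<partial>\<mu> \<partial>\<nu>)"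
        by (simp add: nn_integral_suminf)
      also have "\<dots> \<le> (\<integral>\<^sup>+y. \<integral>\<^sup>+z. ennreal (D * x powr - \<beta> * H y z) \<partial>\<mu> \<partial>\<nu>)"
        by (intro nn_integral_mono inner)
      also have "\<dots> = (\<integral>\<^sup>+y. \<integral>\<^sup>+z. ennreal (D * x powr - \<beta>) * ennreal (H y z) \<partial>\<mu> \<partial>\<nu>)"
        using D H0 by (simp add: ennreal_mult)
      also have "\<dots> = ennreal (D * x powr - \<beta>) * ennreal h"
        unfolding h(2)[symmetric] H_def by (simp add: nn_integral_cmult)
      also have "\<dots> = ennreal (D * h * x powr - \<beta>)"
        using D h by (simp add: ennreal_mult[symmetric] mult_ac)
      finally show ?thesis .
    qed
    have xb: "x powr - \<beta> > 0" using x by simp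
    obtain n where n: "(\<integral>\<^sup>+a. emeasure \<nu> {y. x / 2 < vnorm (a *v y)} \<partial>law n) \<le> ennreal (x powr - \<beta>)"
      using eventually_happens'[OF sequentially_bot product_vanishes[of "x / 2", OF _ xb]] x by auto
    have "emeasure \<nu> {y. x < vnorm y} = (\<integral>\<^sup>+y. (if x < vnorm y then 1 else 0) \<partial>\<nu>)"
      by (rule emeasure_nu_if) measurable
    also have "\<dots> \<le> \<Phi> (mat 1)"
      unfolding \<Phi>_def by (intro nn_integral_mono) (auto simp: \<phi>_1)
    also have "\<dots> \<le> (\<integral>\<^sup>+a. \<Phi> a \<partial>law n) + (\<Sum>k<n. \<integral>\<^sup>+a. \<Delta> a \<partial>law k)"
      by (rule iterate_inequality) (measurable, rule step)
    also have "\<dots> \<le> ennreal (x powr - \<beta>) + ennreal (D * h * x powr - \<beta>)"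
    proof (intro add_mono sum_le)
      have "\<Phi> a \<le> emeasure \<nu> {y. x / 2 < vnorm (a *v y)}" for a
      proof -
        have "\<Phi> a \<le> (\<integral>\<^sup>+y. (if x / 2 < vnorm (a *v y) then 1 else 0) \<partial>\<nu>)"
          unfolding \<Phi>_def using \<phi>_bounds by (intro nn_integral_mono) (auto simp: \<phi>_0 not_less)
        also have "\<dots> = emeasure \<nu> {y. x / 2 < vnorm (a *v y)}"
          by (rule emeasure_nu_if[symmetric]) measurable
        finally show ?thesis .
      qed
      then have "(\<integral>\<^sup>+a. \<Phi> a \<partial>law n) \<le> (\<integral>\<^sup>+a. emeasure \<nu> {y. x / 2 < vnorm (a *v y)} \<partial>law n)"
        by (intro nn_integral_mono)
      then show "(\<integral>\<^sup>+a. \<Phi> a \<partial>law n) \<le> ennreal (x powr - \<beta>)" using n by (rule order_trans)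
    qed
    also have "\<dots> = ennreal ((D * h + 1) * x powr - \<beta>)"
      using D h by (simp add: ennreal_plus[symmetric] algebra_simps del: ennreal_plus)
    finally show ?thesis .
  qed
  then show ?thesis
    using D h by (intro exI[of _ "D * h + 1"]) (auto simp: add_nonneg_pos)
qed

lemma nu_moment_of_tail:
  assumes "C > 0" and "\<And>x. x > 0 \<Longrightarrow> emeasure \<nu> {y. x < vnorm y} \<le> ennreal (C * x powr - \<beta>)"
    and \<kappa>: "0 \<le> \<kappa>" "\<kappa> < \<beta>"
  shows "(\<integral>\<^sup>+y. ennreal (vnorm y powr \<kappa>) \<partial>\<nu>) < \<infinity>"
proof -
  have "(\<integral>\<^sup>+y. ennreal (vnorm y powr \<kappa>) \<partial>\<nu>) \<le> (\<integral>\<^sup>+y. 1 + (if 1 < vnorm y then ennreal (vnorm y powr \<kappa>) else 0) \<partial>\<nu>)"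
    using \<kappa> by (intro nn_integral_mono) (auto simp flip: ennreal_1 simp del: ennreal_1 intro!: ennreal_leI powr_le1 add_increasing)
  also have "\<dots> = 1 + (\<integral>\<^sup>+y. (if 1 < vnorm y then ennreal (vnorm y powr \<kappa>) else 0) \<partial>\<nu>)"
    by (simp add: nn_integral_add nu.emeasure_space_1[simplified])
  also have "\<dots> \<le> 1 + ennreal (C * exp \<kappa> / (1 - exp (\<kappa> - \<beta>)) * 1 powr (\<kappa> - \<beta>))"
    using assms by (intro add_left_mono truncated_moment_above) auto
  also have "\<dots> < \<infinity>" by (simp add: ennreal_add_less_top)
  finally show ?thesis .
qed

lemma midpoint_less:
  fixes k s t :: real
  shows "k < s \<Longrightarrow> k < t \<Longrightarrow> b = (k + min s t) / 2 \<Longrightarrow> b < s"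
    and "k < s \<Longrightarrow> k < t \<Longrightarrow> b = (k + min s t) / 2 \<Longrightarrow> b < t"
  by (cases "s \<le> t"; simp add: min_def)+

text \<open>
  Bootstrap. A moment of order \<open>\<beta> - \<theta>\<close> gives a tail of order \<open>\<beta>\<close>, which gives all moments of order
  below \<open>\<beta>\<close>: each round gains almost \<open>\<theta>\<close>, starting from order zero.
\<close>

lemma nu_moment:
  assumes "0 \<le> \<kappa>" "\<kappa> < \<alpha>"
  shows "(\<integral>\<^sup>+y. ennreal (vnorm y powr \<kappa>) \<partial>\<nu>) < \<infinity>"
proof -
  define \<theta> where "\<theta> = min 1 (\<alpha> / 2)"
  have \<theta>: "0 < \<theta>" "\<theta> \<le> 1" "\<theta> < \<alpha>" using \<alpha>_pos by (auto simp: \<theta>_def)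
  have "(\<integral>\<^sup>+y. ennreal (vnorm y powr \<kappa>) \<partial>\<nu>) < \<infinity>" if "0 \<le> \<kappa>" "\<kappa> < \<alpha>" "\<kappa> < real j * \<theta>" for j \<kappa>
    using that
  proof (induction j arbitrary: \<kappa>)
    case (Suc j)
    define \<beta> where "\<beta> = max \<theta> ((\<kappa> + min \<alpha> (real (Suc j) * \<theta>)) / 2)"
    have \<beta>: "\<theta> \<le> \<beta>" "\<beta> \<le> \<alpha>" "\<beta> = \<theta> \<or> \<kappa> < \<beta>"
      using Suc.prems \<theta> by (auto simp: \<beta>_def max_def min_def)
    have \<kappa>\<beta>: "\<kappa> < \<beta>"
      using Suc.prems by (auto simp: \<beta>_def less_max_iff_disj min_def)
    have "(\<integral>\<^sup>+y. ennreal (vnorm y powr (\<beta> - \<theta>)) \<partial>\<nu>) < \<infinity>"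
    proof (cases "\<beta> = \<theta>")
      case True
      have "(\<integral>\<^sup>+y. ennreal (vnorm y powr (\<beta> - \<theta>)) \<partial>\<nu>) \<le> (\<integral>\<^sup>+y. 1 \<partial>\<nu>)"
        using True by (intro nn_integral_mono) auto
      then show ?thesis
        by (simp add: nu.emeasure_space_1[simplified]) (metis ennreal_one_less_top order_le_less_trans)
    next
      case False
      then have eq: "\<beta> = (\<kappa> + min \<alpha> (real (Suc j) * \<theta>)) / 2"
        by (auto simp: \<beta>_def max_def split: if_splits)
      have "\<beta> < \<alpha>" "\<beta> < real (Suc j) * \<theta>"
        using midpoint_less[OF Suc.prems(2,3)] eq by blast+
      then show ?thesis
        using \<beta> \<theta> by (intro Suc.IH) (auto simp: algebra_simps)
    qed
    then obtain C where "C > 0" "\<And>x. x > 0 \<Longrightarrow> emeasure \<nu> {y. x < vnorm y} \<le> ennreal (C * x powr - \<beta>)"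
      using nu_tail_step[of \<theta> \<beta>] \<theta> \<beta> by blast
    then show ?case
      using Suc.prems \<kappa>\<beta> by (intro nu_moment_of_tail)
  qed (use \<theta> in auto)
  note * = this
  obtain j where "real j > \<kappa> / \<theta>" using reals_Archimedean2 by blast
  then have "\<kappa> < real j * \<theta>" using \<theta> by (simp add: field_simps)
  then show ?thesis using * assms by blast
qed

lemma nu_tail_le: "\<exists>C>0. \<forall>x>0. emeasure \<nu> {y. x < vnorm y} \<le> ennreal (C * x powr - \<alpha>)"
proof -
  define \<theta> where "\<theta> = min 1 (\<alpha> / 2)"
  have \<theta>: "0 < \<theta>" "\<theta> \<le> 1" "\<theta> < \<alpha>" using \<alpha>_pos by (auto simp: \<theta>_def)
  then show ?thesis
    by (intro nu_tail_step[of \<theta> \<alpha>] nu_moment) auto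
qed

section \<open>Decoupling two times of the chain\<close>

text \<open>
  The transition operator of the chain.
\<close>

definition kern :: "(real^'d \<Rightarrow> ennreal) \<Rightarrow> real^'d \<Rightarrow> ennreal" where
  "kern f y = (\<integral>\<^sup>+z. f (fst z *v y + snd z) \<partial>\<mu>)"

lemma measurable_kern [measurable]:
  assumes [measurable]: "f \<in> borel_measurable borel"
  shows "kern f \<in> borel_measurable borel"
  unfolding kern_def by measurable

lemma measurable_kern_pow [measurable]:
  "f \<in> borel_measurable borel \<Longrightarrow> (kern ^^ j) f \<in> borel_measurable borel"
  by (induction j) auto

lemma nn_integral_kern_pow:
  "f \<in> borel_measurable borel \<Longrightarrow> (\<integral>\<^sup>+y. (kern ^^ j) f y \<partial>\<nu>) = (\<integral>\<^sup>+y. f y \<partial>\<nu>)"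
proof (induction j)
  case (Suc j)
  have "(\<integral>\<^sup>+y. (kern ^^ Suc j) f y \<partial>\<nu>) = (\<integral>\<^sup>+y. \<integral>\<^sup>+z. (kern ^^ j) f (fst z *v y + snd z) \<partial>\<mu> \<partial>\<nu>)"
    by (simp add: kern_def)
  also have "\<dots> = (\<integral>\<^sup>+y. (kern ^^ j) f y \<partial>\<nu>)"
    using Suc.prems by (intro invariant[symmetric]) measurable
  finally show ?case using Suc by simp
qed simp

text \<open>
  The two parts of the starting point are kept apart along the recursion: \<open>y\<close> is only multiplied by
  the inputs \<open>A\<close>, while \<open>w\<close> follows the full affine recursion.
\<close>

lemma kern_pow_split:
  assumes [measurable]: "g \<in> borel_measurable borel" "g1 \<in> borel_measurable borel" "g2 \<in> borel_measurable borel"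
    and le: "\<And>y w. vec_nonneg y \<Longrightarrow> vec_nonneg w \<Longrightarrow> g (y + w) \<le> g1 y + g2 w"
    and "vec_nonneg y" "vec_nonneg w"
  shows "(kern ^^ j) g (y + w) \<le> (\<integral>\<^sup>+a. g1 (a *v y) \<partial>law j) + (kern ^^ j) g2 w"
  using assms(5,6)
proof (induction j arbitrary: y w)
  case 0
  then show ?case using le by simp
next
  case (Suc j)
  have "(kern ^^ Suc j) g (y + w) = (\<integral>\<^sup>+z. (kern ^^ j) g (fst z *v y + (fst z *v w + snd z)) \<partial>\<mu>)"
    by (simp add: kern_def matrix_vector_right_distrib add.assoc)
  also have "\<dots> \<le> (\<integral>\<^sup>+z. (\<integral>\<^sup>+a. g1 (a *v (fst z *v y)) \<partial>law j) + (kern ^^ j) g2 (fst z *v w + snd z) \<partial>\<mu>)"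
    using Suc.prems
    by (intro nn_integral_mono_AE eventually_mono[OF AE_mu_nonneg] Suc.IH vec_nonneg_mult vec_nonneg_add) auto
  also have "\<dots> = (\<integral>\<^sup>+z. \<integral>\<^sup>+a. g1 ((a ** fst z) *v y) \<partial>law j \<partial>\<mu>) + (kern ^^ Suc j) g2 w"
    by (simp add: nn_integral_add kern_def matrix_vector_mul_assoc)
  also have "(\<integral>\<^sup>+z. \<integral>\<^sup>+a. g1 ((a ** fst z) *v y) \<partial>law j \<partial>\<mu>) = (\<integral>\<^sup>+a. g1 (a *v y) \<partial>law (Suc j))"
  proof -
    interpret pair_sigma_finite "law j" \<mu> ..
    have "(\<integral>\<^sup>+a. g1 (a *v y) \<partial>law (Suc j)) = (\<integral>\<^sup>+a. \<integral>\<^sup>+z. g1 ((a ** fst z) *v y) \<partial>\<mu> \<partial>law j)"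
      by (simp add: nn_integral_law_Suc nn_integral_m)
    also have "\<dots> = (\<integral>\<^sup>+z. \<integral>\<^sup>+a. g1 ((a ** fst z) *v y) \<partial>law j \<partial>\<mu>)"
      by (rule Fubini'[symmetric]) (simp add: split_beta')
    finally show ?thesis ..
  qed
  finally show ?case .
qed

text \<open>
  After \<open>j\<close> steps the chain is the sum of the propagated initial state and a remainder that does
  not depend on it; by positivity the remainder is dominated by a stationary copy of the chain.
\<close>

lemma kern_pow_decouple:
  assumes [measurable]: "g \<in> borel_measurable borel" "g1 \<in> borel_measurable borel" "g2 \<in> borel_measurable borel"
    and le: "\<And>y w. vec_nonneg y \<Longrightarrow> vec_nonneg w \<Longrightarrow> g (y + w) \<le> g1 y + g2 w"
    and mono: "\<And>y w. vec_nonneg y \<Longrightarrow> vec_nonneg w \<Longrightarrow> g2 w \<le> g2 (y + w)"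
    and y: "vec_nonneg y"
  shows "(kern ^^ j) g y \<le> (\<integral>\<^sup>+a. g1 (a *v y) \<partial>law j) + (\<integral>\<^sup>+y. g2 y \<partial>\<nu>)"
proof -
  have mono_pow: "(kern ^^ j) g2 w \<le> (kern ^^ j) g2 (y + w)" if "vec_nonneg y" "vec_nonneg w" for y w
    using that
  proof (induction j arbitrary: y w)
    case (Suc j)
    have "(kern ^^ Suc j) g2 w = (\<integral>\<^sup>+z. (kern ^^ j) g2 (fst z *v w + snd z) \<partial>\<mu>)"
      by (simp add: kern_def)
    also have "\<dots> \<le> (\<integral>\<^sup>+z. (kern ^^ j) g2 (fst z *v y + (fst z *v w + snd z)) \<partial>\<mu>)"
      using Suc.prems
      by (intro nn_integral_mono_AE eventually_mono[OF AE_mu_nonneg] Suc.IH vec_nonneg_mult vec_nonneg_add) auto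
    also have "\<dots> = (kern ^^ Suc j) g2 (y + w)"
      by (simp add: kern_def matrix_vector_right_distrib add.assoc)
    finally show ?case .
  qed (simp add: mono)
  have "(kern ^^ j) g2 0 = (\<integral>\<^sup>+y. (kern ^^ j) g2 0 \<partial>\<nu>)"
    by (simp add: nu.emeasure_space_1[simplified])
  also have "\<dots> \<le> (\<integral>\<^sup>+y. (kern ^^ j) g2 y \<partial>\<nu>)"
    using AE_nu_nonneg by (intro nn_integral_mono_AE) (auto elim!: eventually_mono dest: mono_pow[of _ 0])
  also have "\<dots> = (\<integral>\<^sup>+y. g2 y \<partial>\<nu>)"
    by (rule nn_integral_kern_pow) measurable
  finally have "(kern ^^ j) g2 0 \<le> (\<integral>\<^sup>+y. g2 y \<partial>\<nu>)" .
  then have upper: "(\<integral>\<^sup>+a. g1 (a *v y) \<partial>law j) + (kern ^^ j) g2 0 \<le> (\<integral>\<^sup>+a. g1 (a *v y) \<partial>law j) + (\<integral>\<^sup>+y. g2 y \<partial>\<nu>)"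
    by (rule add_left_mono)
  have "(kern ^^ j) g (y + 0) \<le> (\<integral>\<^sup>+a. g1 (a *v y) \<partial>law j) + (kern ^^ j) g2 0"
    by (rule kern_pow_split) (auto intro: le y)
  from order_trans[OF this upper] show ?thesis by simp
qed

end

section \<open>Two-time estimates for the stationary chain\<close>

lemma one_minus_powr_le:
  fixes \<sigma> p :: real
  assumes "0 < \<sigma>" "\<sigma> < 1" "0 < p"
  shows "\<exists>C>0. \<forall>t. 0 \<le> t \<longrightarrow> t \<le> \<sigma> \<longrightarrow> (1 - t) powr - p \<le> 1 + C * t"
proof -
  obtain k :: nat where k: "p \<le> real k" using real_arch_simple by blast
  have "(1 - t) powr - p \<le> 1 + real k / (1 - \<sigma>) ^ k * t" if t: "0 \<le> t" "t \<le> \<sigma>" for t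
  proof -
    have pos: "0 < 1 - t" "1 - t \<le> 1" using t assms by auto
    have "(1 - t) powr - p \<le> (1 - t) powr - real k"
      using pos k by (intro powr_mono') auto
    also have "\<dots> = 1 / (1 - t) ^ k"
      using pos by (simp add: powr_minus powr_realpow divide_inverse)
    also have "\<dots> = 1 + (1 - (1 - t) ^ k) / (1 - t) ^ k"
      using pos by (simp add: field_simps)
    also have "\<dots> \<le> 1 + (real k * t) / (1 - \<sigma>) ^ k"
    proof (intro add_left_mono frac_le)
      have "1 + real k * (- t) \<le> (1 + - t) ^ k"
        using pos by (intro Bernoulli_inequality) auto
      then show "1 - (1 - t) ^ k \<le> real k * t" by simp
      show "(1 - \<sigma>) ^ k \<le> (1 - t) ^ k" using t assms by (intro power_mono) auto
    qed (use assms t in auto)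
    finally show ?thesis by simp
  qed
  moreover have "real k / (1 - \<sigma>) ^ k > 0" using k assms by auto
  ultimately show ?thesis by blast
qed

text \<open>
  A truncated power is almost subadditive: if \<open>b\<close> carries the fraction \<open>1 - \<tau>\<close> of the sum, replace
  the sum by \<open>b\<close>, otherwise by \<open>a\<close>. Letting \<open>\<tau>\<close> decay with the time lag keeps the factor in front of
  the independent part summably close to one.
\<close>

lemma min_powr_add_le:
  fixes a b e \<tau> p :: real
  assumes "0 \<le> a" "0 \<le> b" "0 \<le> e" "0 < \<tau>" "\<tau> < 1" "0 < p"
  shows "min (a + b) e powr p \<le> \<tau> powr - p * min a e powr p + (1 - \<tau>) powr - p * min b e powr p"
proof -
  have scale: "min s e powr p \<le> c powr - p * min d e powr p" if "c * s \<le> d" "0 \<le> s" "0 < c" "c < 1" for c s d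
  proof -
    have "c * min s e \<le> min d e"
    proof (rule min.boundedI)
      have "c * min s e \<le> c * s" using that by (intro mult_left_mono) auto
      then show "c * min s e \<le> d" using that by linarith
      have "c * min s e \<le> 1 * e"
        using that assms by (intro mult_mono) auto
      then show "c * min s e \<le> e" by simp
    qed
    then have "min s e \<le> min d e / c" using that by (simp add: field_simps)
    then have "min s e powr p \<le> (min d e / c) powr p"
      using that assms by (intro powr_mono2) auto
    also have "\<dots> = c powr - p * min d e powr p"
      using that by (simp add: powr_divide powr_minus field_simps)
    finally show ?thesis .
  qed
  show ?thesis
  proof (cases "(1 - \<tau>) * (a + b) \<le> b")
    case True
    then have "min (a + b) e powr p \<le> (1 - \<tau>) powr - p * min b e powr p"
      using assms by (intro scale) auto
    then show ?thesis by (simp add: add_increasing)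
  next
    case False
    then have "\<tau> * (a + b) \<le> a" by (simp add: algebra_simps)
    then have "min (a + b) e powr p \<le> \<tau> powr - p * min a e powr p"
      using assms by (intro scale) auto
    then show ?thesis by (simp add: add_increasing2)
  qed
qed

text \<open>
  A majorant of the \<open>p\<close>-th power of the small values of \<open>vnorm y / x\<close>. Capping at \<open>e\<close>, instead of
  discarding the values above \<open>e\<close>, makes it monotone in \<open>y\<close>, as decoupling requires.
\<close>

definition trunc :: "real \<Rightarrow> real \<Rightarrow> real \<Rightarrow> real^'d \<Rightarrow> real" where
  "trunc p x e y = min (vnorm y / x) e powr p"

lemma measurable_trunc [measurable]: "trunc p x e \<in> borel_measurable borel"
  unfolding trunc_def by measurable

lemma trunc_nonneg [simp]: "0 \<le> trunc p x e y"
  by (simp add: trunc_def)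

lemma trunc_le: "0 < p \<Longrightarrow> 0 < x \<Longrightarrow> 0 < e \<Longrightarrow> trunc p x e y \<le> e powr p"
  unfolding trunc_def by (intro powr_mono2) auto

lemma trunc_le_powr:
  assumes "0 \<le> r" "r \<le> p" "0 < x" "0 < e"
  shows "trunc p x e y \<le> e powr (p - r) * (vnorm y / x) powr r"
proof -
  have "trunc p x e y = min (vnorm y / x) e powr (p - r) * min (vnorm y / x) e powr r"
    unfolding trunc_def by (simp flip: powr_add)
  also have "\<dots> \<le> e powr (p - r) * (vnorm y / x) powr r"
    using assms by (intro mult_mono powr_mono2) auto
  finally show ?thesis .
qed

context critical_affine_law
begin

text \<open>
  Two exceedances \<open>j\<close> steps apart: either the propagated state is still large, which costs the
  moment of order \<open>\<kappa> < \<alpha>\<close> of a product of length \<open>j\<close>, or a stationary copy is large independently.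
\<close>

lemma exceed_pair:
  "\<exists>C>0. \<exists>\<rho>. 0 < \<rho> \<and> \<rho> < 1 \<and> (\<forall>u>0. \<forall>j.
     (\<integral>\<^sup>+y. (if u < vnorm y then 1 else 0) * (kern ^^ j) (\<lambda>y. if u < vnorm y then 1 else 0) y \<partial>\<nu>)
      \<le> ennreal (C * \<rho> ^ j * u powr - \<alpha> + C * (u powr - \<alpha>)\<^sup>2))"
proof -
  define \<kappa> where "\<kappa> = \<alpha> / 2"
  have \<kappa>: "0 < \<kappa>" "\<kappa> < \<alpha>" using \<alpha>_pos by (auto simp: \<kappa>_def)
  obtain C0 \<rho> where C0: "C0 > 0" "0 < \<rho>" "\<rho> < 1" and dec: "\<And>n. mom \<kappa> n \<le> ennreal (C0 * \<rho> ^ n)"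
    using mom_decay[OF \<kappa>] by blast
  obtain C1 where C1: "C1 > 0" and tail: "\<And>x. x > 0 \<Longrightarrow> emeasure \<nu> {y. x < vnorm y} \<le> ennreal (C1 * x powr - \<alpha>)"
    using nu_tail_le by blast
  define C2 where "C2 = C1 * exp \<kappa> / (1 - exp (\<kappa> - \<alpha>))"
  have C2: "C2 > 0" using C1 \<kappa> by (simp add: C2_def)
  define C where "C = max (2 powr \<kappa> * C0 * C2) (C1 * C1 * 2 powr \<alpha>)"
  have C: "C > 0" using C1 by (simp add: C_def less_max_iff_disj)
  have "(\<integral>\<^sup>+y. (if u < vnorm y then 1 else 0) * (kern ^^ j) (\<lambda>y. if u < vnorm y then 1 else 0) y \<partial>\<nu>)
      \<le> ennreal (C * \<rho> ^ j * u powr - \<alpha> + C * (u powr - \<alpha>)\<^sup>2)" if u: "u > 0" for u j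
  proof -
    let ?g = "\<lambda>u (y::real^'d). if u < vnorm y then 1 else 0 :: ennreal"
    have k: "(kern ^^ j) (?g u) y \<le> ennreal ((2 / u) powr \<kappa> * (C0 * \<rho> ^ j)) * ennreal (vnorm y powr \<kappa>) + ennreal (C1 * (u / 2) powr - \<alpha>)"
      if y: "vec_nonneg y" for y
    proof -
      have "(kern ^^ j) (?g u) y \<le> (\<integral>\<^sup>+a. ?g (u / 2) (a *v y) \<partial>law j) + (\<integral>\<^sup>+y. ?g (u / 2) y \<partial>\<nu>)"
      proof (rule kern_pow_decouple)
        fix y w :: "real^'d" assume yw: "vec_nonneg y" "vec_nonneg w"
        show "?g u (y + w) \<le> ?g (u / 2) y + ?g (u / 2) w"
          using vnorm_triangle[of y w] by auto
        show "?g (u / 2) w \<le> ?g (u / 2) (y + w)"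
          using vnorm_add_ge[OF yw(2,1)] by (auto simp: add.commute)
      qed (use y in auto)
      also have "(\<integral>\<^sup>+a. ?g (u / 2) (a *v y) \<partial>law j) \<le> (\<integral>\<^sup>+a. ennreal ((2 / u) powr \<kappa> * vnorm y powr \<kappa>) * ennreal (mnorm a powr \<kappa>) \<partial>law j)"
      proof (intro nn_integral_mono)
        fix a :: "real^'d^'d"
        show "?g (u / 2) (a *v y) \<le> ennreal ((2 / u) powr \<kappa> * vnorm y powr \<kappa>) * ennreal (mnorm a powr \<kappa>)"
        proof (cases "u / 2 < vnorm (a *v y)")
          case True
          then have "u / 2 < mnorm a * vnorm y" using vnorm_mult_le[of a y] by simp
          then have "1 \<le> 2 / u * vnorm y * mnorm a" using u by (simp add: field_simps)
          then have "1 \<le> (2 / u * vnorm y * mnorm a) powr \<kappa>" using \<kappa> by (intro ge_one_powr_ge_zero) auto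
          also have "\<dots> = (2 / u) powr \<kappa> * vnorm y powr \<kappa> * mnorm a powr \<kappa>"
            by (simp only: powr_mult)
          finally have "ennreal 1 \<le> ennreal ((2 / u) powr \<kappa> * vnorm y powr \<kappa> * mnorm a powr \<kappa>)"
            by (rule ennreal_leI)
          then show ?thesis using True by (simp add: ennreal_mult)
        qed simp
      qed
      also have "\<dots> = ennreal ((2 / u) powr \<kappa> * vnorm y powr \<kappa>) * mom \<kappa> j"
        unfolding mom_def by (simp add: nn_integral_cmult)
      also have "\<dots> \<le> ennreal ((2 / u) powr \<kappa> * vnorm y powr \<kappa>) * ennreal (C0 * \<rho> ^ j)"
        by (intro mult_left_mono dec) auto
      also have "\<dots> = ennreal ((2 / u) powr \<kappa> * (C0 * \<rho> ^ j)) * ennreal (vnorm y powr \<kappa>)"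
        using C0 by (simp add: ennreal_mult[symmetric] mult_ac)
      also have "(\<integral>\<^sup>+y. ?g (u / 2) y \<partial>\<nu>) = emeasure \<nu> {y. u / 2 < vnorm y}"
        by (rule emeasure_nu_if[symmetric]) measurable
      also have "\<dots> \<le> ennreal (C1 * (u / 2) powr - \<alpha>)"
        using u by (intro tail) simp
      finally show ?thesis by (simp add: add_mono)
    qed
    have "(\<integral>\<^sup>+y. ?g u y * (kern ^^ j) (?g u) y \<partial>\<nu>)
       \<le> (\<integral>\<^sup>+y. ennreal ((2 / u) powr \<kappa> * (C0 * \<rho> ^ j)) * (if u < vnorm y then ennreal (vnorm y powr \<kappa>) else 0) + ennreal (C1 * (u / 2) powr - \<alpha>) * ?g u y \<partial>\<nu>)"
      using AE_nu_nonneg by (intro nn_integral_mono_AE) (auto elim!: eventually_mono dest!: k)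
    also have "\<dots> = ennreal ((2 / u) powr \<kappa> * (C0 * \<rho> ^ j)) * (\<integral>\<^sup>+y. (if u < vnorm y then ennreal (vnorm y powr \<kappa>) else 0) \<partial>\<nu>)
        + ennreal (C1 * (u / 2) powr - \<alpha>) * emeasure \<nu> {y. u < vnorm y}"
      by (subst emeasure_nu_if, measurable) (simp add: nn_integral_add nn_integral_cmult)
    also have "\<dots> \<le> ennreal ((2 / u) powr \<kappa> * (C0 * \<rho> ^ j)) * ennreal (C2 * u powr (\<kappa> - \<alpha>))
        + ennreal (C1 * (u / 2) powr - \<alpha>) * ennreal (C1 * u powr - \<alpha>)"
      unfolding C2_def using \<kappa> C1 u tail
      by (intro add_mono mult_left_mono truncated_moment_above tail) auto
    also have "\<dots> = ennreal ((2 / u) powr \<kappa> * (C0 * \<rho> ^ j) * (C2 * u powr (\<kappa> - \<alpha>)) + C1 * (u / 2) powr - \<alpha> * (C1 * u powr - \<alpha>))"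
      using C0 C1 C2 by (simp add: ennreal_mult[symmetric] ennreal_plus[symmetric] del: ennreal_plus)
    also have "(2 / u) powr \<kappa> * (C0 * \<rho> ^ j) * (C2 * u powr (\<kappa> - \<alpha>)) = (2 powr \<kappa> * C0 * C2) * \<rho> ^ j * u powr - \<alpha>"
      using u by (simp add: powr_divide powr_diff powr_minus field_simps)
    also have "C1 * (u / 2) powr - \<alpha> * (C1 * u powr - \<alpha>) = (C1 * C1 * 2 powr \<alpha>) * (u powr - \<alpha>)\<^sup>2"
      using u by (simp add: powr_divide powr_minus field_simps power2_eq_square)
    also have "ennreal ((2 powr \<kappa> * C0 * C2) * \<rho> ^ j * u powr - \<alpha> + (C1 * C1 * 2 powr \<alpha>) * (u powr - \<alpha>)\<^sup>2)
       \<le> ennreal (C * \<rho> ^ j * u powr - \<alpha> + C * (u powr - \<alpha>)\<^sup>2)"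
      using C0 by (intro ennreal_leI add_mono mult_right_mono) (auto simp: C_def)
    finally show ?thesis .
  qed
  then show ?thesis using C C0 by blast
qed

lemma trunc_mean_le:
  assumes "0 \<le> r" "r \<le> p" "r < \<alpha>"
  shows "\<exists>C>0. \<forall>x>0. \<forall>e>0. (\<integral>\<^sup>+y. ennreal (trunc p x e y) \<partial>\<nu>) \<le> ennreal (C * e powr (p - r) * x powr - r)"
proof -
  obtain c where c: "0 \<le> c" "(\<integral>\<^sup>+y. ennreal (vnorm y powr r) \<partial>\<nu>) = ennreal c"
    using nu_moment[of r] assms by (cases "\<integral>\<^sup>+y. ennreal (vnorm y powr r) \<partial>\<nu>") auto
  have "(\<integral>\<^sup>+y. ennreal (trunc p x e y) \<partial>\<nu>) \<le> ennreal ((c + 1) * e powr (p - r) * x powr - r)" if "x > 0" "e > 0" for x e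
  proof -
    have "(\<integral>\<^sup>+y. ennreal (trunc p x e y) \<partial>\<nu>) \<le> (\<integral>\<^sup>+y. ennreal (e powr (p - r) * x powr - r) * ennreal (vnorm y powr r) \<partial>\<nu>)"
    proof (intro nn_integral_mono)
      fix y :: "real^'d"
      have "trunc p x e y \<le> e powr (p - r) * (vnorm y / x) powr r"
        using assms that by (intro trunc_le_powr) auto
      also have "\<dots> = e powr (p - r) * x powr - r * vnorm y powr r"
        using that by (simp add: powr_divide powr_minus field_simps)
      finally show "ennreal (trunc p x e y) \<le> ennreal (e powr (p - r) * x powr - r) * ennreal (vnorm y powr r)"
        by (simp add: ennreal_mult[symmetric] ennreal_leI)
    qed
    also have "\<dots> = ennreal (e powr (p - r) * x powr - r) * ennreal c"
      using c by (simp add: nn_integral_cmult)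
    also have "\<dots> \<le> ennreal ((c + 1) * e powr (p - r) * x powr - r)"
      using c by (simp add: ennreal_mult[symmetric] mult_ac) (intro ennreal_leI mult_right_mono, auto)
    finally show ?thesis .
  qed
  then show ?thesis using c by (intro exI[of _ "c + 1"]) auto
qed

text \<open>
  Both halves of the integral, below and above the cap at \<open>e * x\<close>, are dominated by values of
  \<open>vnorm y\<close> of the order \<open>e * x\<close>: below because \<open>p + \<kappa> > \<alpha>\<close>, above because \<open>\<kappa> < \<alpha>\<close>.
\<close>

lemma trunc_weighted_mean_le:
  assumes "0 < \<kappa>" "\<kappa> < \<alpha>" "\<alpha> < p + \<kappa>" "0 < p"
  shows "\<exists>C>0. \<forall>x>0. \<forall>e>0. (\<integral>\<^sup>+y. ennreal (trunc p x e y * (vnorm y / x) powr \<kappa>) \<partial>\<nu>)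
    \<le> ennreal (C * e powr (p + \<kappa> - \<alpha>) * x powr - \<alpha>)"
proof -
  obtain C1 where C1: "C1 > 0" and tail: "\<And>x. x > 0 \<Longrightarrow> emeasure \<nu> {y. x < vnorm y} \<le> ennreal (C1 * x powr - \<alpha>)"
    using nu_tail_le by blast
  define C2 where "C2 = C1 * exp \<kappa> / (1 - exp (\<kappa> - \<alpha>))"
  define C3 where "C3 = C1 * exp \<alpha> / (1 - exp (\<alpha> - (p + \<kappa>)))"
  have C2: "C2 > 0" using C1 assms by (simp add: C2_def)
  have C3: "C3 > 0" using C1 assms by (simp add: C3_def)
  have "(\<integral>\<^sup>+y. ennreal (trunc p x e y * (vnorm y / x) powr \<kappa>) \<partial>\<nu>)
    \<le> ennreal ((C3 + C2) * e powr (p + \<kappa> - \<alpha>) * x powr - \<alpha>)" if x: "x > 0" and e: "e > 0" for x e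
  proof -
    have "(\<integral>\<^sup>+y. ennreal (trunc p x e y * (vnorm y / x) powr \<kappa>) \<partial>\<nu>)
      \<le> (\<integral>\<^sup>+y. ennreal (x powr - (p + \<kappa>)) * (if vnorm y \<le> e * x then ennreal (vnorm y powr (p + \<kappa>)) else 0)
          + ennreal (e powr p * x powr - \<kappa>) * (if e * x < vnorm y then ennreal (vnorm y powr \<kappa>) else 0) \<partial>\<nu>)"
    proof (intro nn_integral_mono)
      fix y :: "real^'d"
      show "ennreal (trunc p x e y * (vnorm y / x) powr \<kappa>) \<le> ennreal (x powr - (p + \<kappa>)) * (if vnorm y \<le> e * x then ennreal (vnorm y powr (p + \<kappa>)) else 0)
          + ennreal (e powr p * x powr - \<kappa>) * (if e * x < vnorm y then ennreal (vnorm y powr \<kappa>) else 0)"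
      proof (cases "vnorm y \<le> e * x")
        case True
        then have "vnorm y / x \<le> e" using x by (simp add: field_simps)
        then have "trunc p x e y * (vnorm y / x) powr \<kappa> = (vnorm y / x) powr (p + \<kappa>)"
          by (simp add: trunc_def powr_add)
        also have "\<dots> = x powr - (p + \<kappa>) * vnorm y powr (p + \<kappa>)"
          unfolding powr_divide powr_minus using x by (simp add: field_simps)
        finally show ?thesis using True by (simp add: ennreal_mult)
      next
        case False
        have "trunc p x e y * (vnorm y / x) powr \<kappa> \<le> e powr p * (vnorm y / x) powr \<kappa>"
          using assms x e by (intro mult_right_mono trunc_le) auto
        also have "\<dots> = e powr p * x powr - \<kappa> * vnorm y powr \<kappa>"
          using x by (simp add: powr_divide powr_minus field_simps)
        finally have "ennreal (trunc p x e y * (vnorm y / x) powr \<kappa>) \<le> ennreal (e powr p * x powr - \<kappa> * vnorm y powr \<kappa>)"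
          by (rule ennreal_leI)
        then show ?thesis using False by (simp add: ennreal_mult)
      qed
    qed
    also have "\<dots> = ennreal (x powr - (p + \<kappa>)) * (\<integral>\<^sup>+y. (if vnorm y \<le> e * x then ennreal (vnorm y powr (p + \<kappa>)) else 0) \<partial>\<nu>)
          + ennreal (e powr p * x powr - \<kappa>) * (\<integral>\<^sup>+y. (if e * x < vnorm y then ennreal (vnorm y powr \<kappa>) else 0) \<partial>\<nu>)"
      by (simp add: nn_integral_add nn_integral_cmult)
    also have "\<dots> \<le> ennreal (x powr - (p + \<kappa>)) * ennreal (C3 * (e * x) powr (p + \<kappa> - \<alpha>))
          + ennreal (e powr p * x powr - \<kappa>) * ennreal (C2 * (e * x) powr (\<kappa> - \<alpha>))"
      unfolding C2_def C3_def using assms C1 x e \<alpha>_pos tail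
      by (intro add_mono mult_left_mono truncated_moment_above truncated_moment_below) auto
    also have "\<dots> = ennreal (x powr - (p + \<kappa>) * (C3 * (e * x) powr (p + \<kappa> - \<alpha>)) + e powr p * x powr - \<kappa> * (C2 * (e * x) powr (\<kappa> - \<alpha>)))"
      using C2 C3 by (simp add: ennreal_mult[symmetric] ennreal_plus[symmetric] del: ennreal_plus)
    also have "x powr - (p + \<kappa>) * (C3 * (e * x) powr (p + \<kappa> - \<alpha>)) = C3 * e powr (p + \<kappa> - \<alpha>) * x powr - \<alpha>"
      using x e by (simp add: powr_def ln_mult exp_add[symmetric] algebra_simps)
    also have "e powr p * x powr - \<kappa> * (C2 * (e * x) powr (\<kappa> - \<alpha>)) = C2 * e powr (p + \<kappa> - \<alpha>) * x powr - \<alpha>"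
      using x e by (simp add: powr_def ln_mult exp_add[symmetric] algebra_simps)
    finally show ?thesis by (simp add: algebra_simps)
  qed
  then show ?thesis using C2 C3 by (intro exI[of _ "C3 + C2"]) auto
qed

text \<open>
  Correlations of the truncated powers decay geometrically. The decoupled part contributes the
  square of the mean. In the propagated part, part of the second factor is traded for the moment of
  order \<open>\<kappa>\<close> of the product, and \<open>\<kappa>\<close> can be chosen with \<open>p + \<kappa> > \<alpha>\<close> precisely because \<open>2 * p > \<alpha>\<close>.
\<close>

lemma trunc_pair_le:
  assumes p: "0 < p" "\<alpha> < 2 * p"
  shows "\<exists>C>0. \<exists>\<rho>. 0 < \<rho> \<and> \<rho> < 1 \<and> (\<forall>x>0. \<forall>e>0. \<forall>m\<ge>0. \<forall>j.
     (\<integral>\<^sup>+y. ennreal (trunc p x e y) \<partial>\<nu>) = ennreal m \<longrightarrow>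
     (\<integral>\<^sup>+y. ennreal (trunc p x e y) * (kern ^^ j) (\<lambda>y. ennreal (trunc p x e y)) y \<partial>\<nu>)
      \<le> ennreal (m\<^sup>2 + C * \<rho> ^ j * (m\<^sup>2 + e powr (2 * p - \<alpha>) * x powr - \<alpha>)))"
proof -
  define \<kappa> where "\<kappa> = (if p < \<alpha> then p else \<alpha> / 2)"
  have \<kappa>: "0 < \<kappa>" "\<kappa> \<le> p" "\<kappa> < \<alpha>" "\<alpha> < p + \<kappa>"
    using p \<alpha>_pos by (auto simp: \<kappa>_def)
  obtain C0 \<rho>0 where C0: "C0 > 0" "0 < \<rho>0" "\<rho>0 < 1" and dec: "\<And>n. mom \<kappa> n \<le> ennreal (C0 * \<rho>0 ^ n)"
    using mom_decay[OF \<kappa>(1,3)] by blast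
  obtain C1 where C1: "C1 > 0" and weighted: "\<And>x e. x > 0 \<Longrightarrow> e > 0 \<Longrightarrow>
     (\<integral>\<^sup>+y. ennreal (trunc p x e y * (vnorm y / x) powr \<kappa>) \<partial>\<nu>) \<le> ennreal (C1 * e powr (p + \<kappa> - \<alpha>) * x powr - \<alpha>)"
    using trunc_weighted_mean_le[OF \<kappa>(1,3,4) p(1)] by blast
  (* The share tau of the sum left to the propagated part is sigma^j: geometric, but slowly enough
     that tau^(-p) costs only half of the decay of the moments. *)
  define \<sigma> where "\<sigma> = \<rho>0 powr (1 / (2 * p))"
  have \<sigma>: "0 < \<sigma>" "\<sigma> < 1" using C0 p by (auto simp: \<sigma>_def powr01_less_one)
  have \<sigma>p: "(\<sigma> ^ j) powr - p * \<rho>0 ^ j = (\<rho>0 powr (1/2)) ^ j" for j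
  proof -
    have "(\<sigma> ^ j) powr - p = \<rho>0 powr (- (real j / 2))"
      using C0 p by (simp add: \<sigma>_def powr_realpow[symmetric] powr_powr)
    moreover have "\<rho>0 ^ j = \<rho>0 powr real j" using C0 by (simp add: powr_realpow)
    moreover have "(\<rho>0 powr (1/2)) ^ j = \<rho>0 powr (real j / 2)"
      using C0 by (simp add: powr_realpow[symmetric] powr_powr)
    ultimately show ?thesis by (simp flip: powr_add)
  qed
  obtain B where B: "B > 0" and bern: "\<And>t. 0 \<le> t \<Longrightarrow> t \<le> \<sigma> \<Longrightarrow> (1 - t) powr - p \<le> 1 + B * t"
    using one_minus_powr_le[OF \<sigma> p(1)] by blast
  define \<rho> where "\<rho> = max \<sigma> (\<rho>0 powr (1/2))"
  have \<rho>: "0 < \<rho>" "\<rho> < 1" using \<sigma> C0 by (auto simp: \<rho>_def powr01_less_one less_max_iff_disj)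
  define C where "C = max B (max C1 (C0 * C1))"
  have C: "C > 0" "B \<le> C" "C1 \<le> C" "C0 * C1 \<le> C" using B by (auto simp: C_def less_max_iff_disj)
  have "(\<integral>\<^sup>+y. ennreal (trunc p x e y) * (kern ^^ j) (\<lambda>y. ennreal (trunc p x e y)) y \<partial>\<nu>)
      \<le> ennreal (m\<^sup>2 + C * \<rho> ^ j * (m\<^sup>2 + e powr (2 * p - \<alpha>) * x powr - \<alpha>))"
    if x: "x > 0" and e: "e > 0" and m: "m \<ge> 0" "(\<integral>\<^sup>+y. ennreal (trunc p x e y) \<partial>\<nu>) = ennreal m" for x e m j
  proof -
    let ?g = "trunc p x e :: real^'d \<Rightarrow> real"
    let ?Q = "e powr (2 * p - \<alpha>) * x powr - \<alpha>"
    have eq: "e powr (p - \<kappa>) * (C1 * e powr (p + \<kappa> - \<alpha>) * x powr - \<alpha>) = C1 * ?Q"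
    proof -
      have "e powr (2 * p - \<alpha>) = e powr (p - \<kappa>) * e powr (p + \<kappa> - \<alpha>)"
        unfolding powr_add[symmetric] by simp
      then show ?thesis by (simp only: mult_ac)
    qed
    show ?thesis
    proof (cases "j = 0")
      case True
      have "(\<integral>\<^sup>+y. ennreal (?g y) * ennreal (?g y) \<partial>\<nu>) \<le> (\<integral>\<^sup>+y. ennreal (e powr (p - \<kappa>)) * ennreal (?g y * (vnorm y / x) powr \<kappa>) \<partial>\<nu>)"
      proof (intro nn_integral_mono)
        fix y :: "real^'d"
        have "?g y * ?g y \<le> ?g y * (e powr (p - \<kappa>) * (vnorm y / x) powr \<kappa>)"
          using \<kappa> x e by (intro mult_left_mono trunc_le_powr) auto
        then show "ennreal (?g y) * ennreal (?g y) \<le> ennreal (e powr (p - \<kappa>)) * ennreal (?g y * (vnorm y / x) powr \<kappa>)"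
          by (simp add: ennreal_mult[symmetric] mult_ac ennreal_leI)
      qed
      also have "\<dots> = ennreal (e powr (p - \<kappa>)) * (\<integral>\<^sup>+y. ennreal (?g y * (vnorm y / x) powr \<kappa>) \<partial>\<nu>)"
        by (simp add: nn_integral_cmult)
      also have "\<dots> \<le> ennreal (e powr (p - \<kappa>)) * ennreal (C1 * e powr (p + \<kappa> - \<alpha>) * x powr - \<alpha>)"
        by (intro mult_left_mono weighted x e) auto
      also have "\<dots> = ennreal (C1 * ?Q)"
        using C1 by (simp only: ennreal_mult[symmetric] powr_ge_zero mult_nonneg_nonneg less_imp_le eq)
      also have "\<dots> \<le> ennreal (m\<^sup>2 + C * \<rho> ^ j * (m\<^sup>2 + ?Q))"
      proof (intro ennreal_leI)
        have "C1 * ?Q \<le> C * ?Q" using C by (intro mult_right_mono) auto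
        also have "\<dots> \<le> C * (m\<^sup>2 + ?Q)" using C by (intro mult_left_mono) auto
        also have "\<dots> \<le> m\<^sup>2 + C * \<rho> ^ j * (m\<^sup>2 + ?Q)" using True by simp
        finally show "C1 * ?Q \<le> m\<^sup>2 + C * \<rho> ^ j * (m\<^sup>2 + ?Q)" .
      qed
      finally show ?thesis using True by simp
    next
      case False
      define t where "t = \<sigma> ^ j"
      have t: "0 < t" "t \<le> \<sigma>" "t < 1"
      proof -
        show "0 < t" using \<sigma> by (simp add: t_def)
        show "t \<le> \<sigma>" using False \<sigma> power_decreasing[of 1 j \<sigma>] by (simp add: t_def)
        then show "t < 1" using \<sigma> by simp
      qed
      have k: "(kern ^^ j) (\<lambda>y. ennreal (?g y)) y \<le> ennreal (t powr - p * (e powr (p - \<kappa>) * (C0 * \<rho>0 ^ j))) * ennreal ((vnorm y / x) powr \<kappa>)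
          + ennreal ((1 - t) powr - p * m)" if y: "vec_nonneg y" for y
      proof -
        have "(kern ^^ j) (\<lambda>y. ennreal (?g y)) y \<le> (\<integral>\<^sup>+a. ennreal (t powr - p * ?g (a *v y)) \<partial>law j) + (\<integral>\<^sup>+y. ennreal ((1 - t) powr - p * ?g y) \<partial>\<nu>)"
        proof (rule kern_pow_decouple)
          fix y w :: "real^'d" assume yw: "vec_nonneg y" "vec_nonneg w"
          have "?g (y + w) \<le> min (vnorm y / x + vnorm w / x) e powr p"
            unfolding trunc_def using p e x vnorm_triangle[of y w]
            by (intro powr_mono2 min.mono) (auto simp: add_divide_distrib[symmetric] divide_right_mono)
          also have "\<dots> \<le> t powr - p * ?g y + (1 - t) powr - p * ?g w"
            unfolding trunc_def using t p e x by (intro min_powr_add_le) auto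
          finally show "ennreal (?g (y + w)) \<le> ennreal (t powr - p * ?g y) + ennreal ((1 - t) powr - p * ?g w)"
            by (simp add: ennreal_plus[symmetric] ennreal_leI del: ennreal_plus)
          have "vnorm w / x \<le> vnorm (y + w) / x"
            using vnorm_add_ge[OF yw(2,1)] x by (intro divide_right_mono) (auto simp: add.commute)
          then have "?g w \<le> ?g (y + w)"
            unfolding trunc_def using p e x by (intro powr_mono2 min.mono) auto
          then show "ennreal ((1 - t) powr - p * ?g w) \<le> ennreal ((1 - t) powr - p * ?g (y + w))"
            by (intro ennreal_leI mult_left_mono) auto
        qed (use y in auto)
        also have "(\<integral>\<^sup>+y. ennreal ((1 - t) powr - p * ?g y) \<partial>\<nu>) = ennreal ((1 - t) powr - p * m)"
          using m by (simp add: ennreal_mult nn_integral_cmult)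
        also have "(\<integral>\<^sup>+a. ennreal (t powr - p * ?g (a *v y)) \<partial>law j)
            \<le> (\<integral>\<^sup>+a. ennreal (t powr - p * e powr (p - \<kappa>) * (vnorm y / x) powr \<kappa>) * ennreal (mnorm a powr \<kappa>) \<partial>law j)"
        proof (intro nn_integral_mono)
          fix a :: "real^'d^'d"
          have "?g (a *v y) \<le> e powr (p - \<kappa>) * (vnorm (a *v y) / x) powr \<kappa>"
            using \<kappa> x e by (intro trunc_le_powr) auto
          also have "\<dots> \<le> e powr (p - \<kappa>) * (mnorm a * (vnorm y / x)) powr \<kappa>"
            using \<kappa> x vnorm_mult_le[of a y] by (intro mult_left_mono powr_mono2) (auto simp: divide_right_mono)
          also have "\<dots> = e powr (p - \<kappa>) * ((vnorm y / x) powr \<kappa> * mnorm a powr \<kappa>)"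
            by (simp only: powr_mult mult.commute)
          finally have "t powr - p * ?g (a *v y) \<le> t powr - p * (e powr (p - \<kappa>) * ((vnorm y / x) powr \<kappa> * mnorm a powr \<kappa>))"
            by (intro mult_left_mono) auto
          then show "ennreal (t powr - p * ?g (a *v y)) \<le> ennreal (t powr - p * e powr (p - \<kappa>) * (vnorm y / x) powr \<kappa>) * ennreal (mnorm a powr \<kappa>)"
            by (simp only: ennreal_mult[symmetric] powr_ge_zero mult_nonneg_nonneg mult.assoc ennreal_leI)
        qed
        also have "\<dots> = ennreal (t powr - p * e powr (p - \<kappa>) * (vnorm y / x) powr \<kappa>) * mom \<kappa> j"
          unfolding mom_def by (simp add: nn_integral_cmult)
        also have "\<dots> \<le> ennreal (t powr - p * e powr (p - \<kappa>) * (vnorm y / x) powr \<kappa>) * ennreal (C0 * \<rho>0 ^ j)"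
          by (intro mult_left_mono dec) auto
        also have "\<dots> = ennreal (t powr - p * (e powr (p - \<kappa>) * (C0 * \<rho>0 ^ j))) * ennreal ((vnorm y / x) powr \<kappa>)"
          using C0 by (simp add: ennreal_mult[symmetric] mult_ac)
        finally show ?thesis by (simp add: add_mono)
      qed
      let ?D = "t powr - p * (e powr (p - \<kappa>) * (C0 * \<rho>0 ^ j))"
      have D0: "0 \<le> ?D" using C0 by simp
      have "(\<integral>\<^sup>+y. ennreal (?g y) * (kern ^^ j) (\<lambda>y. ennreal (?g y)) y \<partial>\<nu>)
        \<le> (\<integral>\<^sup>+y. ennreal ?D * ennreal (?g y * (vnorm y / x) powr \<kappa>) + ennreal ((1 - t) powr - p * m) * ennreal (?g y) \<partial>\<nu>)"
      proof (rule nn_integral_mono_AE)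
        show "AE y in \<nu>. ennreal (?g y) * (kern ^^ j) (\<lambda>y. ennreal (?g y)) y \<le> ennreal ?D * ennreal (?g y * (vnorm y / x) powr \<kappa>) + ennreal ((1 - t) powr - p * m) * ennreal (?g y)"
          using AE_nu_nonneg
        proof eventually_elim
          case (elim y)
          have "ennreal (?g y) * (kern ^^ j) (\<lambda>y. ennreal (?g y)) y \<le> ennreal (?g y) * (ennreal ?D * ennreal ((vnorm y / x) powr \<kappa>) + ennreal ((1 - t) powr - p * m))"
            by (intro mult_left_mono k elim) auto
          also have "\<dots> = ennreal ?D * ennreal (?g y * (vnorm y / x) powr \<kappa>) + ennreal ((1 - t) powr - p * m) * ennreal (?g y)"
            by (simp add: distrib_left ennreal_mult' mult_ac)
          finally show ?case .
        qed
      qed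
      also have "\<dots> = ennreal ?D * (\<integral>\<^sup>+y. ennreal (?g y * (vnorm y / x) powr \<kappa>) \<partial>\<nu>) + ennreal ((1 - t) powr - p * m) * ennreal m"
        unfolding m(2)[symmetric] by (simp add: nn_integral_add nn_integral_cmult)
      also have "\<dots> \<le> ennreal ?D * ennreal (C1 * e powr (p + \<kappa> - \<alpha>) * x powr - \<alpha>) + ennreal ((1 - t) powr - p * m) * ennreal m"
        by (intro add_right_mono mult_left_mono weighted x e) auto
      also have "\<dots> = ennreal (?D * (C1 * e powr (p + \<kappa> - \<alpha>) * x powr - \<alpha>) + (1 - t) powr - p * m * m)"
        using C1 D0 m by (simp only: ennreal_mult[symmetric] ennreal_plus[symmetric] powr_ge_zero mult_nonneg_nonneg less_imp_le)
      also have "?D * (C1 * e powr (p + \<kappa> - \<alpha>) * x powr - \<alpha>) = C0 * (t powr - p * \<rho>0 ^ j) * (e powr (p - \<kappa>) * (C1 * e powr (p + \<kappa> - \<alpha>) * x powr - \<alpha>))"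
        by (simp only: mult_ac)
      also have "\<dots> = C0 * C1 * (\<rho>0 powr (1/2)) ^ j * ?Q"
        unfolding eq t_def \<sigma>p by simp
      also have "ennreal (C0 * C1 * (\<rho>0 powr (1/2)) ^ j * ?Q + (1 - t) powr - p * m * m) \<le> ennreal (m\<^sup>2 + C * \<rho> ^ j * (m\<^sup>2 + ?Q))"
      proof (intro ennreal_leI)
        have "C0 * C1 * (\<rho>0 powr (1/2)) ^ j * ?Q \<le> C * \<rho> ^ j * ?Q"
          using C C0 C1 by (intro mult_right_mono mult_mono power_mono) (auto simp: \<rho>_def)
        moreover have "(1 - t) powr - p * (m * m) \<le> (1 + C * \<rho> ^ j) * (m * m)"
        proof (intro mult_right_mono)
          have "(1 - t) powr - p \<le> 1 + B * t" using t by (intro bern) auto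
          also have "B * t \<le> C * \<rho> ^ j"
            unfolding t_def using C B \<sigma> by (intro mult_mono power_mono) (auto simp: \<rho>_def)
          finally show "(1 - t) powr - p \<le> 1 + C * \<rho> ^ j" by simp
        qed simp
        ultimately show "C0 * C1 * (\<rho>0 powr (1/2)) ^ j * ?Q + (1 - t) powr - p * m * m \<le> m\<^sup>2 + C * \<rho> ^ j * (m\<^sup>2 + ?Q)"
          by (simp add: power2_eq_square algebra_simps)
      qed
      finally show ?thesis .
    qed
  qed
  note bound = this
  show ?thesis
    by (intro exI[of _ C] exI[of _ \<rho>] conjI allI impI C(1) \<rho>, rule bound, assumption+)
qed

end

section \<open>Comparing an arbitrary norm with the entrywise norms\<close>

lemma is_norm_simps:
  assumes "is_norm N"
  shows "N x = 0 \<longleftrightarrow> x = 0" "N (c *\<^sub>R x) = \<bar>c\<bar> * N x" "N (x + y) \<le> N x + N y"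
  using assms by (auto simp: is_norm_def)

lemma is_norm_nonneg:
  assumes "is_norm N"
  shows "0 \<le> N x"
proof -
  have "N (x + (-1) *\<^sub>R x) \<le> N x + N ((-1) *\<^sub>R x)"
    by (rule is_norm_simps(3)[OF assms])
  then show ?thesis
    using is_norm_simps(1)[OF assms, of 0] by (simp only: is_norm_simps(2)[OF assms]) simp
qed

lemma is_norm_continuous:
  fixes N :: "'a::euclidean_space \<Rightarrow> real"
  assumes "is_norm N"
  shows "continuous_on UNIV N"
proof (rule convex_on_continuous)
  show "convex_on UNIV N"
    unfolding convex_on_def
  proof (intro conjI ballI allI impI)
    fix x y :: 'a and u v :: real assume uv: "0 \<le> u" "0 \<le> v" "u + v = 1"
    have "N (u *\<^sub>R x + v *\<^sub>R y) \<le> N (u *\<^sub>R x) + N (v *\<^sub>R y)"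
      by (rule is_norm_simps(3)[OF assms])
    then show "N (u *\<^sub>R x + v *\<^sub>R y) \<le> u * N x + v * N y"
      using uv by (simp add: is_norm_simps(2)[OF assms])
  qed simp
qed simp

lemma is_norm_measurable:
  fixes N :: "'a::euclidean_space \<Rightarrow> real"
  shows "is_norm N \<Longrightarrow> N \<in> borel_measurable borel"
  by (intro borel_measurable_continuous_onI is_norm_continuous)

lemma is_norm_vnorm: "is_norm vnorm"
  by (auto simp: is_norm_def vnorm_scaleR vnorm_triangle)

lemma is_norm_mnorm: "is_norm mnorm"
  unfolding is_norm_def
proof (intro conjI allI)
  fix x y :: "real^'d^'d" and c :: real
  show "mnorm x = 0 \<longleftrightarrow> x = 0"
    unfolding mnorm_def by (simp add: sum_nonneg_eq_0_iff sum_nonneg vec_eq_iff)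
  show "mnorm (c *\<^sub>R x) = \<bar>c\<bar> * mnorm x"
    unfolding mnorm_def by (simp add: abs_mult sum_distrib_left)
  show "mnorm (x + y) \<le> mnorm x + mnorm y"
    unfolding mnorm_def by (simp add: sum.distrib[symmetric] sum_mono)
qed

lemma is_norm_le:
  fixes N N' :: "'a::euclidean_space \<Rightarrow> real"
  assumes N: "is_norm N" and N': "is_norm N'"
  shows "\<exists>c>0. \<forall>y. N y \<le> c * N' y"
proof -
  let ?S = "sphere (0::'a) 1"
  have S: "compact ?S" "?S \<noteq> {}" by auto
  have cN: "continuous_on ?S N" and cN': "continuous_on ?S N'"
    using is_norm_continuous[OF N] is_norm_continuous[OF N'] continuous_on_subset by blast+
  obtain a where a: "a \<in> ?S" "\<And>y. y \<in> ?S \<Longrightarrow> N y \<le> N a"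
    using continuous_attains_sup[OF S cN] by blast
  obtain b where b: "b \<in> ?S" "\<And>y. y \<in> ?S \<Longrightarrow> N' b \<le> N' y"
    using continuous_attains_inf[OF S cN'] by blast
  have "a \<noteq> 0" "b \<noteq> 0" using a b by auto
  then have pos: "0 < N a" "0 < N' b"
    using is_norm_simps(1)[OF N, of a] is_norm_simps(1)[OF N', of b] is_norm_nonneg[OF N, of a] is_norm_nonneg[OF N', of b]
    by (auto simp: less_le)
  have "N y \<le> N a / N' b * N' y" for y
  proof (cases "y = 0")
    case True
    then show ?thesis using is_norm_simps(1)[OF N, of 0] is_norm_simps(1)[OF N', of 0] by simp
  next
    case False
    let ?z = "(1 / norm y) *\<^sub>R y"
    have z: "?z \<in> ?S" using False by simp
    have "N ?z * N' b \<le> N a * N' ?z"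
      using a(2)[OF z] b(2)[OF z] pos by (intro mult_mono) (auto intro: is_norm_nonneg N)
    then have "N y * N' b \<le> N a * N' y"
      using False by (simp add: is_norm_simps(2)[OF N] is_norm_simps(2)[OF N'] field_simps)
    then show ?thesis using pos by (simp add: field_simps)
  qed
  moreover have "N a / N' b > 0" using pos by simp
  ultimately show ?thesis by blast
qed

context
  fixes N :: "real^'d \<Rightarrow> real"
  assumes N: "is_norm N"
begin

lemma unit_vector_exists: "\<exists>x. N x = 1"
proof -
  have "N (axis undefined 1) > 0"
    using is_norm_simps(1)[OF N, of "axis undefined 1"] is_norm_nonneg[OF N, of "axis undefined 1"]
    by (auto simp: less_le axis_eq_0_iff)
  then have "N ((1 / N (axis undefined 1)) *\<^sub>R axis undefined 1) = 1"
    by (subst is_norm_simps(2)[OF N]) simp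
  then show ?thesis by blast
qed

lemma op_norm_bdd: "bdd_above ((\<lambda>x. N (a *v x)) ` {x. N x = 1})"
proof -
  obtain c where c: "c > 0" "\<And>y. N y \<le> c * vnorm y"
    using is_norm_le[OF N is_norm_vnorm] by blast
  obtain c' where c': "c' > 0" "\<And>y. vnorm y \<le> c' * N y"
    using is_norm_le[OF is_norm_vnorm N] by blast
  have "N (a *v x) \<le> c * (mnorm a * c')" if "N x = 1" for x
  proof -
    have "N (a *v x) \<le> c * vnorm (a *v x)" by (rule c)
    also have "\<dots> \<le> c * (mnorm a * vnorm x)" using c by (intro mult_left_mono vnorm_mult_le) auto
    also have "\<dots> \<le> c * (mnorm a * c')" using c c'(2)[of x] that by (intro mult_left_mono) auto
    finally show ?thesis .
  qed
  then show ?thesis by (auto intro!: bdd_aboveI2)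
qed

lemma op_norm_apply: "N (a *v x) \<le> op_norm N a * N x"
proof (cases "x = 0")
  case True
  then show ?thesis using is_norm_simps(1)[OF N, of 0] by simp
next
  case False
  then have pos: "N x > 0"
    using is_norm_simps(1)[OF N, of x] is_norm_nonneg[OF N, of x] by (auto simp: less_le)
  let ?z = "(1 / N x) *\<^sub>R x"
  have "N ?z = 1" using pos by (subst is_norm_simps(2)[OF N]) simp
  then have "N (a *v ?z) \<le> op_norm N a"
    unfolding op_norm_def by (intro cSUP_upper op_norm_bdd) auto
  moreover have "N (a *v ?z) = N (a *v x) / N x"
    using pos by (simp add: matrix_vector_mult_scaleR is_norm_simps(2)[OF N])
  ultimately show ?thesis using pos by (simp add: field_simps)
qed

lemma op_norm_leI: "(\<And>x. N x = 1 \<Longrightarrow> N (a *v x) \<le> c) \<Longrightarrow> op_norm N a \<le> c"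
  unfolding op_norm_def using unit_vector_exists by (intro cSUP_least) auto

lemma op_norm_nonneg: "0 \<le> op_norm N a"
  using unit_vector_exists op_norm_apply[of a] is_norm_nonneg[OF N] by (metis mult.right_neutral order_trans)

lemma is_norm_op_norm: "is_norm (op_norm N)"
  unfolding is_norm_def
proof (intro conjI allI)
  fix x y :: "real^'d^'d" and c :: real
  have scale: "op_norm N (c *\<^sub>R x) \<le> \<bar>c\<bar> * op_norm N x" for c x
  proof (rule op_norm_leI)
    fix y assume y: "N y = 1"
    have "N ((c *\<^sub>R x) *v y) = \<bar>c\<bar> * N (x *v y)"
      by (simp add: scaleR_matrix_vector_assoc[symmetric] is_norm_simps(2)[OF N])
    also have "\<dots> \<le> \<bar>c\<bar> * op_norm N x"
      using op_norm_apply[of x y] y by (intro mult_left_mono) auto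
    finally show "N ((c *\<^sub>R x) *v y) \<le> \<bar>c\<bar> * op_norm N x" .
  qed
  show "op_norm N (c *\<^sub>R x) = \<bar>c\<bar> * op_norm N x"
  proof (cases "c = 0")
    case True
    then show ?thesis using scale[of 0 x] op_norm_nonneg[of "0 *\<^sub>R x"] by simp
  next
    case False
    have "\<bar>c\<bar> * op_norm N x = \<bar>c\<bar> * op_norm N ((1 / c) *\<^sub>R (c *\<^sub>R x))" using False by simp
    also have "\<dots> \<le> \<bar>c\<bar> * (\<bar>1 / c\<bar> * op_norm N (c *\<^sub>R x))" by (intro mult_left_mono scale) auto
    also have "\<dots> = op_norm N (c *\<^sub>R x)" using False by simp
    finally show ?thesis using scale[of c x] by simp
  qed
  show "op_norm N (x + y) \<le> op_norm N x + op_norm N y"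
  proof (rule op_norm_leI)
    fix z assume z: "N z = 1"
    have "N ((x + y) *v z) \<le> N (x *v z) + N (y *v z)"
      by (simp add: matrix_vector_mult_add_rdistrib is_norm_simps(3)[OF N])
    also have "\<dots> \<le> op_norm N x + op_norm N y"
      using op_norm_apply[of x z] op_norm_apply[of y z] z by (intro add_mono) auto
    finally show "N ((x + y) *v z) \<le> op_norm N x + op_norm N y" .
  qed
  show "op_norm N x = 0 \<longleftrightarrow> x = 0"
  proof
    assume "op_norm N x = 0"
    then have "N (x *v z) \<le> 0" for z using op_norm_apply[of x z] by simp
    then have "x *v z = 0" for z
      using is_norm_nonneg[OF N, of "x *v z"] is_norm_simps(1)[OF N, of "x *v z"] by (metis order_antisym)
    then show "x = 0" by (metis matrix_eq matrix_vector_mult_0)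
  next
    assume "x = 0"
    then show "op_norm N x = 0" using scale[of 0 x] op_norm_nonneg[of "0 *\<^sub>R x"] by simp
  qed
qed

lemma op_norm_mult: "op_norm N (a ** b) \<le> op_norm N a * op_norm N b"
proof (rule op_norm_leI)
  fix x assume x: "N x = 1"
  have "N ((a ** b) *v x) \<le> op_norm N a * N (b *v x)"
    by (simp add: matrix_vector_mul_assoc[symmetric] op_norm_apply)
  also have "\<dots> \<le> op_norm N a * op_norm N b"
    using op_norm_apply[of b x] x by (intro mult_left_mono op_norm_nonneg) auto
  finally show "N ((a ** b) *v x) \<le> op_norm N a * op_norm N b" .
qed

lemma op_norm_one: "op_norm N (mat 1) = 1"
proof (rule antisym)
  show "op_norm N (mat 1) \<le> 1" by (rule op_norm_leI) simp
  obtain x where "N x = 1" using unit_vector_exists by blast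
  then show "1 \<le> op_norm N (mat 1)" using op_norm_apply[of "mat 1" x] by simp
qed

end

section \<open>The recursion on the original probability space\<close>

locale affine_process = prob_space M
  for M :: "'w measure" +
  fixes N :: "real^'d \<Rightarrow> real"
    and A :: "int \<Rightarrow> 'w \<Rightarrow> real^'d^'d"
    and B :: "int \<Rightarrow> 'w \<Rightarrow> real^'d"
    and X :: "int \<Rightarrow> 'w \<Rightarrow> real^'d"
    and \<alpha> :: real
  assumes N: "is_norm N"
    and iid: "iid_sequence M (\<lambda>t \<omega>. (A t \<omega>, B t \<omega>))"
    and nonneg: "nonneg_entries M (A 0) (B 0)"
    and K3: "K3 M (A 0) (B 0)"
    and K4: "K4 M N (A 0)"
    and K5: "K5 M N (A 0)"
    and K6: "K6 M N (A 0)"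
    and K7: "K7 M N A (B 0) \<alpha>"
    and sol: "causal_stationary_solution M A B X"
begin

definition \<mu> :: "((real^'d^'d) \<times> (real^'d)) measure" where
  "\<mu> = distr M borel (\<lambda>\<omega>. (A 0 \<omega>, B 0 \<omega>))"

definition \<nu> :: "(real^'d) measure" where
  "\<nu> = distr M borel (X 0)"

abbreviation Y :: "int \<Rightarrow> 'w \<Rightarrow> (real^'d^'d) \<times> (real^'d)" where
  "Y t \<omega> \<equiv> (A t \<omega>, B t \<omega>)"

lemma indep_Y: "indep_vars (\<lambda>_. borel) Y UNIV"
  using iid by (simp add: iid_sequence_def)

lemma measurable_Y [measurable]: "Y t \<in> borel_measurable M"
  using indep_Y by (auto simp: indep_vars_def)

lemma measurable_A [measurable]: "A t \<in> borel_measurable M"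
  using measurable_fst_borel[OF measurable_Y[of t]] by simp

lemma measurable_B [measurable]: "B t \<in> borel_measurable M"
  using measurable_snd_borel[OF measurable_Y[of t]] by simp

lemma distr_Y: "distr M borel (Y t) = \<mu>"
  using iid by (simp add: iid_sequence_def \<mu>_def)

lemma sets_\<mu> [measurable_cong, simp]: "sets \<mu> = sets borel"
  by (simp add: \<mu>_def)

lemma prob_\<mu>: "prob_space \<mu>"
  unfolding \<mu>_def by (rule prob_space_distr) measurable

lemma measurable_X [measurable]: "X t \<in> borel_measurable M"
  using sol by (simp add: causal_stationary_solution_def strictly_stationary_def)

lemma sets_\<nu> [measurable_cong, simp]: "sets \<nu> = sets borel"
  by (simp add: \<nu>_def)

lemma prob_\<nu>: "prob_space \<nu>"
  unfolding \<nu>_def by (rule prob_space_distr) measurable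

lemma nn_integral_Y: "f \<in> borel_measurable borel \<Longrightarrow> (\<integral>\<^sup>+\<omega>. f (Y t \<omega>) \<partial>M) = (\<integral>\<^sup>+z. f z \<partial>\<mu>)"
  unfolding distr_Y[of t, symmetric] by (rule nn_integral_distr[symmetric]) measurable

lemma distr_X: "distr M borel (X t) = \<nu>"
proof -
  have st: "distr M (PiM UNIV (\<lambda>_. borel)) (\<lambda>\<omega> s. X (s + t) \<omega>) = distr M (PiM UNIV (\<lambda>_. borel)) (\<lambda>\<omega> s. X s \<omega>)"
    using sol by (simp add: causal_stationary_solution_def strictly_stationary_def)
  have meas: "(\<lambda>\<omega> s. X (s + h) \<omega>) \<in> measurable M (PiM UNIV (\<lambda>_. borel))" for h
    by (rule measurable_PiM_single') auto
  have "distr M borel (X (0 + h)) = distr (distr M (PiM UNIV (\<lambda>_. borel)) (\<lambda>\<omega> s. X (s + h) \<omega>)) borel (\<lambda>x. x 0)" for h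
    by (subst distr_distr) (auto intro: meas simp: comp_def)
  from this[of t] this[of 0] show ?thesis
    using st by (simp add: \<nu>_def)
qed

lemma nn_integral_X: "f \<in> borel_measurable borel \<Longrightarrow> (\<integral>\<^sup>+\<omega>. f (X t \<omega>) \<partial>M) = (\<integral>\<^sup>+y. f y \<partial>\<nu>)"
  unfolding distr_X[of t, symmetric] by (rule nn_integral_distr[symmetric]) measurable

text \<open>
  Every use of independence goes through this lemma: an input that does not enter \<open>Z\<close> can be
  averaged out with \<open>Z\<close> held fixed.
\<close>

lemma nn_integral_fresh:
  assumes [measurable]: "Z \<in> measurable M S" "h \<in> measurable (PiM J (\<lambda>_. borel)) S"
    and [measurable]: "(\<lambda>x. F (fst x) (snd x)) \<in> borel_measurable (S \<Otimes>\<^sub>M borel)"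
    and t: "t \<notin> J" and Z: "AE \<omega> in M. Z \<omega> = h (restrict (\<lambda>i. Y i \<omega>) J)"
  shows "(\<integral>\<^sup>+\<omega>. F (Z \<omega>) (Y t \<omega>) \<partial>M) = (\<integral>\<^sup>+\<omega>. (\<integral>\<^sup>+z. F (Z \<omega>) z \<partial>\<mu>) \<partial>M)"
proof -
  interpret mu: prob_space \<mu> by (rule prob_\<mu>)
  let ?R = "\<lambda>\<omega>. restrict (\<lambda>i. Y i \<omega>) J"
  let ?P = "PiM J (\<lambda>_. borel :: ((real^'d^'d) \<times> (real^'d)) measure)"
  have [measurable]: "?R \<in> measurable M ?P"
    by (rule measurable_restrict) measurable
  let ?T = "PiM {t} (\<lambda>_. borel :: ((real^'d^'d) \<times> (real^'d)) measure)"
  let ?Rt = "\<lambda>\<omega>. restrict (\<lambda>i. Y i \<omega>) {t}"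
  have [measurable]: "?Rt \<in> measurable M ?T"
    by (rule measurable_restrict) measurable
  have FhP: "(\<lambda>x. F (h (fst x)) (snd x t)) \<in> borel_measurable (?P \<Otimes>\<^sub>M ?T)"
    by (rule measurable_compose[where f="\<lambda>x. (h (fst x), snd x t)", OF _ assms(3), simplified]) measurable
  note [measurable] = FhP
  have "indep_var ?P ?R ?T ?Rt"
    using t by (intro indep_var_restrict[OF indep_Y]) auto
  then have D: "distr M ?P ?R \<Otimes>\<^sub>M distr M ?T ?Rt = distr M (?P \<Otimes>\<^sub>M ?T) (\<lambda>\<omega>. (?R \<omega>, ?Rt \<omega>))"
    by (simp add: indep_var_distribution_eq)
  interpret T: prob_space "distr M ?T ?Rt" by (rule prob_space_distr) measurable
  have "(\<integral>\<^sup>+\<omega>. F (Z \<omega>) (Y t \<omega>) \<partial>M) = (\<integral>\<^sup>+\<omega>. F (h (?R \<omega>)) (Y t \<omega>) \<partial>M)"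
    using Z by (intro nn_integral_cong_AE) (auto elim!: eventually_mono)
  also have "\<dots> = (\<integral>\<^sup>+x. F (h (fst x)) (snd x t) \<partial>distr M (?P \<Otimes>\<^sub>M ?T) (\<lambda>\<omega>. (?R \<omega>, ?Rt \<omega>)))"
    by (subst nn_integral_distr) auto
  also have "\<dots> = (\<integral>\<^sup>+r. \<integral>\<^sup>+q. F (h r) (q t) \<partial>distr M ?T ?Rt \<partial>distr M ?P ?R)"
    unfolding D[symmetric] by (subst T.nn_integral_fst[symmetric]) auto
  also have "\<dots> = (\<integral>\<^sup>+\<omega>. (\<integral>\<^sup>+q. F (h (?R \<omega>)) (q t) \<partial>distr M ?T ?Rt) \<partial>M)"
    by (subst nn_integral_distr) auto
  also have "\<dots> = (\<integral>\<^sup>+\<omega>. (\<integral>\<^sup>+z. F (Z \<omega>) z \<partial>\<mu>) \<partial>M)"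
  proof (rule nn_integral_cong_AE, use Z in eventually_elim)
    fix \<omega> assume \<omega>: "Z \<omega> = h (?R \<omega>)"
    have "?R \<omega> \<in> space ?P" by (simp add: space_PiM)
    then have "h (?R \<omega>) \<in> space S" by (rule measurable_space[OF assms(2)])
    then have [measurable]: "F (h (?R \<omega>)) \<in> borel_measurable borel"
      by (intro measurable_compose[where f="\<lambda>z. (h (?R \<omega>), z)", OF _ assms(3), simplified]) measurable
    have "(\<integral>\<^sup>+q. F (h (?R \<omega>)) (q t) \<partial>distr M ?T ?Rt) = (\<integral>\<^sup>+\<omega>'. F (h (?R \<omega>)) (Y t \<omega>') \<partial>M)"
      by (subst nn_integral_distr) auto
    then show "(\<integral>\<^sup>+q. F (h (?R \<omega>)) (q t) \<partial>distr M ?T ?Rt) = (\<integral>\<^sup>+z. F (Z \<omega>) z \<partial>\<mu>)"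
      by (simp add: \<omega> nn_integral_Y)
  qed
  finally show ?thesis .
qed

lemma AE_mu_nonneg_entries: "AE z in \<mu>. mat_nonneg (fst z) \<and> vec_nonneg (snd z)"
proof -
  have "AE \<omega> in M. mat_nonneg (fst (Y 0 \<omega>)) \<and> vec_nonneg (snd (Y 0 \<omega>))"
    using nonneg by (simp add: nonneg_entries_def mat_nonneg_def vec_nonneg_def)
  then show ?thesis
    unfolding \<mu>_def by (subst AE_distr_iff) auto
qed

lemma matrix_law_mu: "matrix_law (distr \<mu> borel fst)"
proof -
  interpret mu: prob_space \<mu> by (rule prob_\<mu>)
  have "prob_space (distr \<mu> borel fst)" by (rule mu.prob_space_distr) measurable
  moreover have "AE a in distr \<mu> borel fst. mat_nonneg a"
    using AE_mu_nonneg_entries by (subst AE_distr_iff) auto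
  ultimately show ?thesis
    unfolding matrix_law_def matrix_law_axioms_def by simp
qed

sublocale m: matrix_law "distr \<mu> borel fst"
  by (rule matrix_law_mu)

lemma nn_integral_fst_mu:
  "f \<in> borel_measurable borel \<Longrightarrow> (\<integral>\<^sup>+a. f a \<partial>distr \<mu> borel fst) = (\<integral>\<^sup>+z. f (fst z) \<partial>\<mu>)"
  by (rule nn_integral_distr) measurable

lemma nn_integral_A: "f \<in> borel_measurable borel \<Longrightarrow> (\<integral>\<^sup>+\<omega>. f (A t \<omega>) \<partial>M) = (\<integral>\<^sup>+a. f a \<partial>distr \<mu> borel fst)"
  using nn_integral_Y[of "\<lambda>z. f (fst z)" t] by (simp add: nn_integral_fst_mu)

lemma left_prod_cong: "(\<And>k. 1 \<le> k \<Longrightarrow> k \<le> n \<Longrightarrow> a k = b k) \<Longrightarrow> left_prod a n = left_prod b n"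
  by (induction n) auto

lemma nn_integral_left_prod:
  "f \<in> borel_measurable borel \<Longrightarrow>
    (\<integral>\<^sup>+\<omega>. f (left_prod (\<lambda>k. A (int k) \<omega>) n) \<partial>M) = (\<integral>\<^sup>+a. f a \<partial>m.law n)"
proof (induction n arbitrary: f)
  case 0
  then show ?case by (simp add: emeasure_space_1)
next
  case (Suc n)
  note [measurable] = Suc.prems
  interpret mu: prob_space \<mu> by (rule prob_\<mu>)
  interpret pair_sigma_finite "m.law n" \<mu> ..
  let ?J = "{1..int n}"
  define h where "h r = left_prod (\<lambda>k. fst (r (int k))) n" for r :: "int \<Rightarrow> (real^'d^'d) \<times> (real^'d)"
  have "(\<lambda>r. left_prod (\<lambda>k. fst (r (int k))) l) \<in> borel_measurable (PiM ?J (\<lambda>_. borel :: ((real^'d^'d) \<times> (real^'d)) measure))"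
    if "l \<le> n" for l
    using that
  proof (induction l)
    case (Suc l)
    have 1: "(\<lambda>r. r (int (Suc l))) \<in> borel_measurable (PiM ?J (\<lambda>_. borel :: ((real^'d^'d) \<times> (real^'d)) measure))"
      using Suc.prems by (intro measurable_component_singleton) auto
    have 2: "(\<lambda>r. left_prod (\<lambda>k. fst (r (int k))) l) \<in> borel_measurable (PiM ?J (\<lambda>_. borel :: ((real^'d^'d) \<times> (real^'d)) measure))"
      using Suc by simp
    show ?case
      using measurable_matrix_mult[OF measurable_fst_borel[OF 1] 2] by simp
  qed simp
  then have h_meas: "h \<in> borel_measurable (PiM ?J (\<lambda>_. borel))"
    unfolding h_def by blast
  have meas: "(\<lambda>\<omega>. left_prod (\<lambda>k. A (int k) \<omega>) l) \<in> borel_measurable M" for l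
    by (induction l) auto
  have "(\<integral>\<^sup>+\<omega>. f (left_prod (\<lambda>k. A (int k) \<omega>) (Suc n)) \<partial>M)
      = (\<integral>\<^sup>+\<omega>. (\<lambda>b z. f (fst z ** b)) (left_prod (\<lambda>k. A (int k) \<omega>) n) (Y (int (Suc n)) \<omega>) \<partial>M)"
    by simp
  also have "\<dots> = (\<integral>\<^sup>+\<omega>. (\<integral>\<^sup>+z. f (fst z ** left_prod (\<lambda>k. A (int k) \<omega>) n) \<partial>\<mu>) \<partial>M)"
  proof (rule nn_integral_fresh[where h=h and J="?J"])
    show "AE \<omega> in M. left_prod (\<lambda>k. A (int k) \<omega>) n = h (\<lambda>i\<in>?J. Y i \<omega>)"
      unfolding h_def by (intro AE_I2 left_prod_cong) auto
  qed (use h_meas meas in auto)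
  also have "\<dots> = (\<integral>\<^sup>+b. (\<integral>\<^sup>+z. f (fst z ** b) \<partial>\<mu>) \<partial>m.law n)"
    by (rule Suc.IH) measurable
  also have "\<dots> = (\<integral>\<^sup>+z. \<integral>\<^sup>+b. f (fst z ** b) \<partial>m.law n \<partial>\<mu>)"
    by (rule Fubini'[symmetric]) (simp add: split_beta')
  also have "\<dots> = (\<integral>\<^sup>+a. f a \<partial>m.law (Suc n))"
    by (subst m.nn_integral_law_Suc') (auto simp: nn_integral_fst_mu)
  finally show ?case .
qed

subsection \<open>The moment and positivity conditions on the law of the inputs\<close>

lemma op_norm_measurable [measurable]: "op_norm N \<in> borel_measurable borel"
  by (intro is_norm_measurable is_norm_op_norm N)

lemma N_measurable [measurable]: "N \<in> borel_measurable borel"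
  by (intro is_norm_measurable N)

text \<open>
  Matrix multiplication is continuous, so a product of support points lies in the support of the law
  of the product.
\<close>

lemma law_open_pos:
  assumes "\<And>k. k \<in> {1..n} \<Longrightarrow> a k \<in> measure_support (distr M borel (A 0))"
    and "open W" "left_prod a n \<in> W"
  shows "0 < emeasure (m.law n) W"
  using assms
proof (induction n arbitrary: W)
  case 0
  then have [measurable]: "W \<in> sets borel" by simp
  have "emeasure (m.law 0) W = (\<integral>\<^sup>+a. indicator W a \<partial>m.law 0)" by simp
  also have "\<dots> = indicator W (mat 1)" by (rule m.nn_integral_law_0) measurable
  finally show ?case using 0 by simp
next
  case (Suc n)
  have [measurable]: "W \<in> sets borel" using Suc.prems by simp
  have dA: "distr M borel (A 0) = distr \<mu> borel fst"
    unfolding \<mu>_def by (subst distr_distr) (auto simp: comp_def)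
  let ?V = "(\<lambda>z::(real^'d^'d) \<times> (real^'d^'d). fst z ** snd z) -` W"
  have "open ?V"
    by (intro open_vimage Suc.prems continuous_intros)
  moreover have "(a (Suc n), left_prod a n) \<in> ?V"
    using Suc.prems by simp
  ultimately obtain U V where UV: "open U" "open V" "a (Suc n) \<in> U" "left_prod a n \<in> V" "U \<times> V \<subseteq> ?V"
    by (rule open_prod_elim) auto
  have [measurable]: "U \<in> sets borel" "V \<in> sets borel" using UV by auto
  have U: "0 < emeasure (distr \<mu> borel fst) U"
    using Suc.prems(1)[of "Suc n"] UV by (auto simp: measure_support_def dA)
  have V: "0 < emeasure (m.law n) V"
    using Suc.prems(1) UV by (intro Suc.IH) auto
  have "0 < emeasure (distr \<mu> borel fst) U * emeasure (m.law n) V"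
    using U V by (simp add: ennreal_zero_less_mult_iff)
  also have "\<dots> = (\<integral>\<^sup>+x. \<integral>\<^sup>+b. indicator U x * indicator V b \<partial>m.law n \<partial>distr \<mu> borel fst)"
    by (simp add: nn_integral_cmult nn_integral_multc)
  also have "\<dots> \<le> (\<integral>\<^sup>+x. \<integral>\<^sup>+b. indicator W (x ** b) \<partial>m.law n \<partial>distr \<mu> borel fst)"
    using UV(5) by (intro nn_integral_mono) (auto simp: indicator_def)
  also have "\<dots> = (\<integral>\<^sup>+x. indicator W x \<partial>m.law (Suc n))"
    by (rule m.nn_integral_law_Suc'[symmetric]) measurable
  finally show ?case by simp
qed

text \<open>
  The group generated by no logarithms at all is trivial and hence not dense. So some product of
  support points is entrywise positive, and positivity is an open condition.
\<close>

lemma positive_product: "\<exists>l s. 0 < s \<and> 0 < emeasure (m.law l) {D. \<forall>i j. s < D $ i $ j}"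
proof -
  let ?G = "{ln (op_norm N (left_prod a n)) | a n.
          1 \<le> n \<and> (\<forall>i j. 0 < left_prod a n $ i $ j) \<and>
          (\<forall>k\<in>{1..n}. a k \<in> measure_support (distr M borel (A 0)))}"
  have "?G \<noteq> {}"
  proof
    assume "?G = {}"
    then have "closure (group_closure {}) = (UNIV :: real set)"
      using K5 by (simp only: K5_def)
    moreover have "group_closure {} = {0::real}"
    proof -
      have "x = 0" if "x \<in> group_closure {}" for x :: real
        using that by (induction rule: group_closure.induct) auto
      then show ?thesis by (auto intro: group_closure.base)
    qed
    ultimately have "{0::real} = UNIV" by simp
    then show False by (metis UNIV_I singletonD zero_neq_one)
  qed
  then obtain a n where an: "\<And>i j. 0 < left_prod a n $ i $ j"
    "\<And>k. k \<in> {1..n} \<Longrightarrow> a k \<in> measure_support (distr M borel (A 0))"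
    by blast
  define s where "s = Min (range (\<lambda>ij. left_prod a n $ fst ij $ snd ij)) / 2"
  have fin: "finite (range (\<lambda>ij. left_prod a n $ fst ij $ snd ij))" by simp
  have s: "0 < s" using an(1) by (simp add: s_def)
  have less: "s < left_prod a n $ i $ j" for i j
  proof -
    have "2 * s \<le> left_prod a n $ i $ j"
      unfolding s_def using Min_le[OF fin rangeI[of _ "(i, j)"]] by simp
    then show ?thesis using s by simp
  qed
  have "open {D::real^'d^'d. \<forall>i j. s < D $ i $ j}"
  proof -
    have "{D::real^'d^'d. \<forall>i j. s < D $ i $ j} = (\<Inter>i. \<Inter>j. {D. s < D $ i $ j})" by auto
    also have "open \<dots>" by (intro open_INT open_Collect_less continuous_intros ballI finite)
    finally show ?thesis .
  qed
  then have "0 < emeasure (m.law n) {D. \<forall>i j. s < D $ i $ j}"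
    using an(2) less by (intro law_open_pos[where a=a]) auto
  then show ?thesis using s by blast
qed

lemma op_norm_equiv: "\<exists>K\<ge>1. \<forall>a. mnorm a \<le> K * op_norm N a \<and> op_norm N a \<le> K * mnorm a"
proof -
  obtain c1 where c1: "c1 > 0" "\<And>a. mnorm a \<le> c1 * op_norm N a"
    using is_norm_le[OF is_norm_mnorm is_norm_op_norm[OF N]] by blast
  obtain c2 where c2: "c2 > 0" "\<And>a. op_norm N a \<le> c2 * mnorm a"
    using is_norm_le[OF is_norm_op_norm[OF N] is_norm_mnorm] by blast
  define K where "K = max 1 (max c1 c2)"
  have "mnorm a \<le> K * op_norm N a" for a
    using c1(2)[of a] by (rule order_trans) (auto simp: K_def intro!: mult_right_mono op_norm_nonneg N)
  moreover have "op_norm N a \<le> K * mnorm a" for a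
    using c2(2)[of a] by (rule order_trans) (auto simp: K_def intro!: mult_right_mono)
  ultimately show ?thesis by (intro exI[of _ K]) (auto simp: K_def)
qed

lemma some_decay: "\<exists>\<kappa>>0. \<exists>C>0. \<exists>\<rho>. 0 < \<rho> \<and> \<rho> < 1 \<and> (\<forall>n. m.mom \<kappa> n \<le> ennreal (C * \<rho> ^ n))"
proof -
  obtain \<kappa> where \<kappa>: "\<kappa> > 0" "(\<integral>\<^sup>+\<omega>. ennreal (op_norm N (A 0 \<omega>) powr \<kappa>) \<partial>M) < 1"
    using K4 by (auto simp: K4_def)
  obtain K where K: "K \<ge> 1" "\<And>a. mnorm a \<le> K * op_norm N a"
    using op_norm_equiv by blast
  let ?e = "\<integral>\<^sup>+a. ennreal (op_norm N a powr \<kappa>) \<partial>distr \<mu> borel fst"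
  have e: "?e < 1" using \<kappa> nn_integral_A[of "\<lambda>a. ennreal (op_norm N a powr \<kappa>)" 0] by simp
  then obtain r where r: "?e = ennreal r" "0 \<le> r" "r < 1"
    by (cases ?e) (auto simp: ennreal_less_one_iff)
  define \<rho> where "\<rho> = max r (1/2)"
  have \<rho>: "0 < \<rho>" "\<rho> < 1" "?e \<le> ennreal \<rho>" using r by (auto simp: \<rho>_def intro!: ennreal_leI)
  have op: "(\<integral>\<^sup>+a. ennreal (op_norm N a powr \<kappa>) \<partial>m.law n) \<le> ennreal (\<rho> ^ n)" for n
  proof (induction n)
    case 0
    show ?case by (simp add: op_norm_one[OF N])
  next
    case (Suc n)
    have "(\<integral>\<^sup>+a. ennreal (op_norm N a powr \<kappa>) \<partial>m.law (Suc n)) = (\<integral>\<^sup>+a. \<integral>\<^sup>+b. ennreal (op_norm N (a ** b) powr \<kappa>) \<partial>distr \<mu> borel fst \<partial>m.law n)"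
      by (rule m.nn_integral_law_Suc) measurable
    also have "\<dots> \<le> (\<integral>\<^sup>+a. \<integral>\<^sup>+b. ennreal (op_norm N a powr \<kappa>) * ennreal (op_norm N b powr \<kappa>) \<partial>distr \<mu> borel fst \<partial>m.law n)"
      using \<kappa> by (intro nn_integral_mono)
        (auto simp: ennreal_mult[symmetric] powr_mult[symmetric] intro!: ennreal_leI powr_mono2 op_norm_mult op_norm_nonneg N)
    also have "\<dots> = (\<integral>\<^sup>+a. ennreal (op_norm N a powr \<kappa>) \<partial>m.law n) * ?e"
      by (simp add: nn_integral_cmult nn_integral_multc)
    also have "\<dots> \<le> ennreal (\<rho> ^ n) * ennreal \<rho>"
      by (intro mult_mono Suc \<rho>) auto
    finally show ?case using \<rho> by (simp add: ennreal_mult[symmetric] mult.commute)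
  qed
  have "m.mom \<kappa> n \<le> ennreal (K powr \<kappa> * \<rho> ^ n)" for n
  proof -
    have "m.mom \<kappa> n \<le> (\<integral>\<^sup>+a. ennreal (K powr \<kappa>) * ennreal (op_norm N a powr \<kappa>) \<partial>m.law n)"
      unfolding m.mom_def using K \<kappa>
      by (intro nn_integral_mono) (auto simp: ennreal_mult[symmetric] powr_mult[symmetric] intro!: ennreal_leI powr_mono2)
    also have "\<dots> = ennreal (K powr \<kappa>) * (\<integral>\<^sup>+a. ennreal (op_norm N a powr \<kappa>) \<partial>m.law n)"
      by (simp add: nn_integral_cmult)
    also have "\<dots> \<le> ennreal (K powr \<kappa>) * ennreal (\<rho> ^ n)"
      by (intro mult_left_mono op) auto
    finally show ?thesis using \<rho> by (simp add: ennreal_mult)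
  qed
  moreover have "K powr \<kappa> > 0" using K by simp
  ultimately show ?thesis using \<kappa> \<rho> by blast
qed

lemma \<alpha>_pos: "0 < \<alpha>"
  using K7 by (simp add: K7_def)

lemma ext_log_bounds:
  fixes e :: ennreal
  assumes "- \<delta> < ext_log e / ereal n" "ext_log e / ereal n < \<delta>" "0 < n"
  shows "ennreal (exp (- \<delta> * n)) \<le> e \<and> e \<le> ennreal (exp (\<delta> * n))"
proof (cases e)
  case (real r)
  have "r \<noteq> 0" using assms real by (auto simp: ext_log_def)
  then have r: "r > 0" using real by simp
  then have "ext_log e / ereal n = ereal (ln r / n)"
    using real assms by (simp add: ext_log_def)
  then have "- \<delta> < ln r / n" "ln r / n < \<delta>" using assms by auto
  then have "- \<delta> * n \<le> ln r" "ln r \<le> \<delta> * n" using assms(3) by (auto simp: field_simps)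
  then have "exp (- \<delta> * n) \<le> exp (ln r)" "exp (ln r) \<le> exp (\<delta> * n)" by simp_all
  then show ?thesis using r real by (simp add: ennreal_leI)
next
  case top
  then show ?thesis using assms by (simp add: ext_log_def)
qed

text \<open>
  Passing from the operator norm to entry sums costs a constant factor, which any exponential absorbs.
\<close>

lemma subexponential:
  assumes \<delta>: "0 < \<delta>"
  shows "\<forall>\<^sub>F n in sequentially. ennreal (exp (- \<delta> * real n)) \<le> m.mom \<alpha> n \<and> m.mom \<alpha> n \<le> ennreal (exp (\<delta> * real n))"
proof -
  obtain K where K: "K \<ge> 1" "\<And>a. mnorm a \<le> K * op_norm N a" "\<And>a. op_norm N a \<le> K * mnorm a"
    using op_norm_equiv by blast
  define e where "e n = (\<integral>\<^sup>+a. ennreal (op_norm N a powr \<alpha>) \<partial>m.law n)" for n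
  have "(\<lambda>n. ext_log (e n) / ereal (real n)) \<longlonglongrightarrow> 0"
    using K7 unfolding K7_def e_def by (simp add: nn_integral_left_prod[of "\<lambda>a. ennreal (op_norm N a powr \<alpha>)"])
  then have "\<forall>\<^sub>F n in sequentially. - ereal (\<delta> / 2) < ext_log (e n) / ereal (real n)"
    "\<forall>\<^sub>F n in sequentially. ext_log (e n) / ereal (real n) < ereal (\<delta> / 2)"
    using \<delta> by (auto intro: order_tendstoD)
  moreover have "\<forall>\<^sub>F n in sequentially. max 1 (2 * \<alpha> * ln K / \<delta>) \<le> real n"
    using filterlim_real_sequentially unfolding filterlim_at_top by blast
  ultimately show ?thesis
  proof eventually_elim
    case (elim n)
    have n: "real n \<ge> 1" "\<alpha> * ln K \<le> \<delta> / 2 * real n" using elim \<delta> by (auto simp: field_simps)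
    have e: "ennreal (exp (- (\<delta> / 2) * real n)) \<le> e n" "e n \<le> ennreal (exp ((\<delta> / 2) * real n))"
      using ext_log_bounds[of "\<delta> / 2" "e n" "real n"] elim n by auto
    have Ka: "K powr \<alpha> \<le> exp (\<delta> / 2 * real n)" using K n by (simp add: powr_def)
    have scale: "(\<integral>\<^sup>+a. ennreal (f a powr \<alpha>) \<partial>m.law n) \<le> ennreal (K powr \<alpha>) * (\<integral>\<^sup>+a. ennreal (g a powr \<alpha>) \<partial>m.law n)"
      if "\<And>a. f a \<le> K * g a" "\<And>a. 0 \<le> f a" "\<And>a. 0 \<le> g a" and [measurable]: "g \<in> borel_measurable borel" for f g
    proof -
      have "(\<integral>\<^sup>+a. ennreal (f a powr \<alpha>) \<partial>m.law n) \<le> (\<integral>\<^sup>+a. ennreal (K powr \<alpha>) * ennreal (g a powr \<alpha>) \<partial>m.law n)"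
        using that K \<alpha>_pos by (intro nn_integral_mono) (auto simp: ennreal_mult[symmetric] powr_mult[symmetric] intro!: ennreal_leI powr_mono2)
      then show ?thesis by (simp add: nn_integral_cmult)
    qed
    have "m.mom \<alpha> n \<le> ennreal (K powr \<alpha>) * e n"
      unfolding m.mom_def e_def using K by (intro scale) (auto intro: op_norm_nonneg N)
    also have "\<dots> \<le> ennreal (exp (\<delta> / 2 * real n)) * ennreal (exp ((\<delta> / 2) * real n))"
      by (intro mult_mono e ennreal_leI Ka) auto
    also have "\<dots> = ennreal (exp (\<delta> * real n))"
      by (simp add: ennreal_mult[symmetric] exp_add[symmetric])
    finally have up: "m.mom \<alpha> n \<le> ennreal (exp (\<delta> * real n))" .
    have "ennreal (exp (\<delta> / 2 * real n)) * ennreal (exp (- \<delta> * real n)) = ennreal (exp (- (\<delta> / 2) * real n))"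
      by (simp add: ennreal_mult[symmetric] exp_add[symmetric] algebra_simps)
    also have "\<dots> \<le> e n" by (rule e)
    also have "\<dots> \<le> ennreal (K powr \<alpha>) * m.mom \<alpha> n"
      unfolding m.mom_def e_def using K by (intro scale) (auto intro: op_norm_nonneg N)
    also have "\<dots> \<le> ennreal (exp (\<delta> / 2 * real n)) * m.mom \<alpha> n"
      by (intro mult_right_mono ennreal_leI Ka) auto
    finally have "ennreal (exp (- \<delta> * real n)) \<le> m.mom \<alpha> n"
      by (subst (asm) ennreal_mult_le_mult_iff) auto
    with up show ?case by simp
  qed
qed

definition min_row_sum :: "real^'d^'d \<Rightarrow> real" where
  "min_row_sum a = (MIN i. \<Sum>j\<in>UNIV. a $ i $ j)"

lemma min_row_sum_le: "min_row_sum a \<le> (\<Sum>j\<in>UNIV. a $ i $ j)"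
  unfolding min_row_sum_def by (intro Min_le) auto

lemma min_row_sum_geI: "(\<And>i. c \<le> (\<Sum>j\<in>UNIV. a $ i $ j)) \<Longrightarrow> c \<le> min_row_sum a"
  unfolding min_row_sum_def by (subst Min_ge_iff) auto

lemma measurable_min_row_sum [measurable]: "min_row_sum \<in> borel_measurable borel"
  unfolding min_row_sum_def by (intro borel_measurable_Min) auto

lemma min_row_sum_nonneg: "mat_nonneg a \<Longrightarrow> 0 \<le> min_row_sum a"
  by (intro min_row_sum_geI sum_nonneg) (auto simp: mat_nonneg_def)

lemma min_row_sum_le_mnorm: "min_row_sum a \<le> mnorm a"
proof -
  have "min_row_sum a \<le> (\<Sum>j\<in>UNIV. a $ undefined $ j)" by (rule min_row_sum_le)
  also have "\<dots> \<le> (\<Sum>j\<in>UNIV. \<bar>a $ undefined $ j\<bar>)" by (intro sum_mono) auto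
  also have "\<dots> \<le> mnorm a"
    unfolding mnorm_def by (rule member_le_sum[where f="\<lambda>i. \<Sum>j\<in>UNIV. \<bar>a $ i $ j\<bar>"]) (auto intro: sum_nonneg)
  finally show ?thesis .
qed

lemma min_row_sum_mult:
  assumes "mat_nonneg a" "mat_nonneg b"
  shows "min_row_sum a * min_row_sum b \<le> min_row_sum (a ** b)"
proof (rule min_row_sum_geI)
  fix i
  have "min_row_sum a * min_row_sum b \<le> (\<Sum>k\<in>UNIV. a $ i $ k) * min_row_sum b"
    using assms by (intro mult_right_mono min_row_sum_le min_row_sum_nonneg)
  also have "\<dots> \<le> (\<Sum>k\<in>UNIV. a $ i $ k * (\<Sum>j\<in>UNIV. b $ k $ j))"
    unfolding sum_distrib_right using assms
    by (intro sum_mono mult_left_mono min_row_sum_le) (auto simp: mat_nonneg_def)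
  also have "\<dots> = (\<Sum>k\<in>UNIV. \<Sum>j\<in>UNIV. a $ i $ k * b $ k $ j)"
    by (simp add: sum_distrib_left)
  also have "\<dots> = (\<Sum>j\<in>UNIV. (a ** b) $ i $ j)"
    unfolding matrix_matrix_mult_def by (subst sum.swap) simp
  finally show "min_row_sum a * min_row_sum b \<le> (\<Sum>j\<in>UNIV. (a ** b) $ i $ j)" .
qed

text \<open>
  Minimal row sums of non-negative matrices are supermultiplicative. Thus the row sum condition
  makes the moments of order \<open>\<kappa>\<close> of all products at least one, which forces \<open>\<kappa>\<close> not to lie below
  the critical exponent.
\<close>

lemma large_moment:
  "\<exists>\<kappa>>0. (\<forall>n. 1 \<le> m.mom \<kappa> n) \<and> (\<integral>\<^sup>+a. ennreal (mnorm a powr \<kappa> * max 0 (ln (mnorm a))) \<partial>distr \<mu> borel fst) < \<infinity>"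
proof -
  obtain \<kappa> where \<kappa>: "\<kappa> > 0"
    and low: "(\<integral>\<^sup>+\<omega>. ennreal (min_row_sum (A 0 \<omega>) powr \<kappa>) \<partial>M) \<ge> ennreal (real CARD('d) powr (\<kappa> / 2))"
    and logm: "(\<integral>\<^sup>+\<omega>. ennreal (op_norm N (A 0 \<omega>) powr \<kappa> * log_plus (op_norm N (A 0 \<omega>))) \<partial>M) < \<infinity>"
    using K6 by (auto simp: K6_def min_row_sum_def)
  have "real CARD('d) \<ge> 1"
    by (metis One_nat_def Suc_leI of_nat_1 of_nat_mono zero_less_card_finite)
  then have "real CARD('d) powr (\<kappa> / 2) \<ge> 1" using \<kappa> by (intro ge_one_powr_ge_zero) auto
  then have "1 \<le> ennreal (real CARD('d) powr (\<kappa> / 2))" by simp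
  also note low
  also have "(\<integral>\<^sup>+\<omega>. ennreal (min_row_sum (A 0 \<omega>) powr \<kappa>) \<partial>M) = (\<integral>\<^sup>+a. ennreal (min_row_sum a powr \<kappa>) \<partial>distr \<mu> borel fst)"
    by (rule nn_integral_A) measurable
  finally have one: "1 \<le> (\<integral>\<^sup>+a. ennreal (min_row_sum a powr \<kappa>) \<partial>distr \<mu> borel fst)" .
  have row: "1 \<le> (\<integral>\<^sup>+a. ennreal (min_row_sum a powr \<kappa>) \<partial>m.law n)" for n
  proof (induction n)
    case 0
    have "1 \<le> min_row_sum (mat 1)"
      by (rule min_row_sum_geI) (simp add: mat_def)
    then show ?case using \<kappa> by (simp add: ge_one_powr_ge_zero)
  next
    case (Suc n)
    have "1 * 1 \<le> (\<integral>\<^sup>+a. ennreal (min_row_sum a powr \<kappa>) \<partial>m.law n) * (\<integral>\<^sup>+a. ennreal (min_row_sum a powr \<kappa>) \<partial>distr \<mu> borel fst)"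
      by (intro mult_mono Suc one) auto
    also have "\<dots> = (\<integral>\<^sup>+a. \<integral>\<^sup>+b. ennreal (min_row_sum a powr \<kappa>) * ennreal (min_row_sum b powr \<kappa>) \<partial>distr \<mu> borel fst \<partial>m.law n)"
      by (simp add: nn_integral_cmult nn_integral_multc)
    also have "\<dots> \<le> (\<integral>\<^sup>+a. \<integral>\<^sup>+b. ennreal (min_row_sum (a ** b) powr \<kappa>) \<partial>distr \<mu> borel fst \<partial>m.law n)"
    proof (rule nn_integral_mono_AE)
      show "AE a in m.law n. (\<integral>\<^sup>+b. ennreal (min_row_sum a powr \<kappa>) * ennreal (min_row_sum b powr \<kappa>) \<partial>distr \<mu> borel fst) \<le> (\<integral>\<^sup>+b. ennreal (min_row_sum (a ** b) powr \<kappa>) \<partial>distr \<mu> borel fst)"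
        using m.AE_law_nonneg[of n]
      proof eventually_elim
        case (elim a)
        show ?case
        proof (rule nn_integral_mono_AE, use m.nonneg_m in eventually_elim)
          fix b :: "real^'d^'d" assume b: "mat_nonneg b"
          then show "ennreal (min_row_sum a powr \<kappa>) * ennreal (min_row_sum b powr \<kappa>) \<le> ennreal (min_row_sum (a ** b) powr \<kappa>)"
            using elim \<kappa> by (auto simp: ennreal_mult[symmetric] powr_mult[symmetric]
                intro!: ennreal_leI powr_mono2 min_row_sum_mult mult_nonneg_nonneg min_row_sum_nonneg)
        qed
      qed
    qed
    also have "\<dots> = (\<integral>\<^sup>+a. ennreal (min_row_sum a powr \<kappa>) \<partial>m.law (Suc n))"
      by (rule m.nn_integral_law_Suc[symmetric]) measurable
    finally show ?case by simp
  qed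
  have "1 \<le> m.mom \<kappa> n" for n
  proof -
    have "(\<integral>\<^sup>+a. ennreal (min_row_sum a powr \<kappa>) \<partial>m.law n) \<le> m.mom \<kappa> n"
      unfolding m.mom_def using m.AE_law_nonneg[of n] \<kappa>
      by (intro nn_integral_mono_AE) (auto elim!: eventually_mono intro!: ennreal_leI powr_mono2 min_row_sum_nonneg min_row_sum_le_mnorm)
    with row[of n] show ?thesis by (rule order_trans)
  qed
  moreover have "(\<integral>\<^sup>+a. ennreal (mnorm a powr \<kappa> * max 0 (ln (mnorm a))) \<partial>distr \<mu> borel fst) < \<infinity>"
  proof -
    obtain K where K: "K \<ge> 1" "\<And>a. mnorm a \<le> K * op_norm N a"
      using op_norm_equiv by blast
    define c where "c = K powr \<kappa> * (1 + ln K)"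
    have c: "0 \<le> c" using K by (simp add: c_def)
    have logfin: "(\<integral>\<^sup>+a. ennreal (op_norm N a powr \<kappa> * log_plus (op_norm N a)) \<partial>distr \<mu> borel fst) < \<infinity>"
      using logm by (subst nn_integral_A[symmetric]) (auto simp: log_plus_def)
    have pw: "mnorm a powr \<kappa> * max 0 (ln (mnorm a)) \<le> c * exp \<kappa> + c * 2 * (op_norm N a powr \<kappa> * log_plus (op_norm N a))" for a
    proof -
      let ?o = "op_norm N a"
      have o: "0 \<le> ?o" by (rule op_norm_nonneg[OF N])
      have a1: "mnorm a powr \<kappa> \<le> K powr \<kappa> * ?o powr \<kappa>"
        using \<kappa> K by (subst powr_mult[symmetric]) (auto intro!: powr_mono2)
      have a2: "max 0 (ln (mnorm a)) \<le> (1 + ln K) * (1 + log_plus ?o)"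
      proof (cases "1 < mnorm a")
        case True
        have op: "0 < ?o"
        proof (rule ccontr)
          assume "\<not> 0 < ?o"
          then have "?o = 0" using o by simp
          then show False using K(2)[of a] True by simp
        qed
        have "ln (mnorm a) \<le> ln (K * ?o)" using True K(2)[of a] by simp
        also have "\<dots> = ln K + ln ?o" using K op by (simp add: ln_mult)
        also have "\<dots> \<le> (1 + ln K) + log_plus ?o" by (simp add: log_plus_def)
        also have "\<dots> \<le> (1 + ln K) * (1 + log_plus ?o)" using K by (simp add: log_plus_def algebra_simps)
        finally show ?thesis using True K by (simp add: log_plus_def)
      next
        case False
        have "ln (mnorm a) \<le> 0"
        proof (cases "mnorm a = 0")
          case nz: False
          then have "0 < mnorm a" using mnorm_nonneg[of a] by linarith
          then show ?thesis using False by simp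
        qed simp
        then show ?thesis using K by (simp add: log_plus_def)
      qed
      have a3: "?o powr \<kappa> * (1 + log_plus ?o) \<le> exp \<kappa> + 2 * (?o powr \<kappa> * log_plus ?o)"
      proof (cases "?o \<le> exp 1")
        case True
        have "?o powr \<kappa> \<le> exp 1 powr \<kappa>" using True o \<kappa> by (intro powr_mono2) auto
        then have "?o powr \<kappa> \<le> exp \<kappa>" by (simp add: powr_def)
        moreover have "0 \<le> ?o powr \<kappa> * log_plus ?o" by (simp add: log_plus_def)
        ultimately show ?thesis by (simp add: algebra_simps)
      next
        case False
        then have "1 \<le> ln ?o" by (metis exp_gt_zero ln_exp ln_le_cancel_iff linear order_less_le_trans)
        then have "1 \<le> log_plus ?o" by (simp add: log_plus_def)
        then have "?o powr \<kappa> * 1 \<le> ?o powr \<kappa> * log_plus ?o" by (intro mult_left_mono) auto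
        then show ?thesis by (simp add: algebra_simps add_increasing)
      qed
      have "mnorm a powr \<kappa> * max 0 (ln (mnorm a)) \<le> (K powr \<kappa> * ?o powr \<kappa>) * ((1 + ln K) * (1 + log_plus ?o))"
        by (intro mult_mono a1 a2) auto
      also have "\<dots> = c * (?o powr \<kappa> * (1 + log_plus ?o))" by (simp add: c_def)
      also have "\<dots> \<le> c * (exp \<kappa> + 2 * (?o powr \<kappa> * log_plus ?o))" by (intro mult_left_mono a3 c)
      finally show ?thesis by (simp add: algebra_simps)
    qed
    have "(\<integral>\<^sup>+a. ennreal (mnorm a powr \<kappa> * max 0 (ln (mnorm a))) \<partial>distr \<mu> borel fst)
      \<le> (\<integral>\<^sup>+a. ennreal (c * exp \<kappa>) + ennreal (c * 2) * ennreal (op_norm N a powr \<kappa> * log_plus (op_norm N a)) \<partial>distr \<mu> borel fst)"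
    proof (intro nn_integral_mono)
      fix a :: "real^'d^'d"
      have l0: "0 \<le> op_norm N a powr \<kappa> * log_plus (op_norm N a)" by (simp add: log_plus_def)
      show "ennreal (mnorm a powr \<kappa> * max 0 (ln (mnorm a))) \<le> ennreal (c * exp \<kappa>) + ennreal (c * 2) * ennreal (op_norm N a powr \<kappa> * log_plus (op_norm N a))"
        using c l0 ennreal_leI[OF pw[of a]] by (simp add: ennreal_mult ennreal_plus)
    qed
    also have "\<dots> = ennreal (c * exp \<kappa>) + ennreal (c * 2) * (\<integral>\<^sup>+a. ennreal (op_norm N a powr \<kappa> * log_plus (op_norm N a)) \<partial>distr \<mu> borel fst)"
      by (simp add: nn_integral_add nn_integral_cmult m.emeasure_space_1[simplified] log_plus_def)
    also have "\<dots> < \<infinity>"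
      using logfin by (simp add: ennreal_mult_less_top)
    finally show ?thesis .
  qed
  ultimately show ?thesis using \<kappa> by blast
qed

lemma moment_B: "(\<integral>\<^sup>+z. ennreal (vnorm (snd z) powr \<alpha>) \<partial>\<mu>) < \<infinity>"
proof -
  obtain c where c: "c > 0" "\<And>y. vnorm y \<le> c * N y"
    using is_norm_le[OF is_norm_vnorm N] by blast
  have "(\<integral>\<^sup>+z. ennreal (vnorm (snd z) powr \<alpha>) \<partial>\<mu>) = (\<integral>\<^sup>+\<omega>. ennreal (vnorm (B 0 \<omega>) powr \<alpha>) \<partial>M)"
    using nn_integral_Y[of "\<lambda>z. ennreal (vnorm (snd z) powr \<alpha>)" 0] by simp
  also have "\<dots> \<le> (\<integral>\<^sup>+\<omega>. ennreal (c powr \<alpha>) * ennreal (N (B 0 \<omega>) powr \<alpha>) \<partial>M)"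
    using c \<alpha>_pos by (intro nn_integral_mono) (auto simp: ennreal_mult[symmetric] powr_mult[symmetric] intro!: ennreal_leI powr_mono2)
  also have "\<dots> = ennreal (c powr \<alpha>) * (\<integral>\<^sup>+\<omega>. ennreal (N (B 0 \<omega>) powr \<alpha>) \<partial>M)"
    by (rule nn_integral_cmult) measurable
  also have "\<dots> < \<infinity>"
    using K7 by (simp add: K7_def ennreal_mult_less_top)
  finally show ?thesis .
qed

lemma nonzero_B: "AE z in \<mu>. snd z \<noteq> 0"
  unfolding \<mu>_def using K3 by (subst AE_distr_iff) (auto simp: K3_def)

subsection \<open>The stationary solution\<close>

lemma X_rec: "AE \<omega> in M. X t \<omega> = A t \<omega> *v X (t - 1) \<omega> + B t \<omega>"
  using sol by (simp add: causal_stationary_solution_def)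

lemma X_past:
  assumes "s \<le> u"
  shows "\<exists>h\<in>measurable (PiM {..u} (\<lambda>_. borel)) borel. AE \<omega> in M. X s \<omega> = h (restrict (\<lambda>i. Y i \<omega>) {..u})"
proof -
  obtain f where f: "f \<in> borel_measurable (PiM (UNIV :: nat set) (\<lambda>_. borel))" "AE \<omega> in M. X s \<omega> = f (\<lambda>k. Y (s - int k) \<omega>)"
    using sol unfolding causal_stationary_solution_def causal_def by blast
  let ?h = "\<lambda>r. f (\<lambda>k::nat. r (s - int k))"
  have "(\<lambda>r k. r (s - int k)) \<in> measurable (PiM {..u} (\<lambda>_. borel :: ((real^'d^'d) \<times> (real^'d)) measure)) (PiM (UNIV :: nat set) (\<lambda>_. borel))"
  proof (rule measurable_PiM_single')
    fix k :: nat
    show "(\<lambda>r. r (s - int k)) \<in> borel_measurable (PiM {..u} (\<lambda>_. borel :: ((real^'d^'d) \<times> (real^'d)) measure))"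
      using assms by (intro measurable_component_singleton) auto
  qed auto
  then have "?h \<in> measurable (PiM {..u} (\<lambda>_. borel)) borel"
    using f(1) by (rule measurable_compose)
  moreover have "AE \<omega> in M. X s \<omega> = ?h (restrict (\<lambda>i. Y i \<omega>) {..u})"
    using f(2) assms by (auto elim!: eventually_mono simp: restrict_def)
  ultimately show ?thesis by (intro bexI[of _ ?h]) auto
qed

lemma nu_invariant:
  assumes [measurable]: "f \<in> borel_measurable borel"
  shows "(\<integral>\<^sup>+y. f y \<partial>\<nu>) = (\<integral>\<^sup>+y. \<integral>\<^sup>+z. f (fst z *v y + snd z) \<partial>\<mu> \<partial>\<nu>)"
proof -
  interpret mu: prob_space \<mu> by (rule prob_\<mu>)
  obtain h where h: "h \<in> measurable (PiM {..0} (\<lambda>_. borel)) borel" "AE \<omega> in M. X 0 \<omega> = h (restrict (\<lambda>i. Y i \<omega>) {..0})"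
    using X_past[of 0 0] by auto
  have "(\<integral>\<^sup>+y. f y \<partial>\<nu>) = (\<integral>\<^sup>+\<omega>. f (X 1 \<omega>) \<partial>M)"
    by (rule nn_integral_X[symmetric]) measurable
  also have "\<dots> = (\<integral>\<^sup>+\<omega>. (\<lambda>y z. f (fst z *v y + snd z)) (X 0 \<omega>) (Y 1 \<omega>) \<partial>M)"
    using X_rec[of 1] by (intro nn_integral_cong_AE) (auto elim!: eventually_mono)
  also have "\<dots> = (\<integral>\<^sup>+\<omega>. (\<integral>\<^sup>+z. f (fst z *v X 0 \<omega> + snd z) \<partial>\<mu>) \<partial>M)"
    by (rule nn_integral_fresh[where h=h and J="{..0}" and S=borel]) (use h in auto)
  also have "\<dots> = (\<integral>\<^sup>+y. \<integral>\<^sup>+z. f (fst z *v y + snd z) \<partial>\<mu> \<partial>\<nu>)"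
    by (rule nn_integral_X) measurable
  finally show ?thesis .
qed

lemma critical_affine_law: "critical_affine_law \<mu> \<alpha> \<nu>"
  by (intro critical_affine_law.intro critical_matrix_law.intro critical_matrix_law_axioms.intro
      critical_affine_law_axioms.intro matrix_law_mu \<alpha>_pos positive_product some_decay subexponential
      large_moment prob_\<mu> sets_\<mu> prob_\<nu> sets_\<nu> moment_B nonzero_B nu_invariant)
    (use AE_mu_nonneg_entries in auto)

sublocale c: critical_affine_law \<mu> \<alpha> \<nu>
  by (rule critical_affine_law)

text \<open>
  The Markov property: the next input is independent of the present and the past.
\<close>

lemma nn_integral_pair:
  assumes [measurable]: "f \<in> borel_measurable borel" and "g \<in> borel_measurable borel"
  shows "(\<integral>\<^sup>+\<omega>. f (X s \<omega>) * g (X (s + int j) \<omega>) \<partial>M) = (\<integral>\<^sup>+y. f y * (c.kern ^^ j) g y \<partial>\<nu>)"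
  using assms(2)
proof (induction j arbitrary: g)
  case 0
  then show ?case using nn_integral_X[of "\<lambda>y. f y * g y" s] by simp
next
  case (Suc j)
  note [measurable] = Suc.prems
  let ?u = "s + int j"
  obtain h1 where h1: "h1 \<in> measurable (PiM {..?u} (\<lambda>_. borel)) borel" "AE \<omega> in M. X s \<omega> = h1 (restrict (\<lambda>i. Y i \<omega>) {..?u})"
    using X_past[of s ?u] by auto
  obtain h2 where h2: "h2 \<in> measurable (PiM {..?u} (\<lambda>_. borel)) borel" "AE \<omega> in M. X ?u \<omega> = h2 (restrict (\<lambda>i. Y i \<omega>) {..?u})"
    using X_past[of ?u ?u] by auto
  note [measurable] = h1(1) h2(1)
  have "(\<integral>\<^sup>+\<omega>. f (X s \<omega>) * g (X (s + int (Suc j)) \<omega>) \<partial>M)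
      = (\<integral>\<^sup>+\<omega>. (\<lambda>x z. f (fst x) * g (fst z *v snd x + snd z)) (X s \<omega>, X ?u \<omega>) (Y (?u + 1) \<omega>) \<partial>M)"
    using X_rec[of "?u + 1"] by (intro nn_integral_cong_AE) (auto elim!: eventually_mono simp: add_ac)
  also have "\<dots> = (\<integral>\<^sup>+\<omega>. (\<integral>\<^sup>+z. f (fst (X s \<omega>, X ?u \<omega>)) * g (fst z *v snd (X s \<omega>, X ?u \<omega>) + snd z) \<partial>\<mu>) \<partial>M)"
  proof (rule nn_integral_fresh[where h="\<lambda>r. (h1 r, h2 r)" and J="{..?u}" and S="borel \<Otimes>\<^sub>M borel"])
    show "AE \<omega> in M. (X s \<omega>, X ?u \<omega>) = (h1 (\<lambda>i\<in>{..?u}. Y i \<omega>), h2 (\<lambda>i\<in>{..?u}. Y i \<omega>))"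
      using h1(2) h2(2) by eventually_elim simp
  qed auto
  also have "\<dots> = (\<integral>\<^sup>+\<omega>. f (X s \<omega>) * c.kern g (X ?u \<omega>) \<partial>M)"
    by (simp add: nn_integral_cmult c.kern_def)
  also have "\<dots> = (\<integral>\<^sup>+y. f y * (c.kern ^^ j) (c.kern g) y \<partial>\<nu>)"
    by (rule Suc.IH) measurable
  finally show ?case by (simp add: funpow_swap1)
qed

end

section \<open>Limits along the normalising sequence\<close>

lemma sum_power_dist_le:
  fixes \<rho> :: real and s n :: int
  assumes "0 < \<rho>" "\<rho> < 1"
  shows "(\<Sum>t=1..n. \<rho> ^ nat \<bar>s - t\<bar>) \<le> 2 / (1 - \<rho>)"
proof -
  have half: "(\<Sum>t\<in>T. \<rho> ^ f t) \<le> 1 / (1 - \<rho>)" if "finite T" "inj_on f T" for T :: "int set" and f :: "int \<Rightarrow> nat"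
  proof -
    have "(\<Sum>t\<in>T. \<rho> ^ f t) = (\<Sum>k\<in>f ` T. \<rho> ^ k)"
      using that by (simp add: sum.reindex)
    also have "\<dots> \<le> (\<Sum>k. \<rho> ^ k)"
      using assms that by (intro sum_le_suminf summable_geometric) auto
    also have "\<dots> = 1 / (1 - \<rho>)"
      using assms by (intro suminf_geometric) auto
    finally show ?thesis .
  qed
  have "(\<Sum>t=1..n. \<rho> ^ nat \<bar>s - t\<bar>) = (\<Sum>t\<in>{1..n} \<inter> {..s}. \<rho> ^ nat \<bar>s - t\<bar>) + (\<Sum>t\<in>{1..n} - {..s}. \<rho> ^ nat \<bar>s - t\<bar>)"
    by (rule sum.Int_Diff) simp
  also have "\<dots> \<le> 1 / (1 - \<rho>) + 1 / (1 - \<rho>)"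
    by (intro add_mono half) (auto simp: inj_on_def)
  finally show ?thesis by simp
qed

context affine_process
begin

lemma N_equiv: "\<exists>K\<ge>1. \<forall>y. vnorm y \<le> K * N y \<and> N y \<le> K * vnorm y"
proof -
  obtain c1 where c1: "c1 > 0" "\<And>y. vnorm y \<le> c1 * N y"
    using is_norm_le[OF is_norm_vnorm N] by blast
  obtain c2 where c2: "c2 > 0" "\<And>y. N y \<le> c2 * vnorm y"
    using is_norm_le[OF N is_norm_vnorm] by blast
  define K where "K = max 1 (max c1 c2)"
  have "vnorm y \<le> K * N y" for y
    by (rule order_trans[OF c1(2)], rule mult_right_mono, simp add: K_def, rule is_norm_nonneg[OF N])
  moreover have "N y \<le> K * vnorm y" for y
    using c2(2)[of y] by (rule order_trans) (auto simp: K_def intro!: mult_right_mono)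
  ultimately show ?thesis by (intro exI[of _ K]) (auto simp: K_def)
qed

lemma N_tail_ge: "\<exists>c>0. \<forall>u\<ge>1. c * u powr - \<alpha> \<le> \<P>(\<omega> in M. N (X t \<omega>) > u)"
proof -
  obtain K where K: "K \<ge> 1" "\<And>y. vnorm y \<le> K * N y"
    using N_equiv by blast
  obtain c where c: "c > 0" "\<And>x. x \<ge> 1 \<Longrightarrow> ennreal (c * x powr - \<alpha>) \<le> emeasure \<nu> {y. x < vnorm y}"
    using c.nu_tail_ge by blast
  have "c * K powr - \<alpha> * u powr - \<alpha> \<le> \<P>(\<omega> in M. N (X t \<omega>) > u)" if u: "u \<ge> 1" for u
  proof -
    have "1 * 1 \<le> K * u" using K u by (intro mult_mono) auto
    then have "ennreal (c * (K * u) powr - \<alpha>) \<le> emeasure \<nu> {y. K * u < vnorm y}"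
      by (intro c) simp
    also have "\<dots> = emeasure M {\<omega> \<in> space M. K * u < vnorm (X t \<omega>)}"
      unfolding distr_X[of t, symmetric] by (subst emeasure_distr) (auto intro!: arg_cong[where f="emeasure M"])
    also have "\<dots> \<le> emeasure M {\<omega> \<in> space M. N (X t \<omega>) > u}"
    proof (intro emeasure_mono subsetI)
      fix \<omega> assume w: "\<omega> \<in> {\<omega> \<in> space M. K * u < vnorm (X t \<omega>)}"
      then have "K * u < K * N (X t \<omega>)" using K(2)[of "X t \<omega>"] by simp
      then show "\<omega> \<in> {\<omega> \<in> space M. N (X t \<omega>) > u}" using K w by simp
    qed measurable
    finally show ?thesis
      using u K by (simp add: emeasure_eq_measure powr_mult mult.assoc)
  qed
  moreover have "c * K powr - \<alpha> > 0" using c K by simp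
  ultimately show ?thesis by blast
qed

lemma N_pair_le:
  "\<exists>C>0. \<exists>\<rho>. 0 < \<rho> \<and> \<rho> < 1 \<and> (\<forall>u>0. \<forall>s j.
     \<P>(\<omega> in M. N (X s \<omega>) > u \<and> N (X (s + int j) \<omega>) > u) \<le> C * \<rho> ^ j * u powr - \<alpha> + C * (u powr - \<alpha>)\<^sup>2)"
proof -
  obtain K where K: "K \<ge> 1" "\<And>y. N y \<le> K * vnorm y"
    using N_equiv by blast
  let ?g = "\<lambda>u (y::real^'d). if u < vnorm y then 1 else 0 :: ennreal"
  obtain C0 \<rho> where C0: "C0 > 0" "0 < \<rho>" "\<rho> < 1"
    and pair: "\<And>u j. u > 0 \<Longrightarrow> (\<integral>\<^sup>+y. ?g u y * (c.kern ^^ j) (?g u) y \<partial>\<nu>) \<le> ennreal (C0 * \<rho> ^ j * u powr - \<alpha> + C0 * (u powr - \<alpha>)\<^sup>2)"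
    using c.exceed_pair by blast
  define k where "k = K powr \<alpha>"
  have k: "k \<ge> 1" using K \<alpha>_pos by (auto simp: k_def ge_one_powr_ge_zero)
  have "\<P>(\<omega> in M. N (X s \<omega>) > u \<and> N (X (s + int j) \<omega>) > u) \<le> C0 * k\<^sup>2 * \<rho> ^ j * u powr - \<alpha> + C0 * k\<^sup>2 * (u powr - \<alpha>)\<^sup>2"
    if u: "u > 0" for u s j
  proof -
    define v where "v = u / K"
    have v: "v > 0" using u K by (simp add: v_def)
    have vN: "v < vnorm y" if "u < N y" for y
      using K(2)[of y] that K(1) by (simp add: v_def field_simps)
    have "emeasure M {\<omega> \<in> space M. N (X s \<omega>) > u \<and> N (X (s + int j) \<omega>) > u}
       = (\<integral>\<^sup>+\<omega>. indicator {\<omega> \<in> space M. N (X s \<omega>) > u \<and> N (X (s + int j) \<omega>) > u} \<omega> \<partial>M)"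
      by (rule nn_integral_indicator[symmetric]) measurable
    also have "\<dots> \<le> (\<integral>\<^sup>+\<omega>. ?g v (X s \<omega>) * ?g v (X (s + int j) \<omega>) \<partial>M)"
      by (intro nn_integral_mono) (auto simp: indicator_def vN)
    also have "\<dots> = (\<integral>\<^sup>+y. ?g v y * (c.kern ^^ j) (?g v) y \<partial>\<nu>)"
      by (rule nn_integral_pair) measurable
    also have "\<dots> \<le> ennreal (C0 * \<rho> ^ j * v powr - \<alpha> + C0 * (v powr - \<alpha>)\<^sup>2)"
      by (rule pair) fact
    finally have "\<P>(\<omega> in M. N (X s \<omega>) > u \<and> N (X (s + int j) \<omega>) > u) \<le> C0 * \<rho> ^ j * v powr - \<alpha> + C0 * (v powr - \<alpha>)\<^sup>2"
      using C0 by (subst (asm) emeasure_eq_measure) (subst (asm) ennreal_le_iff, auto)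
    also have "v powr - \<alpha> = k * u powr - \<alpha>"
      using u K by (simp add: v_def k_def powr_divide powr_minus field_simps)
    also have "C0 * \<rho> ^ j * (k * u powr - \<alpha>) + C0 * (k * u powr - \<alpha>)\<^sup>2 \<le> C0 * k\<^sup>2 * \<rho> ^ j * u powr - \<alpha> + C0 * k\<^sup>2 * (u powr - \<alpha>)\<^sup>2"
    proof (rule add_mono)
      have "k * 1 \<le> k * k" using k by (intro mult_left_mono) auto
      then have "C0 * \<rho> ^ j * u powr - \<alpha> * k \<le> C0 * \<rho> ^ j * u powr - \<alpha> * k\<^sup>2"
        using C0 by (intro mult_left_mono) (auto simp: power2_eq_square)
      then show "C0 * \<rho> ^ j * (k * u powr - \<alpha>) \<le> C0 * k\<^sup>2 * \<rho> ^ j * u powr - \<alpha>" by (simp add: mult_ac)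
    qed (simp add: power_mult_distrib)
    finally show ?thesis .
  qed
  moreover have "C0 * k\<^sup>2 > 0" using C0 k by simp
  ultimately show ?thesis using C0 by blast
qed

text \<open>
  Given a large value at time 1, a large value at time \<open>t\<close> is either inherited, with a probability
  that decays geometrically in \<open>t\<close>, or caused by later inputs, which costs another full tail.
\<close>

lemma exceed_after:
  "\<exists>D>0. \<exists>\<rho>. 0 < \<rho> \<and> \<rho> < 1 \<and> (\<forall>u\<ge>1. \<forall>s n. 1 \<le> s \<longrightarrow> s \<le> n \<longrightarrow>
     \<P>(\<omega> in M. block_max N X (int s) (int n) \<omega> > u \<bar> N (X 1 \<omega>) > u) \<le> D * (\<rho> ^ s + real n * u powr - \<alpha>))"
proof -
  obtain C \<rho> where C: "C > 0" "0 < \<rho>" "\<rho> < 1"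
    and pair: "\<And>u s j. u > 0 \<Longrightarrow> \<P>(\<omega> in M. N (X s \<omega>) > u \<and> N (X (s + int j) \<omega>) > u) \<le> C * \<rho> ^ j * u powr - \<alpha> + C * (u powr - \<alpha>)\<^sup>2"
    using N_pair_le by blast
  obtain c where c: "c > 0" "\<And>u. u \<ge> 1 \<Longrightarrow> c * u powr - \<alpha> \<le> \<P>(\<omega> in M. N (X 1 \<omega>) > u)"
    using N_tail_ge by blast
  define D where "D = C / c / \<rho> / (1 - \<rho>) + C / c"
  have D: "D > 0" using C c by (simp add: D_def add_pos_pos)
  have "\<P>(\<omega> in M. block_max N X (int s) (int n) \<omega> > u \<bar> N (X 1 \<omega>) > u) \<le> D * (\<rho> ^ s + real n * u powr - \<alpha>)"
    if u: "u \<ge> 1" and sn: "1 \<le> s" "s \<le> n" for u s n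
  proof -
    define U where "U = u powr - \<alpha>"
    have U: "U > 0" using u by (simp add: U_def)
    define E where "E t = {\<omega> \<in> space M. N (X 1 \<omega>) > u \<and> N (X (int t) \<omega>) > u}" for t :: nat
    have [measurable]: "E t \<in> sets M" for t unfolding E_def by measurable
    have Et: "prob (E t) \<le> C * \<rho> ^ (t - 1) * U + C * U\<^sup>2" if "t \<ge> 1" for t
      using pair[of u 1 "t - 1"] that u by (simp add: E_def U_def)
    have "\<P>(\<omega> in M. block_max N X (int s) (int n) \<omega> > u \<and> N (X 1 \<omega>) > u) \<le> prob (\<Union>t\<in>{s..n}. E t)"
    proof (intro finite_measure_mono subsetI)
      fix \<omega> assume w: "\<omega> \<in> {\<omega> \<in> space M. block_max N X (int s) (int n) \<omega> > u \<and> N (X 1 \<omega>) > u}"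
      then have "u < (MAX t\<in>{int s..int n}. N (X t \<omega>))" by (simp add: block_max_def)
      then obtain t where t: "t \<in> {int s..int n}" "u < N (X t \<omega>)"
        using sn by (subst (asm) Max_gr_iff) auto
      then have "nat t \<in> {s..n}" "int (nat t) = t" by auto
      then show "\<omega> \<in> (\<Union>t\<in>{s..n}. E t)"
        using t w by (intro UN_I[of "nat t"]) (auto simp: E_def)
    qed auto
    also have "\<dots> \<le> (\<Sum>t\<in>{s..n}. prob (E t))"
      by (rule finite_measure_subadditive_finite) auto
    also have "\<dots> \<le> (\<Sum>t\<in>{s..n}. C / \<rho> * U * \<rho> ^ t + C * U\<^sup>2)"
    proof (rule sum_mono)
      fix t assume t: "t \<in> {s..n}"
      then have "\<rho> ^ t = \<rho> * \<rho> ^ (t - 1)" using sn by (cases t) auto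
      then show "prob (E t) \<le> C / \<rho> * U * \<rho> ^ t + C * U\<^sup>2"
        using Et[of t] t sn C by (simp add: mult_ac)
    qed
    also have "\<dots> = C / \<rho> * U * (\<Sum>t\<in>{s..n}. \<rho> ^ t) + real (card {s..n}) * (C * U\<^sup>2)"
      by (simp add: sum.distrib sum_distrib_left)
    also have "\<dots> \<le> C / \<rho> * U * (\<rho> ^ s / (1 - \<rho>)) + real n * (C * U\<^sup>2)"
    proof (intro add_mono mult_left_mono mult_right_mono)
      have "(\<Sum>t\<in>{s..n}. \<rho> ^ t) = (\<rho> ^ s - \<rho> ^ Suc n) / (1 - \<rho>)"
        using sn C by (simp add: sum_gp)
      also have "\<dots> \<le> \<rho> ^ s / (1 - \<rho>)" using C by (intro divide_right_mono) auto
      finally show "(\<Sum>t\<in>{s..n}. \<rho> ^ t) \<le> \<rho> ^ s / (1 - \<rho>)" .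
    qed (use C U sn in auto)
    finally have num: "\<P>(\<omega> in M. block_max N X (int s) (int n) \<omega> > u \<and> N (X 1 \<omega>) > u)
       \<le> C / \<rho> * U * (\<rho> ^ s / (1 - \<rho>)) + real n * (C * U\<^sup>2)" .
    have "\<P>(\<omega> in M. block_max N X (int s) (int n) \<omega> > u \<bar> N (X 1 \<omega>) > u)
       \<le> (C / \<rho> * U * (\<rho> ^ s / (1 - \<rho>)) + real n * (C * U\<^sup>2)) / (c * U)"
      unfolding cond_prob_def using num c(2)[OF u] c(1) U C
      by (intro frac_le) (auto simp: U_def)
    also have "\<dots> = C / c / \<rho> / (1 - \<rho>) * \<rho> ^ s + C / c * (real n * U)"
      using U c C by (simp add: field_simps power2_eq_square)
    also have "\<dots> \<le> D * \<rho> ^ s + D * (real n * U)"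
      using C c U by (intro add_mono mult_right_mono) (auto simp: D_def)
    finally show ?thesis by (simp add: U_def algebra_simps)
  qed
  then show ?thesis using D C by blast
qed

text \<open>
  Chebyshev's inequality. As the covariances decay geometrically in the lag, the variance of the sum
  is of the order of \<open>n\<close> times a single bound.
\<close>

lemma trunc_sum_deviation:
  assumes p: "0 < p" "\<alpha> < 2 * p"
  shows "\<exists>C>0. \<forall>x>0. \<forall>e>0. \<forall>m\<ge>0. \<forall>a>0. \<forall>n::nat. (\<integral>\<^sup>+y. ennreal (trunc p x e y) \<partial>\<nu>) = ennreal m \<longrightarrow>
     \<P>(\<omega> in M. a \<le> \<bar>(\<Sum>t=1..int n. trunc p x e (X t \<omega>)) - real n * m\<bar>)
      \<le> C * real n * (m\<^sup>2 + e powr (2 * p - \<alpha>) * x powr - \<alpha>) / a\<^sup>2"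
proof -
  obtain C0 \<rho> where C0: "C0 > 0" "0 < \<rho>" "\<rho> < 1"
    and pair: "\<forall>x>0. \<forall>e>0. \<forall>m\<ge>0. \<forall>j. (\<integral>\<^sup>+y. ennreal (trunc p x e y) \<partial>\<nu>) = ennreal m \<longrightarrow>
     (\<integral>\<^sup>+y. ennreal (trunc p x e y) * (c.kern ^^ j) (\<lambda>y. ennreal (trunc p x e y)) y \<partial>\<nu>)
      \<le> ennreal (m\<^sup>2 + C0 * \<rho> ^ j * (m\<^sup>2 + e powr (2 * p - \<alpha>) * x powr - \<alpha>))"
    using c.trunc_pair_le[OF p] by (elim exE conjE) (rule that, assumption+)
  define C where "C = C0 * 2 / (1 - \<rho>)"
  have C: "C > 0" using C0 by (simp add: C_def)
  have "\<P>(\<omega> in M. a \<le> \<bar>(\<Sum>t=1..int n. trunc p x e (X t \<omega>)) - real n * m\<bar>)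
      \<le> C * real n * (m\<^sup>2 + e powr (2 * p - \<alpha>) * x powr - \<alpha>) / a\<^sup>2"
    if x: "x > 0" and e: "e > 0" and a: "a > 0" and m: "m \<ge> 0" "(\<integral>\<^sup>+y. ennreal (trunc p x e y) \<partial>\<nu>) = ennreal m" for x e m a n
  proof -
    define Q where "Q = m\<^sup>2 + e powr (2 * p - \<alpha>) * x powr - \<alpha>"
    have Q: "0 \<le> Q" by (simp add: Q_def)
    define g where "g t \<omega> = trunc p x e (X t \<omega>)" for t \<omega>
    have [measurable]: "g t \<in> borel_measurable M" for t unfolding g_def by measurable
    have g0: "0 \<le> g t \<omega>" and gb: "g t \<omega> \<le> e powr p" for t \<omega>
      using p x e by (auto simp: g_def intro: trunc_le)
    have int_g: "integrable M (g t)" for t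
      using g0 gb by (intro integrable_const_bound[where B="e powr p"]) auto
    have int_gg: "integrable M (\<lambda>\<omega>. g s \<omega> * g t \<omega>)" for s t
    proof (rule integrable_const_bound[where B="e powr p * e powr p"])
      show "AE \<omega> in M. norm (g s \<omega> * g t \<omega>) \<le> e powr p * e powr p"
        using g0 gb by (auto simp: abs_mult intro!: AE_I2 mult_mono)
    qed measurable
    have Eg: "expectation (g t) = m" for t
    proof -
      have "ennreal (expectation (g t)) = (\<integral>\<^sup>+\<omega>. ennreal (g t \<omega>) \<partial>M)"
        using g0 by (intro nn_integral_eq_integral[symmetric] int_g) auto
      also have "\<dots> = ennreal m"
        unfolding g_def m(2)[symmetric] by (rule nn_integral_X) measurable
      finally show ?thesis using m g0 by (simp add: ennreal_inj integral_nonneg)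
    qed
    have Egg': "expectation (\<lambda>\<omega>. g s \<omega> * g (s + int j) \<omega>) \<le> m\<^sup>2 + C0 * \<rho> ^ j * Q" for s j
    proof -
      have "ennreal (expectation (\<lambda>\<omega>. g s \<omega> * g (s + int j) \<omega>)) = (\<integral>\<^sup>+\<omega>. ennreal (g s \<omega> * g (s + int j) \<omega>) \<partial>M)"
        using g0 by (intro nn_integral_eq_integral[symmetric] int_gg) auto
      also have "\<dots> = (\<integral>\<^sup>+\<omega>. ennreal (trunc p x e (X s \<omega>)) * ennreal (trunc p x e (X (s + int j) \<omega>)) \<partial>M)"
        by (simp add: g_def ennreal_mult)
      also have "\<dots> = (\<integral>\<^sup>+y. ennreal (trunc p x e y) * (c.kern ^^ j) (\<lambda>y. ennreal (trunc p x e y)) y \<partial>\<nu>)"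
        by (rule nn_integral_pair) measurable
      also have "\<dots> \<le> ennreal (m\<^sup>2 + C0 * \<rho> ^ j * Q)"
        unfolding Q_def by (intro pair[rule_format] x e m)
      finally show ?thesis using C0 Q by (subst (asm) ennreal_le_iff) auto
    qed
    have Egg: "expectation (\<lambda>\<omega>. g s \<omega> * g t \<omega>) \<le> m\<^sup>2 + C0 * \<rho> ^ nat \<bar>s - t\<bar> * Q" for s t
    proof (cases "s \<le> t")
      case True
      then have "s + int (nat (t - s)) = t" "nat \<bar>s - t\<bar> = nat (t - s)" by auto
      then show ?thesis using Egg'[of s "nat (t - s)"] by simp
    next
      case False
      then have "t + int (nat (s - t)) = s" "nat \<bar>s - t\<bar> = nat (s - t)" by auto
      then show ?thesis using Egg'[of t "nat (s - t)"] by (simp add: mult.commute)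
    qed
    define S where "S \<omega> = (\<Sum>t=1..int n. g t \<omega>)" for \<omega>
    have [measurable]: "S \<in> borel_measurable M" unfolding S_def by measurable
    have S2: "(S \<omega>)\<^sup>2 = (\<Sum>s=1..int n. \<Sum>t=1..int n. g s \<omega> * g t \<omega>)" for \<omega>
      by (simp add: S_def power2_eq_square sum_product)
    have int_S2: "integrable M (\<lambda>\<omega>. (S \<omega>)\<^sup>2)"
      unfolding S2 by (intro Bochner_Integration.integrable_sum int_gg)
    have int_S: "integrable M S"
      unfolding S_def by (intro Bochner_Integration.integrable_sum int_g)
    have ES: "expectation S = real n * m"
      unfolding S_def by (simp add: int_g Eg)
    have "expectation (\<lambda>\<omega>. (S \<omega>)\<^sup>2) = (\<Sum>s=1..int n. \<Sum>t=1..int n. expectation (\<lambda>\<omega>. g s \<omega> * g t \<omega>))"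
      unfolding S2 by (simp add: int_gg)
    also have "\<dots> \<le> (\<Sum>s=1..int n. \<Sum>t=1..int n. m\<^sup>2 + C0 * \<rho> ^ nat \<bar>s - t\<bar> * Q)"
      by (intro sum_mono Egg)
    also have "\<dots> = (\<Sum>s=1..int n. real n * m\<^sup>2 + C0 * Q * (\<Sum>t=1..int n. \<rho> ^ nat \<bar>s - t\<bar>))"
      by (simp add: sum.distrib sum_distrib_left mult_ac)
    also have "\<dots> \<le> (\<Sum>s=1..int n. real n * m\<^sup>2 + C0 * Q * (2 / (1 - \<rho>)))"
      using C0 Q by (intro sum_mono add_left_mono mult_left_mono sum_power_dist_le) auto
    also have "\<dots> = (real n * m)\<^sup>2 + C * real n * Q"
      using C0 by (simp add: C_def power2_eq_square algebra_simps)
    finally have "expectation (\<lambda>\<omega>. (S \<omega>)\<^sup>2) - (expectation S)\<^sup>2 \<le> C * real n * Q"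
      by (simp add: ES)
    then have var: "variance S \<le> C * real n * Q"
      using variance_eq[OF int_S int_S2] by simp
    have "prob {\<omega> \<in> space M. a \<le> \<bar>S \<omega> - expectation S\<bar>} \<le> variance S / a\<^sup>2"
      by (rule Chebyshev_inequality) (use int_S2 a in auto)
    also have "\<dots> \<le> C * real n * Q / a\<^sup>2"
      using var by (intro divide_right_mono) auto
    finally show ?thesis by (simp add: ES S_def g_def Q_def)
  qed
  note bound = this
  show ?thesis
    by (intro exI[of _ C] conjI allI impI C, rule bound, assumption+)
qed

lemma ereal_quotient_le: "0 < b \<Longrightarrow> a / b \<le> d \<Longrightarrow> ereal a / ereal b \<le> ereal d"
  by simp

lemma ereal_quotient_nonneg: "0 \<le> a \<Longrightarrow> 0 \<le> b \<Longrightarrow> 0 \<le> ereal a / ereal b"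
  unfolding divide_ereal_def by (intro ereal_0_le_mult) (auto simp: ereal_inverse_nonneg_iff)

lemma limsup_nonneg: "(\<And>n. 0 \<le> f n) \<Longrightarrow> 0 \<le> limsup (f :: nat \<Rightarrow> ereal)"
  using Limsup_mono[of "\<lambda>_. 0" f sequentially] by (simp add: Limsup_const)

lemma no_late_exceedance:
  fixes x :: "nat \<Rightarrow> real"
  assumes x: "filterlim x at_top sequentially" and nx: "(\<lambda>n. real n * x n powr - \<alpha>) \<longlonglongrightarrow> 0"
    and \<epsilon>: "\<epsilon> > 0"
  shows "(\<lambda>s::nat. limsup (\<lambda>n::nat.
      ereal (\<P>(\<omega> in M. block_max N X (int s) (int n) \<omega> > \<epsilon> * x n \<bar> N (X 1 \<omega>) > \<epsilon> * x n)))) \<longlonglongrightarrow> 0"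
proof -
  obtain D \<rho> where D: "D > 0" "0 < \<rho>" "\<rho> < 1" and bound: "\<And>u s n. u \<ge> 1 \<Longrightarrow> 1 \<le> s \<Longrightarrow> s \<le> n \<Longrightarrow>
     \<P>(\<omega> in M. block_max N X (int s) (int n) \<omega> > u \<bar> N (X 1 \<omega>) > u) \<le> D * (\<rho> ^ s + real n * u powr - \<alpha>)"
    using exceed_after by blast
  let ?f = "\<lambda>s n. ereal (\<P>(\<omega> in M. block_max N X (int s) (int n) \<omega> > \<epsilon> * x n \<bar> N (X 1 \<omega>) > \<epsilon> * x n))"
  have upper: "limsup (?f s) \<le> ereal (D * \<rho> ^ s)" if s: "s \<ge> 1" for s
  proof -
    have "(\<lambda>n. D * (\<rho> ^ s + \<epsilon> powr - \<alpha> * (real n * x n powr - \<alpha>))) \<longlonglongrightarrow> D * (\<rho> ^ s + \<epsilon> powr - \<alpha> * 0)"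
      by (intro tendsto_intros nx)
    then have lim: "(\<lambda>n. ereal (D * (\<rho> ^ s + \<epsilon> powr - \<alpha> * (real n * x n powr - \<alpha>)))) \<longlonglongrightarrow> ereal (D * \<rho> ^ s)"
      by simp
    have "\<forall>\<^sub>F n in sequentially. 1 / \<epsilon> \<le> x n"
      using x unfolding filterlim_at_top by blast
    then have "\<forall>\<^sub>F n in sequentially. ?f s n \<le> ereal (D * (\<rho> ^ s + \<epsilon> powr - \<alpha> * (real n * x n powr - \<alpha>)))"
      using eventually_ge_at_top[of s]
    proof eventually_elim
      case (elim n)
      then have "1 \<le> \<epsilon> * x n" using \<epsilon> by (simp add: field_simps)
      then show ?case using bound[of "\<epsilon> * x n" s n] s elim by (simp add: powr_mult mult_ac)
    qed
    then have "limsup (?f s) \<le> limsup (\<lambda>n. ereal (D * (\<rho> ^ s + \<epsilon> powr - \<alpha> * (real n * x n powr - \<alpha>))))"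
      by (rule Limsup_mono)
    also have "\<dots> = ereal (D * \<rho> ^ s)"
      by (rule lim_imp_Limsup[OF _ lim]) simp
    finally show ?thesis .
  qed
  show ?thesis
  proof (rule tendsto_sandwich[where f="\<lambda>_. 0" and h="\<lambda>s. ereal (D * \<rho> ^ s)"])
    show "\<forall>\<^sub>F s in sequentially. 0 \<le> limsup (?f s)"
      by (intro always_eventually allI limsup_nonneg) (simp add: cond_prob_def)
    show "\<forall>\<^sub>F s in sequentially. limsup (?f s) \<le> ereal (D * \<rho> ^ s)"
      using eventually_ge_at_top[of 1] by eventually_elim (rule upper)
    have "(\<lambda>s. D * \<rho> ^ s) \<longlonglongrightarrow> D * 0"
      using D by (intro tendsto_intros LIMSEQ_realpow_zero) auto
    then show "(\<lambda>s. ereal (D * \<rho> ^ s)) \<longlonglongrightarrow> 0"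
      by (simp add: zero_ereal_def)
  qed simp
qed

text \<open>
  The mean of the truncated sum tends to zero, so exceeding \<open>\<delta>\<close> is a deviation from the mean. By
  Chebyshev its probability is, relative to the tail at \<open>x n\<close>, at most of the order of
  \<open>\<epsilon> powr (2 * p - \<alpha>)\<close> plus a term that vanishes with \<open>n\<close>.
\<close>

lemma small_values_negligible:
  fixes x :: "nat \<Rightarrow> real"
  assumes p: "0 < p" "\<alpha> < 2 * p" and x: "filterlim x at_top sequentially"
    and r': "0 < r'" "r' \<le> p" "r' < \<alpha>" and nx: "(\<lambda>n. real n * x n powr - r') \<longlonglongrightarrow> 0"
    and \<delta>: "\<delta> > 0"
  shows "((\<lambda>\<epsilon>. limsup (\<lambda>n::nat.
         ereal (\<P>(\<omega> in M. (\<Sum>t = 1..int n. N (X t \<omega> /\<^sub>R x n) powr p * of_bool (N (X t \<omega>) \<le> \<epsilon> * x n)) > \<delta>))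
         / ereal (real n * \<P>(\<omega> in M. N (X 1 \<omega>) > x n)))) \<longlongrightarrow> 0) (at_right 0)"
proof -
  let ?P = "\<lambda>\<epsilon> n. \<P>(\<omega> in M. (\<Sum>t = 1..int n. N (X t \<omega> /\<^sub>R x n) powr p * of_bool (N (X t \<omega>) \<le> \<epsilon> * x n)) > \<delta>)"
  let ?q = "\<lambda>n. \<P>(\<omega> in M. N (X 1 \<omega>) > x n)"
  obtain K where K: "K \<ge> 1" "\<And>y. N y \<le> K * vnorm y"
    using N_equiv by blast
  obtain C0 where C0: "C0 > 0" and dev: "\<forall>x>0. \<forall>e>0. \<forall>m\<ge>0. \<forall>a>0. \<forall>n::nat. (\<integral>\<^sup>+y. ennreal (trunc p x e y) \<partial>\<nu>) = ennreal m \<longrightarrow>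
     \<P>(\<omega> in M. a \<le> \<bar>(\<Sum>t=1..int n. trunc p x e (X t \<omega>)) - real n * m\<bar>)
      \<le> C0 * real n * (m\<^sup>2 + e powr (2 * p - \<alpha>) * x powr - \<alpha>) / a\<^sup>2"
    using trunc_sum_deviation[OF p] by (elim exE conjE) (rule that, assumption+)
  (* The order r' makes the expected sum vanish; the order r > alpha / 2 makes the square of a
     single mean negligible against the tail. *)
  define r where "r = (\<alpha> / 2 + min p \<alpha>) / 2"
  have r: "0 \<le> r" "r \<le> p" "r < \<alpha>" "\<alpha> < 2 * r"
    using p \<alpha>_pos by (auto simp: r_def min_def)
  obtain C1 where C1: "C1 > 0" and mean1: "\<And>x e. x > 0 \<Longrightarrow> e > 0 \<Longrightarrow> (\<integral>\<^sup>+y. ennreal (trunc p x e y) \<partial>\<nu>) \<le> ennreal (C1 * e powr (p - r') * x powr - r')"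
    using c.trunc_mean_le[of r' p] r' by auto
  obtain C2 where C2: "C2 > 0" and mean2: "\<And>x e. x > 0 \<Longrightarrow> e > 0 \<Longrightarrow> (\<integral>\<^sup>+y. ennreal (trunc p x e y) \<partial>\<nu>) \<le> ennreal (C2 * e powr (p - r) * x powr - r)"
    using c.trunc_mean_le[of r p] r by auto
  obtain c where c: "c > 0" "\<And>u. u \<ge> 1 \<Longrightarrow> c * u powr - \<alpha> \<le> \<P>(\<omega> in M. N (X 1 \<omega>) > u)"
    using N_tail_ge by blast
  define \<delta>' where "\<delta>' = \<delta> / K powr p"
  have \<delta>': "\<delta>' > 0" using \<delta> K by (simp add: \<delta>'_def)
  define D where "D = 4 * C0 / (\<delta>'\<^sup>2 * c)"
  have D: "D > 0" using C0 \<delta>' c by (simp add: D_def)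
  have dom: "N (y /\<^sub>R s) powr p * of_bool (N y \<le> e * s) \<le> K powr p * trunc p s e y" if "s > 0" "e > 0" for s e y
  proof (cases "N y \<le> e * s")
    case True
    have "N (y /\<^sub>R s) = N y / s"
      using that by (simp add: is_norm_simps(2)[OF N] divide_inverse mult.commute)
    also have "\<dots> \<le> K * min (vnorm y / s) e"
    proof -
      have "N y / s \<le> K * (vnorm y / s)"
        using K(2)[of y] that by (simp add: divide_right_mono)
      moreover have "N y / s \<le> e" using True that by (simp add: field_simps)
      then have "N y / s \<le> K * e"
        using K(1) that mult_right_mono[of 1 K e] by linarith
      ultimately show ?thesis by (simp add: min_def)
    qed
    finally have "N (y /\<^sub>R s) powr p \<le> (K * min (vnorm y / s) e) powr p"
      using p is_norm_nonneg[OF N] by (intro powr_mono2) auto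
    then show ?thesis using True by (simp add: trunc_def powr_mult)
  qed simp
  have upper: "limsup (\<lambda>n. ereal (?P e n) / ereal (real n * ?q n)) \<le> ereal (D * e powr (2 * p - \<alpha>))" if e: "e > 0" for e
  proof -
    have "((\<lambda>n. D * (C2\<^sup>2 * e powr (2 * (p - r)) * x n powr (\<alpha> - 2 * r) + e powr (2 * p - \<alpha>))) \<longlongrightarrow>
        D * (C2\<^sup>2 * e powr (2 * (p - r)) * 0 + e powr (2 * p - \<alpha>))) sequentially"
      using r x by (intro tendsto_intros tendsto_neg_powr) auto
    then have lim: "(\<lambda>n. ereal (D * (C2\<^sup>2 * e powr (2 * (p - r)) * x n powr (\<alpha> - 2 * r) + e powr (2 * p - \<alpha>)))) \<longlonglongrightarrow> ereal (D * e powr (2 * p - \<alpha>))"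
      by simp
    have "(\<lambda>n. C1 * e powr (p - r') * (real n * x n powr - r')) \<longlonglongrightarrow> C1 * e powr (p - r') * 0"
      by (intro tendsto_intros nx)
    then have "\<forall>\<^sub>F n in sequentially. C1 * e powr (p - r') * (real n * x n powr - r') < \<delta>' / 2"
      using \<delta>' by (intro order_tendstoD(2)) auto
    moreover have "\<forall>\<^sub>F n in sequentially. 1 \<le> x n"
      using x unfolding filterlim_at_top by blast
    ultimately have "\<forall>\<^sub>F n in sequentially. ereal (?P e n) / ereal (real n * ?q n)
        \<le> ereal (D * (C2\<^sup>2 * e powr (2 * (p - r)) * x n powr (\<alpha> - 2 * r) + e powr (2 * p - \<alpha>)))"
      using eventually_ge_at_top[of 1]
    proof eventually_elim
      case (elim n)
      have xn: "x n > 0" using elim by simp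
      obtain m where m: "m \<ge> 0" "(\<integral>\<^sup>+y. ennreal (trunc p (x n) e y) \<partial>\<nu>) = ennreal m"
        using mean1[OF xn e] by (cases "\<integral>\<^sup>+y. ennreal (trunc p (x n) e y) \<partial>\<nu>") (auto simp: top_unique)
      have m1: "m \<le> C1 * e powr (p - r') * x n powr - r'"
        using mean1[OF xn e] C1 unfolding m by (subst (asm) ennreal_le_iff) auto
      have m2: "m \<le> C2 * e powr (p - r) * x n powr - r"
        using mean2[OF xn e] C2 unfolding m by (subst (asm) ennreal_le_iff) auto
      have nm: "real n * m \<le> \<delta>' / 2"
      proof -
        have "real n * m \<le> real n * (C1 * e powr (p - r') * x n powr - r')"
          by (intro mult_left_mono m1) simp
        also have "\<dots> = C1 * e powr (p - r') * (real n * x n powr - r')"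
          by (simp only: mult_ac)
        finally show ?thesis using elim(1) by linarith
      qed
      have "?P e n \<le> \<P>(\<omega> in M. \<delta>' / 2 \<le> \<bar>(\<Sum>t=1..int n. trunc p (x n) e (X t \<omega>)) - real n * m\<bar>)"
      proof (intro finite_measure_mono subsetI)
        fix \<omega> assume w: "\<omega> \<in> {\<omega> \<in> space M. (\<Sum>t = 1..int n. N (X t \<omega> /\<^sub>R x n) powr p * of_bool (N (X t \<omega>) \<le> e * x n)) > \<delta>}"
        then have "\<delta> < (\<Sum>t = 1..int n. N (X t \<omega> /\<^sub>R x n) powr p * of_bool (N (X t \<omega>) \<le> e * x n))" by simp
        also have "\<dots> \<le> (\<Sum>t = 1..int n. K powr p * trunc p (x n) e (X t \<omega>))"
          by (intro sum_mono dom xn e)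
        also have "\<dots> = K powr p * (\<Sum>t = 1..int n. trunc p (x n) e (X t \<omega>))"
          by (simp add: sum_distrib_left)
        finally have "\<delta>' < (\<Sum>t = 1..int n. trunc p (x n) e (X t \<omega>))"
          using K by (simp add: \<delta>'_def field_simps)
        then have "\<delta>' / 2 \<le> \<bar>(\<Sum>t=1..int n. trunc p (x n) e (X t \<omega>)) - real n * m\<bar>"
          using nm by linarith
        then show "\<omega> \<in> {\<omega> \<in> space M. \<delta>' / 2 \<le> \<bar>(\<Sum>t=1..int n. trunc p (x n) e (X t \<omega>)) - real n * m\<bar>}"
          using w by simp
      qed measurable
      also have "\<dots> \<le> C0 * real n * (m\<^sup>2 + e powr (2 * p - \<alpha>) * x n powr - \<alpha>) / (\<delta>' / 2)\<^sup>2"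
        using \<delta>' by (intro dev[rule_format] xn e m) auto
      also have "\<dots> \<le> C0 * real n * ((C2 * e powr (p - r) * x n powr - r)\<^sup>2 + e powr (2 * p - \<alpha>) * x n powr - \<alpha>) / (\<delta>' / 2)\<^sup>2"
        using C0 m m2 by (intro divide_right_mono mult_left_mono add_right_mono power_mono) auto
      finally have num: "?P e n \<le> C0 * real n * ((C2 * e powr (p - r) * x n powr - r)\<^sup>2 + e powr (2 * p - \<alpha>) * x n powr - \<alpha>) / (\<delta>' / 2)\<^sup>2" .
      have q: "c * x n powr - \<alpha> \<le> ?q n" using elim by (intro c) simp
      have xa: "0 < x n powr - \<alpha>" using xn by simp
      have qpos: "0 < real n * (c * x n powr - \<alpha>)" using c xa elim by simp
      have "?P e n / (real n * ?q n) \<le> (C0 * real n * ((C2 * e powr (p - r) * x n powr - r)\<^sup>2 + e powr (2 * p - \<alpha>) * x n powr - \<alpha>) / (\<delta>' / 2)\<^sup>2) / (real n * (c * x n powr - \<alpha>))"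
        using num qpos C0 by (intro frac_le mult_left_mono q) auto
      also have "(C2 * e powr (p - r) * x n powr - r)\<^sup>2 = C2\<^sup>2 * e powr (2 * (p - r)) * x n powr (\<alpha> - 2 * r) * x n powr - \<alpha>"
      proof -
        have 1: "(e powr (p - r))\<^sup>2 = e powr (2 * (p - r))"
          using e by (simp add: power2_eq_square flip: powr_add)
        have 2: "(x n powr - r)\<^sup>2 = x n powr (\<alpha> - 2 * r) * x n powr - \<alpha>"
          using xn by (simp add: power2_eq_square flip: powr_add)
        show ?thesis unfolding power_mult_distrib 1 2 by (simp only: mult.assoc)
      qed
      also have "(C0 * real n * (C2\<^sup>2 * e powr (2 * (p - r)) * x n powr (\<alpha> - 2 * r) * x n powr - \<alpha> + e powr (2 * p - \<alpha>) * x n powr - \<alpha>) / (\<delta>' / 2)\<^sup>2) / (real n * (c * x n powr - \<alpha>))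
          = D * (C2\<^sup>2 * e powr (2 * (p - r)) * x n powr (\<alpha> - 2 * r) + e powr (2 * p - \<alpha>))"
      proof -
        have "(C0 * real n * (G * U + H * U) / (\<delta>' / 2)\<^sup>2) / (real n * (c * U)) = D * (G + H)" if "U > 0" for G H U :: real
          using that c \<delta>' elim by (simp add: D_def power_divide field_simps)
        from this[OF xa] show ?thesis .
      qed
      finally have "?P e n / (real n * ?q n) \<le> D * (C2\<^sup>2 * e powr (2 * (p - r)) * x n powr (\<alpha> - 2 * r) + e powr (2 * p - \<alpha>))" .
      moreover have "real n * ?q n > 0"
        using qpos mult_left_mono[OF q, of "real n"] by linarith
      ultimately show ?case by (intro ereal_quotient_le)
    qed
    then have "limsup (\<lambda>n. ereal (?P e n) / ereal (real n * ?q n)) \<le> limsup (\<lambda>n. ereal (D * (C2\<^sup>2 * e powr (2 * (p - r)) * x n powr (\<alpha> - 2 * r) + e powr (2 * p - \<alpha>))))"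
      by (rule Limsup_mono)
    also have "\<dots> = ereal (D * e powr (2 * p - \<alpha>))"
      by (rule lim_imp_Limsup[OF _ lim]) simp
    finally show ?thesis .
  qed
  show ?thesis
  proof (rule tendsto_sandwich[where f="\<lambda>_. 0" and h="\<lambda>e. ereal (D * e powr (2 * p - \<alpha>))"])
    show "\<forall>\<^sub>F e in at_right 0. 0 \<le> limsup (\<lambda>n. ereal (?P e n) / ereal (real n * ?q n))"
      by (intro always_eventually allI limsup_nonneg ereal_quotient_nonneg) auto
    show "\<forall>\<^sub>F e in at_right 0. limsup (\<lambda>n. ereal (?P e n) / ereal (real n * ?q n)) \<le> ereal (D * e powr (2 * p - \<alpha>))"
      using eventually_at_right_less[of 0] by eventually_elim (rule upper)
    have "((\<lambda>e. e powr (2 * p - \<alpha>)) \<longlongrightarrow> 0 powr (2 * p - \<alpha>)) (at_right (0::real))"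
      using p by (intro tendsto_powr') (auto simp: eventually_at_right_less intro!: tendsto_intros eventually_mono[OF eventually_at_right_less[of "0::real"]])
    then have "((\<lambda>e. D * e powr (2 * p - \<alpha>)) \<longlongrightarrow> D * 0) (at_right (0::real))"
      by (intro tendsto_intros) simp
    then show "((\<lambda>e. ereal (D * e powr (2 * p - \<alpha>))) \<longlongrightarrow> 0) (at_right 0)"
      by (simp add: zero_ereal_def)
  qed simp
qed

end

theorem proposition5p8:
  fixes M :: "'w measure"
    and N :: "real^'d \<Rightarrow> real"
    and A :: "int \<Rightarrow> 'w \<Rightarrow> real^'d^'d"
    and B :: "int \<Rightarrow> 'w \<Rightarrow> real^'d"
    and X :: "int \<Rightarrow> 'w \<Rightarrow> real^'d"
    and \<alpha> p :: real
    and x :: "nat \<Rightarrow> real"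
  assumes "prob_space M"
    and "is_norm N"
    and "iid_sequence M (\<lambda>t \<omega>. (A t \<omega>, B t \<omega>))"
    and "nonneg_entries M (A 0) (B 0)"
    and "K1 M N (A 0) (B 0)"
    and "K2 M N A"
    and "K3 M (A 0) (B 0)"
    and "K4 M N (A 0)"
    and "K5 M N (A 0)"
    and "K6 M N (A 0)"
    and "K7 M N A (B 0) \<alpha>"
    and "causal_stationary_solution M A B X"
    and "p > \<alpha> / 2"
    and "\<And>n. n \<ge> 1 \<Longrightarrow> x n > 0"
    and "\<exists>\<kappa>'>0. \<kappa>' < \<alpha> \<and> (\<lambda>n. real n / x n powr min p (\<alpha> - \<kappa>')) \<longlonglongrightarrow> 0"
  shows "(\<forall>\<epsilon>>0.
            (\<lambda>s::nat. limsup (\<lambda>n::nat.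
               ereal (\<P>(\<omega> in M. block_max N X (int s) (int n) \<omega> > \<epsilon> * x n \<bar> N (X 1 \<omega>) > \<epsilon> * x n))))
              \<longlonglongrightarrow> 0) \<and>
         (\<forall>\<delta>>0.
            ((\<lambda>\<epsilon>. limsup (\<lambda>n::nat.
               ereal (\<P>(\<omega> in M. (\<Sum>t = 1..int n.
                          N (X t \<omega> /\<^sub>R x n) powr p * of_bool (N (X t \<omega>) \<le> \<epsilon> * x n)) > \<delta>))
               / ereal (real n * \<P>(\<omega> in M. N (X 1 \<omega>) > x n))))
              \<longlongrightarrow> 0) (at_right 0))"
proof -
  interpret affine_process M N A B X \<alpha>
    by (intro affine_process.intro affine_process_axioms.intro assms)
  obtain \<kappa>' where \<kappa>': "\<kappa>' > 0" "\<kappa>' < \<alpha>" and lim: "(\<lambda>n. real n / x n powr min p (\<alpha> - \<kappa>')) \<longlonglongrightarrow> 0"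
    using assms(15) by blast
  define r where "r = min p (\<alpha> - \<kappa>')"
  have p: "0 < p" "\<alpha> < 2 * p" using assms(13) \<alpha>_pos by auto
  have r: "0 < r" "r \<le> p" "r < \<alpha>" using p \<kappa>' by (auto simp: r_def)
  have nr: "(\<lambda>n. real n * x n powr - r) \<longlonglongrightarrow> 0"
    using lim by (simp add: r_def powr_minus divide_inverse)
  have x_top: "filterlim x at_top sequentially"
    unfolding filterlim_at_top
  proof
    fix Z :: real
    have "\<forall>\<^sub>F n in sequentially. real n * x n powr - r < 1"
      using nr by (rule order_tendstoD(2)) simp
    moreover have "\<forall>\<^sub>F n in sequentially. (max Z 1) powr r \<le> real n"
      using filterlim_real_sequentially unfolding filterlim_at_top by blast
    ultimately show "\<forall>\<^sub>F n in sequentially. Z \<le> x n"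
      using eventually_ge_at_top[of 1]
    proof eventually_elim
      case (elim n)
      have xn: "x n > 0" using elim by (intro assms(14))
      have "real n < x n powr r"
        using elim(1) xn by (simp add: powr_minus field_simps)
      then have "(max Z 1) powr r < x n powr r" using elim by linarith
      then have "max Z 1 < x n"
        using r xn by (metis less_max_iff_disj linorder_not_le powr_mono2 less_imp_le)
      then show ?case by simp
    qed
  qed
  have na: "(\<lambda>n. real n * x n powr - \<alpha>) \<longlonglongrightarrow> 0"
  proof (rule tendsto_sandwich[OF _ _ tendsto_const nr])
    have "\<forall>\<^sub>F n in sequentially. 1 \<le> x n"
      using x_top unfolding filterlim_at_top by blast
    then show "\<forall>\<^sub>F n in sequentially. real n * x n powr - \<alpha> \<le> real n * x n powr - r"
      by eventually_elim (use r in \<open>auto intro!: mult_left_mono powr_mono\<close>)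
  qed simp
  show ?thesis
    using no_late_exceedance[OF x_top na] small_values_negligible[OF p x_top r nr] by blast
qed

end
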